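(* Let $k\in\mathbb{N}$ be fixed, let $p\in[1,\infty)$, and for each integer $n\ge k$ let $X_p^{(n)}$ be a random vector in $\mathbb{R}^n$ such that either $X_p^{(n)}\sim P^{(n)}_{p,R^{(n)}}$ for some random variable $R^{(n)}$ with values almost surely in $(0,\infty)$, or $X_p^{(n)}\sim\sigma_p^{(n)}$. Then $$\lim_{n\to\infty}\mathbb{P}\bigl[S^{(n)}_{n,p}(X_p^{(n)})\ge\mathrm{e}^{m_p}\,S^{(n)}_{k,p}(X_p^{(n)})\bigr]=\frac12.$$
   Context: For $x\in\mathbb{R}^n$ and $p\in[1,\infty)$ let $\|x\|_p=(\sum_{i=1}^n|x_i|^p)^{1/p}$, $\mathbb{B}_p^n=\{x\in\mathbb{R}^n:\|x\|_p\le1\}$, $\mathbb{S}_p^{n-1}=\{x\in\mathbb{R}^n:\|x\|_p=1\}$. Cone measure: $\mu_p^{(n)}(A)=\lambda^{(n)}(\{ra:r\in[0,1],a\in A\})/\lambda^{(n)}(\mathbb{B}_p^n)$ for Borel $A\subset\mathbb{S}_p^{n-1}$, with $\lambda^{(n)}$ Lebesgue measure. Surface measure $\sigma_p^{(n)}$: the normalized (to total mass 1) $(n-1)$-dimensional Hausdorff measure on $\mathbb{S}_p^{n-1}$. For a random variable $R^{(n)}$ taking values a.s. in $(0,\infty)$, $P^{(n)}_{p,R^{(n)}}$ is the distribution of $R^{(n)}\Theta$, where $\Theta\sim\mu_p^{(n)}$ is independent of $R^{(n)}$. For $x\in\mathbb{R}^n$ and $1\le k\le n$ let $$S^{(n)}_{k,p}(x)=\Bigl(\tbinom{n}{k}^{-1}\sum_{1\le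 i_1<\dots<i_k\le n}|x_{i_1}|^p\cdots|x_{i_k}|^p\Bigr)^{1/(kp)}.$$ The $p$-Gaussian distribution has Lebesgue density $x\mapsto \frac{1}{2p^{1/p}\Gamma(1+1/p)}\mathrm{e}^{-|x|^p/p}$ on $\mathbb{R}$. For $X$ a $p$-Gaussian random variable, $m_p=\mathbb{E}[\log|X|]$. *)

theory Defs
  imports "HOL-Probability.Probability"
begin

text \<open>
  Since the dimension tends to infinity, a point of \<open>\<real>\<^sup>n\<close> is an extensional function on
  the index set \<open>{..<n}\<close>, i.e. the coordinates \<open>x\<^sub>1, \<dots>, x\<^sub>n\<close> are \<open>x 0, \<dots>, x (n - 1)\<close>.
  The measure below is Lebesgue measure on the Borel sets; as the target of a random vector
  only its space and its sigma-algebra matter.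
\<close>

definition leb :: "nat \<Rightarrow> (nat \<Rightarrow> real) measure" where
  "leb n = (\<Pi>\<^sub>M i\<in>{..<n}. lborel)"

definition lp_norm :: "real \<Rightarrow> nat \<Rightarrow> (nat \<Rightarrow> real) \<Rightarrow> real" where
  "lp_norm p n x = (\<Sum>i<n. \<bar>x i\<bar> powr p) powr (1 / p)"

definition lp_ball :: "real \<Rightarrow> nat \<Rightarrow> (nat \<Rightarrow> real) set" where
  "lp_ball p n = {x \<in> space (leb n). lp_norm p n x \<le> 1}"

definition lp_sphere :: "real \<Rightarrow> nat \<Rightarrow> (nat \<Rightarrow> real) set" where
  "lp_sphere p n = {x \<in> space (leb n). lp_norm p n x = 1}"

definition scale_vec :: "nat \<Rightarrow> real \<Rightarrow> (nat \<Rightarrow> real) \<Rightarrow> (nat \<Rightarrow> real)" where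
  "scale_vec n r x = (\<lambda>i\<in>{..<n}. r * x i)"

definition cone :: "nat \<Rightarrow> (nat \<Rightarrow> real) set \<Rightarrow> (nat \<Rightarrow> real) set" where
  "cone n A = {scale_vec n r a | r a. r \<in> {0..1} \<and> a \<in> A}"

text \<open>
  The cone measure and the surface measure live on the sphere. Both are represented as Borel
  measures on all of \<open>\<real>\<^sup>n\<close> that give no mass to the complement of the sphere, so that they can
  be compared with the law of a random vector in \<open>\<real>\<^sup>n\<close>.
\<close>

definition cone_measure :: "real \<Rightarrow> nat \<Rightarrow> (nat \<Rightarrow> real) measure" where
  "cone_measure p n = measure_of (space (leb n)) (sets (leb n))
     (\<lambda>A. emeasure (leb n) (cone n (A \<inter> lp_sphere p n)) / emeasure (leb n) (lp_ball p n))"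

definition ediam :: "('a \<Rightarrow> 'a \<Rightarrow> real) \<Rightarrow> 'a set \<Rightarrow> ennreal" where
  "ediam d U = (SUP x\<in>U. SUP y\<in>U. ennreal (d x y))"

text \<open>
  The \<open>s\<close>-dimensional Hausdorff outer measure of a metric \<open>d\<close>. The empty set contributes \<open>0\<close>
  to a cover also for \<open>s = 0\<close>, where every nonempty set contributes \<open>1\<close>, so that the
  0-dimensional Hausdorff measure is the counting measure. The usual dimensional constant is
  omitted: it cancels in the normalization below.
\<close>

definition hausdorff_pre :: "('a \<Rightarrow> 'a \<Rightarrow> real) \<Rightarrow> nat \<Rightarrow> real \<Rightarrow> 'a set \<Rightarrow> ennreal" where
  "hausdorff_pre d s \<delta> A =
     (INF U\<in>{U :: nat \<Rightarrow> 'a set. A \<subseteq> (\<Union>i. U i) \<and> (\<forall>i. ediam d (U i) \<le> ennreal \<delta>)}.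
        \<Sum>i. if U i = {} then 0 else ediam d (U i) ^ s)"

definition hausdorff :: "('a \<Rightarrow> 'a \<Rightarrow> real) \<Rightarrow> nat \<Rightarrow> 'a set \<Rightarrow> ennreal" where
  "hausdorff d s A = (SUP \<delta>\<in>{0<..}. hausdorff_pre d s \<delta> A)"

definition euclid_dist :: "nat \<Rightarrow> (nat \<Rightarrow> real) \<Rightarrow> (nat \<Rightarrow> real) \<Rightarrow> real" where
  "euclid_dist n x y = sqrt (\<Sum>i<n. (x i - y i)\<^sup>2)"

definition surface_measure :: "real \<Rightarrow> nat \<Rightarrow> (nat \<Rightarrow> real) measure" where
  "surface_measure p n = measure_of (space (leb n)) (sets (leb n))
     (\<lambda>A. hausdorff (euclid_dist n) (n - 1) (A \<inter> lp_sphere p n)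
            / hausdorff (euclid_dist n) (n - 1) (lp_sphere p n))"

text \<open>
  The law of \<open>R \<Theta>\<close>, for a random variable \<open>R\<close> on the probability space \<open>N\<close>. The product with
  the cone measure adjoins to \<open>N\<close> a \<open>\<Theta>\<close> (the second projection) that is distributed according
  to the cone measure and independent of \<open>R\<close>.
\<close>

definition radial_law :: "real \<Rightarrow> nat \<Rightarrow> 'b measure \<Rightarrow> ('b \<Rightarrow> real) \<Rightarrow> (nat \<Rightarrow> real) measure" where
  "radial_law p n N R =
     distr (N \<Otimes>\<^sub>M cone_measure p n) (leb n) (\<lambda>(\<omega>, \<theta>). scale_vec n (R \<omega>) \<theta>)"

definition sym_mean :: "nat \<Rightarrow> nat \<Rightarrow> real \<Rightarrow> (nat \<Rightarrow> real) \<Rightarrow> real" where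
  "sym_mean n k p x =
     ((\<Sum>I | I \<subseteq> {..<n} \<and> card I = k. \<Prod>i\<in>I. \<bar>x i\<bar> powr p) / real (n choose k))
       powr (1 / (real k * p))"

definition p_gaussian :: "real \<Rightarrow> real measure" where
  "p_gaussian p = density lborel
     (\<lambda>x. ennreal (1 / (2 * p powr (1 / p) * Gamma (1 + 1 / p)) * exp (- (\<bar>x\<bar> powr p) / p)))"

definition log_moment :: "real \<Rightarrow> real" where
  "log_moment p = (LINT x|p_gaussian p. ln \<bar>x\<bar>)"

end

theory Submission
  imports Defs
begin

text \<open>
  The event is invariant under scaling, so under the radial laws its probability is that of the same event for
  a vector \<open>G\<close> of independent p-Gaussians: in polar coordinates both are proportional to the Lebesgue
  measure of the part of the ball in the cone. By Newton's recursion the logarithm of the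
  normalized elementary symmetric polynomial of \<open>|G\<^sub>1|\<^sup>p, \<dots>, |G\<^sub>n|\<^sup>p\<close> is \<open>k\<close> times the
  logarithm of their mean up to \<open>O(1/n)\<close>, so the event says that the normalized sum of the centred variables
  \<open>ln |G\<^sub>i| - m\<^sub>p - (|G\<^sub>i|\<^sup>p - 1) / p\<close> is at least \<open>o(1)\<close>, and the central limit theorem gives \<open>1/2\<close>.

  The surface measure has a density proportional to the Euclidean norm of the gradient of the p-norm
  with respect to the cone measure. Locally the central projection onto the tangent hyperplane is almost
  isometric and almost preserves the volume of the cone below a set; on hyperplanes, the Hausdorff measure is a constant
  multiple of the Lebesgue measure, and reflections reduce all hyperplanes to one. In terms of \<open>G\<close> the surface
  measure thus weights the event with \<open>(\<Sum>|G\<^sub>i|\<^sup>2\<^sup>p\<^sup>-\<^sup>2)\<^sup>1\<^sup>/\<^sup>2\<close>, which divided by \<open>\<surd>n\<close> converges to a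
  constant in \<open>L\<^sup>1\<close>.
\<close>

section \<open>Moments of the p-Gaussian distribution\<close>

text \<open>The linear term in the summands arises because the p-Gaussian scaling gives |G|^p the
  mean 1: the logarithm of the average of the |G_i|^p is its deviation from 1 up to a square of
  order 1/n, and the exponent \<open>1 / (k * p)\<close> leaves a division by \<open>p\<close>, so
  that \<open>k\<close> only affects the remainder.

  Two obstacles shape the geometric half. The surface measure is built from an outer measure; that
  it is additive, positive and finite on the sphere is extracted from the hypothesis that its
  normalization is the law of a random vector. And where a coordinate vanishes the power sum need
  not be differentiable, so charts are built off the coordinate hyperplanes, which are shown to be
  null. The charts distort by factors close to 1, countably many dyadic cubes carry the comparison
  to all Borel sets, and the factor is then sent to 1. The weight is the gradient norm because a
  tangent plane lies at distance \<open>1 / grad_norm\<close> from the origin and a cone has volume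
  base times height over \<open>n\<close>.\<close>

lemma has_integral_powr_exp_pos:
  fixes p s :: real
  assumes p: "1 \<le> p" and s: "-1 < s"
  shows "((\<lambda>x. x powr s * exp (- (x powr p) / p)) has_integral (p powr ((s + 1) / p - 1) * Gamma ((s + 1) / p))) {0<..}"
proof -
  \<comment> \<open>The exponent for which the substitution \<open>t = x powr p / p\<close> turns
    the Gamma integral into the present one.\<close>
  define a where "a = (s + 1) / p"
  have a: "0 < a" using p s by (simp add: a_def)
  let ?f = "\<lambda>t. t powr (a - 1) / exp t" and ?g = "\<lambda>x. x powr p / p" and ?g' = "\<lambda>x::real. x powr (p - 1)"
  have "(?f has_integral Gamma a) {0..}" by (rule Gamma_integral_real[OF a])
  \<comment> \<open>The substitution is made on the open half-line, so the endpoint 0 is removed as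
    a null set.\<close>
  then have F: "(?f has_integral Gamma a) {0<..}"
  proof -
    assume "(?f has_integral Gamma a) {0..}"
    then have "((\<lambda>t. if t \<in> {0<..} then ?f t else 0) has_integral Gamma a) {0..}"
      by (rule has_integral_spike[of "{0}", rotated 2]) auto
    then show ?thesis by (subst (asm) has_integral_restrict) auto
  qed
  then have Fabs: "?f absolutely_integrable_on {0<..}"
    by (intro nonnegative_absolutely_integrable_1) (auto simp: integrable_on_def)
  have img: "?g ` {0<..} = {0<..}"
  proof (intro subset_antisym subsetI)
    fix t :: real assume t: "t \<in> {0<..}"
    then have "t = ?g ((p * t) powr (1 / p))" using p by (simp add: powr_powr)
    then show "t \<in> ?g ` {0<..}" using t p by (intro image_eqI[of _ _ "(p * t) powr (1 / p)"]) auto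
  qed (use p in auto)
  have inj: "inj_on ?g {0<..}"
  proof (rule inj_onI)
    fix x y :: real assume "x \<in> {0<..}" "y \<in> {0<..}" "?g x = ?g y"
    then show "x = y"
      using p powr_less_mono2[of p x y] powr_less_mono2[of p y x] by (cases x y rule: linorder_cases) auto
  qed
  have der: "(?g has_field_derivative ?g' x) (at x within {0<..})" if "x \<in> {0<..}" for x
    using that p by (auto intro!: derivative_eq_intros DERIV_subset[OF has_real_derivative_powr])
  have "?f absolutely_integrable_on ?g ` {0<..} \<and> integral (?g ` {0<..}) ?f = Gamma a"
    unfolding img using Fabs integral_unique[OF F] by (rule conjI)
  then have key: "(\<lambda>x. \<bar>?g' x\<bar> * ?f (?g x)) absolutely_integrable_on {0<..} \<and>
      integral {0<..} (\<lambda>x. \<bar>?g' x\<bar> * ?f (?g x)) = Gamma a"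
    by (subst has_absolute_integral_change_of_variables_1'[OF _ der inj]) simp_all
  have "((\<lambda>x. \<bar>?g' x\<bar> * ?f (?g x)) has_integral Gamma a) {0<..}"
    using integrable_integral[OF set_lebesgue_integral_eq_integral(1)[OF key[THEN conjunct1]]] key[THEN conjunct2] by simp
  then have "((\<lambda>x. p powr (a - 1) * (\<bar>?g' x\<bar> * ?f (?g x))) has_integral (p powr (a - 1) * Gamma a)) {0<..}"
    by (rule has_integral_mult_right)
  then show ?thesis
    unfolding a_def[symmetric]
  proof (rule has_integral_eq[rotated])
    fix x :: real assume "x \<in> {0<..}"
    then have x: "0 < x" by simp
    have "p powr (a - 1) * (x powr p / p) powr (a - 1) = x powr (p * (a - 1))"
      using p x by (simp add: powr_divide powr_powr)
    moreover have "x powr (p - 1) * x powr (p * (a - 1)) = x powr s"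
    proof -
      have "p - 1 + p * (a - 1) = s" using p by (simp add: a_def field_simps)
      then show ?thesis by (simp add: powr_add[symmetric])
    qed
    ultimately show "p powr (a - 1) * (\<bar>?g' x\<bar> * ?f (?g x)) = x powr s * exp (- (x powr p) / p)"
      by (simp add: exp_minus field_simps) (metis mult.assoc mult.commute)
  qed
qed

lemma nn_integral_abs:
  assumes [measurable]: "h \<in> borel_measurable borel"
  shows "(\<integral>\<^sup>+x. h \<bar>x\<bar> \<partial>lborel) = 2 * (\<integral>\<^sup>+x. h x * indicator {0<..} x \<partial>(lborel :: real measure))"
proof -
  have "(\<integral>\<^sup>+x. h \<bar>x\<bar> \<partial>lborel) = (\<integral>\<^sup>+x. h x * indicator {0<..} x + h (- x) * indicator {..<0} x \<partial>lborel)"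
    by (intro nn_integral_cong_AE eventually_mono[OF AE_lborel_singleton[of "0::real"]]) (auto simp: indicator_def abs_if)
  also have "\<dots> = (\<integral>\<^sup>+x. h x * indicator {0<..} x \<partial>lborel) + (\<integral>\<^sup>+x. h (- x) * indicator {..<0} x \<partial>lborel)"
    by (rule nn_integral_add) measurable
  also have "(\<integral>\<^sup>+x. h (- x) * indicator {..<0} x \<partial>lborel) = (\<integral>\<^sup>+x. h x * indicator {0<..} x \<partial>(lborel :: real measure))"
    by (subst nn_integral_real_affine[where c = "-1" and t = 0]) (auto intro!: nn_integral_cong simp: indicator_def)
  finally show ?thesis by (simp add: mult_2)
qed

lemma nn_integral_powr_exp:
  fixes p s :: real
  assumes p: "1 \<le> p" and s: "-1 < s"
  shows "(\<integral>\<^sup>+x. ennreal (\<bar>x\<bar> powr s * exp (- (\<bar>x\<bar> powr p) / p)) \<partial>lborel)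
    = ennreal (2 * (p powr ((s + 1) / p - 1) * Gamma ((s + 1) / p)))"
proof -
  let ?h = "\<lambda>x. x powr s * exp (- (x powr p) / p)"
  have "(\<integral>\<^sup>+x. ennreal (?h x) * indicator {0<..} x \<partial>lborel) = (\<integral>\<^sup>+x. ennreal (indicator {0<..} x * ?h x) \<partial>lborel)"
    by (intro nn_integral_cong) (auto simp: indicator_def)
  also have "\<dots> = ennreal (p powr ((s + 1) / p - 1) * Gamma ((s + 1) / p))"
    using nn_integral_has_integral_lebesgue[OF _ has_integral_powr_exp_pos[OF p s]] by simp
  finally show ?thesis
    using nn_integral_abs[of "\<lambda>x. ennreal (?h x)"] by (simp add: ennreal_mult')
qed

definition pg_const :: "real \<Rightarrow> real" where
  "pg_const p = 1 / (2 * p powr (1 / p) * Gamma (1 + 1 / p))"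

definition pg_density :: "real \<Rightarrow> real \<Rightarrow> real" where
  "pg_density p x = pg_const p * exp (- (\<bar>x\<bar> powr p) / p)"

lemma p_gaussian_density: "p_gaussian p = density lborel (\<lambda>x. ennreal (pg_density p x))"
  by (simp add: p_gaussian_def pg_density_def pg_const_def)

lemma sets_p_gaussian [measurable_cong, simp]: "sets (p_gaussian p) = sets borel"
  by (simp add: p_gaussian_def)

lemma space_p_gaussian [simp]: "space (p_gaussian p) = UNIV"
  by (simp add: p_gaussian_def)

lemma measurable_pg_density [measurable]: "pg_density p \<in> borel_measurable borel"
  unfolding pg_density_def by measurable

definition xi :: "real \<Rightarrow> real \<Rightarrow> real" where
  "xi p x = ln \<bar>x\<bar> - log_moment p - (\<bar>x\<bar> powr p - 1) / p"

lemma measurable_xi [measurable]: "xi p \<in> borel_measurable borel"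
  unfolding xi_def by measurable

context
  fixes p :: real assumes p: "1 \<le> p"
begin

lemma Gamma_pos: "0 < Gamma (1 + 1 / p)"
  using p by (intro Gamma_real_pos) (simp add: add_pos_pos)

lemma pg_const_pos: "0 < pg_const p"
  using p Gamma_pos by (simp add: pg_const_def)

lemma pg_density_pos: "0 < pg_density p x"
  using pg_const_pos by (simp add: pg_density_def)

lemma nn_integral_p_gaussian_powr:
  assumes s: "-1 < s"
  shows "(\<integral>\<^sup>+x. ennreal (\<bar>x\<bar> powr s) \<partial>p_gaussian p) = ennreal (pg_const p * (2 * (p powr ((s + 1) / p - 1) * Gamma ((s + 1) / p))))"
proof -
  have "(\<integral>\<^sup>+x. ennreal (\<bar>x\<bar> powr s) \<partial>p_gaussian p) = (\<integral>\<^sup>+x. ennreal (pg_const p) * ennreal (\<bar>x\<bar> powr s * exp (- (\<bar>x\<bar> powr p) / p)) \<partial>lborel)"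
    unfolding p_gaussian_density using pg_const_pos
    by (subst nn_integral_density) (auto intro!: nn_integral_cong simp: pg_density_def ennreal_mult[symmetric] mult_ac)
  also have "\<dots> = ennreal (pg_const p) * ennreal (2 * (p powr ((s + 1) / p - 1) * Gamma ((s + 1) / p)))"
    by (subst nn_integral_cmult) (simp_all only: nn_integral_powr_exp[OF p s], measurable)
  finally show ?thesis using pg_const_pos by (simp add: ennreal_mult')
qed

lemma p_gaussian_norm: "pg_const p * (2 * (p powr (1 / p) * Gamma (1 + 1 / p))) = 1"
  using p Gamma_pos by (simp add: pg_const_def)

lemma AE_p_gaussian_nonzero: "AE x in p_gaussian p. x \<noteq> 0"
  unfolding p_gaussian_density using AE_lborel_singleton[of "0::real"] by (subst AE_density) auto

lemma prob_space_p_gaussian: "prob_space (p_gaussian p)"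
proof
  have "emeasure (p_gaussian p) (space (p_gaussian p)) = (\<integral>\<^sup>+x. 1 \<partial>p_gaussian p)" by simp
  \<comment> \<open>\<open>0 powr 0\<close> is 0, so the two integrands agree only away from the
    origin.\<close>
  also have "\<dots> = (\<integral>\<^sup>+x. ennreal (\<bar>x\<bar> powr 0) \<partial>p_gaussian p)"
    by (intro nn_integral_cong_AE eventually_mono[OF AE_p_gaussian_nonzero]) simp
  also have "\<dots> = ennreal (pg_const p * (2 * (p powr (1 / p - 1) * Gamma (1 / p))))"
    by (subst nn_integral_p_gaussian_powr) simp_all
  also have "p powr (1 / p - 1) * Gamma (1 / p) = p powr (1 / p) * Gamma (1 + 1 / p)"
  proof -
    have "1 / p \<notin> \<int>\<^sub>\<le>\<^sub>0" using p by (auto dest!: nonpos_Ints_nonpos)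
    then show ?thesis using p Gamma_plus1[of "1 / p"] by (simp add: powr_diff add.commute)
  qed
  finally show "emeasure (p_gaussian p) (space (p_gaussian p)) = 1"
    by (simp add: p_gaussian_norm)
qed

lemma integrable_p_gaussian_powr: "-1 < s \<Longrightarrow> integrable (p_gaussian p) (\<lambda>x. \<bar>x\<bar> powr s)"
  by (intro integrableI_nonneg) (auto simp: nn_integral_p_gaussian_powr)

text \<open>The factor \<open>1 / p\<close> in the exponent of the density makes this moment 1: at
  \<open>s = p\<close> the moment formula becomes the normalization identity
  \<open>p_gaussian_norm\<close>. Hence averages of the |G_i|^p concentrate at 1, the point at which
  the logarithm is linearized.\<close>

lemma expectation_p_gaussian_powr_p: "(LINT x|p_gaussian p. \<bar>x\<bar> powr p) = 1"
proof (rule integral_eq_nn_integral[THEN trans])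
  have "(\<integral>\<^sup>+x. ennreal (\<bar>x\<bar> powr p) \<partial>p_gaussian p) = ennreal (pg_const p * (2 * (p powr (1 / p) * Gamma (1 + 1 / p))))"
    using p by (subst nn_integral_p_gaussian_powr) (simp_all add: add_divide_distrib add.commute)
  then show "enn2real (\<integral>\<^sup>+x. ennreal (\<bar>x\<bar> powr p) \<partial>p_gaussian p) = 1"
    by (simp add: p_gaussian_norm)
qed auto

lemma ln_square_le:
  assumes "x \<noteq> (0::real)" shows "(ln \<bar>x\<bar>)\<^sup>2 \<le> \<bar>x\<bar> powr 2 + 16 * \<bar>x\<bar> powr (- 1 / 2)"
proof (cases "1 \<le> \<bar>x\<bar>")
  case True
  then have "0 \<le> ln \<bar>x\<bar>" "ln \<bar>x\<bar> \<le> \<bar>x\<bar>" using ln_bound[of "\<bar>x\<bar>"] by auto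
  then have "(ln \<bar>x\<bar>)\<^sup>2 \<le> \<bar>x\<bar>\<^sup>2" by (intro power_mono) auto
  also have "\<dots> = \<bar>x\<bar> powr 2" using assms by simp
  finally show ?thesis by (simp add: add_increasing2)
next
  case False
  \<comment> \<open>With the fourth root, \<open>ln y \<le> y\<close> costs only
    \<open>\<bar>x\<bar> powr (- 1 / 2)\<close> after squaring, which is integrable at 0; the 16 is
    the square of 4.\<close>
  define y where "y = \<bar>x\<bar> powr (- 1 / 4)"
  have y: "0 < y" using assms by (simp add: y_def)
  have ln: "- ln \<bar>x\<bar> = 4 * ln y" using assms by (simp add: y_def ln_powr)
  have "0 \<le> - ln \<bar>x\<bar>" using False assms by simp
  moreover have "- ln \<bar>x\<bar> \<le> 4 * y" using ln ln_bound[OF y] by simp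
  ultimately have "(- ln \<bar>x\<bar>)\<^sup>2 \<le> (4 * y)\<^sup>2" by (intro power_mono)
  also have "(4 * y)\<^sup>2 = 16 * \<bar>x\<bar> powr (- 1 / 2)"
    by (simp add: y_def power_mult_distrib power2_eq_square powr_add[symmetric])
  finally show ?thesis by (simp add: add_increasing)
qed

lemma integrable_ln_square: "integrable (p_gaussian p) (\<lambda>x. (ln \<bar>x\<bar>)\<^sup>2)"
proof (rule Bochner_Integration.integrable_bound)
  show "integrable (p_gaussian p) (\<lambda>x. \<bar>x\<bar> powr 2 + 16 * \<bar>x\<bar> powr (- 1 / 2))"
    by (intro Bochner_Integration.integrable_add integrable_mult_right integrable_p_gaussian_powr) auto
  show "AE x in p_gaussian p. norm ((ln \<bar>x\<bar>)\<^sup>2) \<le> norm (\<bar>x\<bar> powr 2 + 16 * \<bar>x\<bar> powr (- 1 / 2))"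
    by (rule eventually_mono[OF AE_p_gaussian_nonzero]) (use ln_square_le in auto)
qed measurable

interpretation pg: prob_space "p_gaussian p" by (rule prob_space_p_gaussian)

lemma integrable_ln: "integrable (p_gaussian p) (\<lambda>x. ln \<bar>x\<bar>)"
  by (rule pg.square_integrable_imp_integrable[OF _ integrable_ln_square]) measurable

lemma expectation_xi: "(LINT x|p_gaussian p. xi p x) = 0"
proof -
  have i: "integrable (p_gaussian p) (\<lambda>x. \<bar>x\<bar> powr p)" using p by (intro integrable_p_gaussian_powr) auto
  have "(LINT x|p_gaussian p. xi p x) = log_moment p - log_moment p - ((LINT x|p_gaussian p. \<bar>x\<bar> powr p) - 1) / p"
    unfolding xi_def using integrable_ln i
    by (simp add: log_moment_def pg.prob_space[unfolded space_p_gaussian])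
  then show ?thesis by (simp add: expectation_p_gaussian_powr_p)
qed

lemma integrable_powr_square: "-1/2 < s \<Longrightarrow> integrable (p_gaussian p) (\<lambda>x. (\<bar>x\<bar> powr s)\<^sup>2)"
  using integrable_p_gaussian_powr[of "2 * s"]
  by (simp add: power2_eq_square powr_add[symmetric])

lemma integrable_xi_square: "integrable (p_gaussian p) (\<lambda>x. (xi p x)\<^sup>2)"
proof (rule Bochner_Integration.integrable_bound)
  let ?c = "1 / p - log_moment p"
  show "integrable (p_gaussian p) (\<lambda>x. 3 * (ln \<bar>x\<bar>)\<^sup>2 + 3 * ((\<bar>x\<bar> powr p)\<^sup>2 / p\<^sup>2) + 3 * ?c\<^sup>2)"
    using p by (intro Bochner_Integration.integrable_add integrable_mult_right integrable_divide integrable_ln_square integrable_powr_square) auto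
  show "AE x in p_gaussian p. norm ((xi p x)\<^sup>2) \<le> norm (3 * (ln \<bar>x\<bar>)\<^sup>2 + 3 * ((\<bar>x\<bar> powr p)\<^sup>2 / p\<^sup>2) + 3 * ?c\<^sup>2)"
  proof (rule AE_I2)
    fix x :: real
    \<comment> \<open>The difference of the two sides is the sum of the three squares
      supplied.\<close>
    have *: "(a - b + c)\<^sup>2 \<le> 3 * a\<^sup>2 + 3 * b\<^sup>2 + 3 * c\<^sup>2" for a b c :: real
      using zero_le_power2[of "a + b"] zero_le_power2[of "a - c"] zero_le_power2[of "b + c"]
      by (simp add: power2_eq_square algebra_simps)
    have "xi p x = ln \<bar>x\<bar> - \<bar>x\<bar> powr p / p + ?c" by (simp add: xi_def diff_divide_distrib)
    then have "(xi p x)\<^sup>2 \<le> 3 * (ln \<bar>x\<bar>)\<^sup>2 + 3 * (\<bar>x\<bar> powr p / p)\<^sup>2 + 3 * ?c\<^sup>2" by (simp only: *)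
    then show "norm ((xi p x)\<^sup>2) \<le> norm (3 * (ln \<bar>x\<bar>)\<^sup>2 + 3 * ((\<bar>x\<bar> powr p)\<^sup>2 / p\<^sup>2) + 3 * ?c\<^sup>2)"
      by (simp add: power_divide)
  qed
qed measurable

text \<open>The variance is positive because \<open>ln x - x powr p / p\<close> is strictly decreasing for \<open>x > 1\<close>.\<close>

lemma variance_xi_pos: "0 < (LINT x|p_gaussian p. (xi p x)\<^sup>2)"
proof (rule ccontr)
  assume "\<not> 0 < (LINT x|p_gaussian p. (xi p x)\<^sup>2)"
  moreover have "0 \<le> (LINT x|p_gaussian p. (xi p x)\<^sup>2)" by (intro integral_nonneg_AE AE_I2) simp
  ultimately have "(LINT x|p_gaussian p. (xi p x)\<^sup>2) = 0" by linarith
  then have "AE x in p_gaussian p. (xi p x)\<^sup>2 = 0"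
    by (subst (asm) integral_nonneg_eq_0_iff_AE[OF integrable_xi_square]) auto
  then have ae: "AE x in lborel. xi p x = 0"
    unfolding p_gaussian_density using pg_density_pos by (subst (asm) AE_density) auto
  have dec: "xi p y < xi p x" if "1 < x" "x < y" for x y
  proof (rule DERIV_neg_imp_decreasing[OF that(2)])
    fix z assume z: "x \<le> z" "z \<le> y"
    then have z1: "1 < z" using that by simp
    have "((\<lambda>x. ln x - log_moment p - (x powr p - 1) / p) has_real_derivative (1 / z - z powr (p - 1))) (at z)"
      using z1 p by (auto intro!: derivative_eq_intros simp: field_simps)
    then have "(xi p has_real_derivative (1 / z - z powr (p - 1))) (at z)"
    proof (rule has_field_derivative_transform_within_open[where S = "{0<..}"])
      show "ln x - log_moment p - (x powr p - 1) / p = xi p x" if "x \<in> {0<..}" for x using that by (simp add: xi_def)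
    qed (use z1 in auto)
    moreover have "1 / z < 1" using z1 by simp
    moreover have "1 \<le> z powr (p - 1)" using z1 p by (simp add: ge_one_powr_ge_zero)
    ultimately show "\<exists>y. (xi p has_real_derivative y) (at z) \<and> y < 0" by (intro exI[of _ "1 / z - z powr (p - 1)"]) auto
  qed
  have "\<exists>c. \<forall>x\<in>{1<..<2}. xi p x = 0 \<longrightarrow> x = c"
  proof (cases "\<exists>c\<in>{1<..<2}. xi p c = 0")
    case True
    then obtain c where c: "c \<in> {1<..<2}" "xi p c = 0" by auto
    have "x = c" if "x \<in> {1<..<2}" "xi p x = 0" for x
      using dec[of x c] dec[of c x] c that by (cases x c rule: linorder_cases) auto
    then show ?thesis by blast
  qed auto
  then obtain c where c: "\<And>x. x \<in> {1<..<2} \<Longrightarrow> xi p x = 0 \<Longrightarrow> x = c" by blast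
  have "AE x in lborel. x \<notin> {1<..<2::real}"
    using ae AE_lborel_singleton[of c] by eventually_elim (use c in auto)
  then have "emeasure lborel {1<..<2::real} = 0"
    by (subst (asm) AE_iff_measurable[where N = "{1<..<2}"]) auto
  then show False by simp
qed

end

section \<open>Elementary symmetric polynomials\<close>

definition elem_sym :: "nat \<Rightarrow> nat \<Rightarrow> (nat \<Rightarrow> real) \<Rightarrow> real" where
  "elem_sym n k y = (\<Sum>I | I \<subseteq> {..<n} \<and> card I = k. \<Prod>i\<in>I. y i)"

lemma finite_subsets_card: "finite {I. I \<subseteq> {..<n::nat} \<and> card I = k}"
  by (rule finite_subset[of _ "Pow {..<n}"]) auto

lemma elem_sym_0 [simp]: "elem_sym n 0 y = 1"
proof -
  have "{I. I \<subseteq> {..<n} \<and> card I = 0} = {{}}" by (auto dest: finite_subset)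
  then show ?thesis by (simp add: elem_sym_def)
qed

lemma elem_sym_0_Suc [simp]: "elem_sym 0 (Suc k) y = 0"
  by (simp add: elem_sym_def)

text \<open>The index sets are split by whether they contain the last index.\<close>

lemma elem_sym_Suc: "elem_sym (Suc n) (Suc k) y = elem_sym n (Suc k) y + y n * elem_sym n k y"
proof -
  let ?A = "{I. I \<subseteq> {..<n} \<and> card I = Suc k}" and ?B = "{I. I \<subseteq> {..<n} \<and> card I = k}"
  have fin: "finite I" if "I \<subseteq> {..<n}" for I using that finite_subset by auto
  have eq: "{I. I \<subseteq> {..<Suc n} \<and> card I = Suc k} = ?A \<union> insert n ` ?B"
  proof (intro subset_antisym subsetI)
    fix I assume I: "I \<in> {I. I \<subseteq> {..<Suc n} \<and> card I = Suc k}"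
    show "I \<in> ?A \<union> insert n ` ?B"
    proof (cases "n \<in> I")
      case True
      then have "I = insert n (I - {n})" "I - {n} \<subseteq> {..<n}" "card (I - {n}) = k"
        using I by (auto simp: less_Suc_eq)
      then show ?thesis by blast
    next
      case False then show ?thesis using I by (auto simp: less_Suc_eq)
    qed
  next
    fix I assume "I \<in> ?A \<union> insert n ` ?B"
    then show "I \<in> {I. I \<subseteq> {..<Suc n} \<and> card I = Suc k}"
      using fin by (auto simp: card_insert_if)
  qed
  have inj: "inj_on (insert n) ?B" by (rule inj_onI) (metis (lifting) Diff_insert_absorb lessThan_iff less_irrefl mem_Collect_eq subsetD)
  have "elem_sym (Suc n) (Suc k) y = elem_sym n (Suc k) y + (\<Sum>I\<in>insert n ` ?B. \<Prod>i\<in>I. y i)"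
    unfolding elem_sym_def eq by (rule sum.union_disjoint) (auto simp: finite_subsets_card)
  also have "(\<Sum>I\<in>insert n ` ?B. \<Prod>i\<in>I. y i) = (\<Sum>I\<in>?B. y n * (\<Prod>i\<in>I. y i))"
    unfolding sum.reindex[OF inj] o_def
  proof (intro sum.cong refl)
    fix I assume "I \<in> ?B"
    then show "(\<Prod>i\<in>insert n I. y i) = y n * (\<Prod>i\<in>I. y i)"
      using fin by (intro prod.insert) auto
  qed
  finally show ?thesis by (simp add: elem_sym_def sum_distrib_left)
qed

lemma elem_sym_nonneg: "(\<And>i. i < n \<Longrightarrow> 0 \<le> y i) \<Longrightarrow> 0 \<le> elem_sym n k y"
  unfolding elem_sym_def by (intro sum_nonneg prod_nonneg) auto

lemma elem_sym_1: "elem_sym n (Suc 0) y = (\<Sum>i<n. y i)"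
  by (induction n) (auto simp: elem_sym_Suc)

text \<open>Expanding the product on the right, each monomial of \<open>elem_sym n (Suc k) y\<close>
  arises \<open>Suc k\<close> times; the monomials left over contain a repeated variable and are
  nonnegative.\<close>

lemma elem_sym_upper_step:
  assumes "\<And>i. i < n \<Longrightarrow> 0 \<le> y i"
  shows "real (Suc k) * elem_sym n (Suc k) y \<le> (\<Sum>i<n. y i) * elem_sym n k y"
  using assms
proof (induction n arbitrary: k)
  case (Suc n)
  let ?s = "\<Sum>i<n. y i" and ?e = "\<lambda>k. elem_sym n k y"
  have IH: "real (Suc k) * ?e (Suc k) \<le> ?s * ?e k" for k using Suc by simp
  have yn: "0 \<le> y n" using Suc by simp
  show ?case
  proof (cases k)
    case 0 then show ?thesis by (simp add: elem_sym_1)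
  next
    case (Suc j)
    have "0 \<le> ?e j" using Suc.prems by (intro elem_sym_nonneg) auto
    \<comment> \<open>The sum of these three nonnegative terms is the difference of the two sides
      for \<open>Suc n\<close>.\<close>
    then have "0 \<le> (?s * ?e k - real (Suc k) * ?e (Suc k)) + y n * (?s * ?e j - real (Suc j) * ?e (Suc j)) + y n * y n * ?e j"
      using IH[of k] IH[of j] yn by (intro add_nonneg_nonneg mult_nonneg_nonneg) auto
    then show ?thesis by (simp add: elem_sym_Suc Suc algebra_simps)
  qed
qed simp

text \<open>The leftover monomials of the expansion are a square \<open>(y i)\<^sup>2\<close> times
  a product of \<open>k\<close> variables other than \<open>y i\<close>; admitting all products of
  \<open>k\<close> variables bounds their sum by the last term.\<close>

lemma elem_sym_lower_step:
  assumes "\<And>i. i < n \<Longrightarrow> 0 \<le> y i"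
  shows "(\<Sum>i<n. y i) * elem_sym n (Suc k) y \<le> real (Suc (Suc k)) * elem_sym n (Suc (Suc k)) y + (\<Sum>i<n. (y i)\<^sup>2) * elem_sym n k y"
  using assms
proof (induction n arbitrary: k)
  case (Suc n)
  let ?s = "\<Sum>i<n. y i" and ?q = "\<Sum>i<n. (y i)\<^sup>2" and ?e = "\<lambda>k. elem_sym n k y"
  let ?D = "\<lambda>k. real (Suc (Suc k)) * ?e (Suc (Suc k)) + ?q * ?e k - ?s * ?e (Suc k)"
  have IH: "0 \<le> ?D k" for k using Suc.IH[of k] Suc.prems by simp
  have yn: "0 \<le> y n" using Suc.prems by simp
  show ?case
  proof (cases k)
    case 0
    then show ?thesis using IH[of 0] by (simp add: elem_sym_Suc elem_sym_1 algebra_simps power2_eq_square)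
  next
    case (Suc j)
    have "0 \<le> ?e j" using Suc.prems by (intro elem_sym_nonneg) auto
    then have "0 \<le> ?D k + y n * ?D j + y n * y n * y n * ?e j"
      using IH[of k] IH[of j] yn by (intro add_nonneg_nonneg mult_nonneg_nonneg) auto
    then show ?thesis by (simp add: elem_sym_Suc Suc algebra_simps power2_eq_square)
  qed
qed simp

lemma elem_sym_upper:
  assumes "\<And>i. i < n \<Longrightarrow> 0 \<le> y i"
  shows "fact k * elem_sym n k y \<le> (\<Sum>i<n. y i) ^ k"
proof (induction k)
  case (Suc k)
  have "fact (Suc k) * elem_sym n (Suc k) y = fact k * (real (Suc k) * elem_sym n (Suc k) y)" by (simp add: mult_ac)
  also have "\<dots> \<le> fact k * ((\<Sum>i<n. y i) * elem_sym n k y)"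
    using elem_sym_upper_step[of n y k] assms by (intro mult_left_mono) auto
  also have "\<dots> = (\<Sum>i<n. y i) * (fact k * elem_sym n k y)" by simp
  also have "\<dots> \<le> (\<Sum>i<n. y i) * (\<Sum>i<n. y i) ^ k"
    using Suc assms by (intro mult_left_mono sum_nonneg) auto
  finally show ?case by simp
qed simp

text \<open>A union bound: the power of the sum runs over tuples of indices, those with distinct
  entries give the factorial term, and in every other tuple one of the \<open>Suc k choose 2\<close>
  pairs of entries coincides.\<close>

lemma elem_sym_lower:
  assumes "\<And>i. i < n \<Longrightarrow> 0 \<le> y i"
  shows "(\<Sum>i<n. y i) ^ Suc k \<le> fact (Suc k) * elem_sym n (Suc k) y + real (Suc k choose 2) * (\<Sum>i<n. (y i)\<^sup>2) * (\<Sum>i<n. y i) ^ (k - 1)"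
proof (induction k)
  case 0 then show ?case by (simp add: elem_sym_1 binomial_eq_0)
next
  case (Suc k)
  let ?s = "\<Sum>i<n. y i" and ?q = "\<Sum>i<n. (y i)\<^sup>2" and ?e = "\<lambda>k. elem_sym n k y"
  have s: "0 \<le> ?s" and q: "0 \<le> ?q" using assms by (auto intro: sum_nonneg)
  \<comment> \<open>For \<open>k = 0\<close> the exponent \<open>k - 1\<close> is truncated to 0,
    but then the binomial coefficient vanishes.\<close>
  have pw: "?s * (real (Suc k choose 2) * ?q * ?s ^ (k - 1)) = real (Suc k choose 2) * ?q * ?s ^ k"
    by (cases k) (auto simp: binomial_eq_0)
  have "?s ^ Suc (Suc k) = ?s * ?s ^ Suc k" by simp
  also have "\<dots> \<le> ?s * (fact (Suc k) * ?e (Suc k) + real (Suc k choose 2) * ?q * ?s ^ (k - 1))"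
    using s by (intro mult_left_mono Suc)
  also have "\<dots> = fact (Suc k) * (?s * ?e (Suc k)) + real (Suc k choose 2) * ?q * ?s ^ k"
    unfolding distrib_left pw by simp
  also have "fact (Suc k) * (?s * ?e (Suc k)) \<le> fact (Suc k) * (real (Suc (Suc k)) * ?e (Suc (Suc k)) + ?q * ?e k)"
    using elem_sym_lower_step[of n y k] assms by (intro mult_left_mono) auto
  also have "\<dots> = fact (Suc (Suc k)) * ?e (Suc (Suc k)) + real (Suc k) * ?q * (fact k * ?e k)"
    by (simp add: distrib_left algebra_simps)
  also have "real (Suc k) * ?q * (fact k * ?e k) \<le> real (Suc k) * ?q * ?s ^ k"
    using q elem_sym_upper[of n y k] assms by (intro mult_left_mono) auto
  also have "fact (Suc (Suc k)) * ?e (Suc (Suc k)) + real (Suc k) * ?q * ?s ^ k + real (Suc k choose 2) * ?q * ?s ^ k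
     = fact (Suc (Suc k)) * ?e (Suc (Suc k)) + real (Suc (Suc k) choose 2) * ?q * ?s ^ (Suc k - 1)"
    by (simp add: numeral_2_eq_2 algebra_simps)
  finally show ?case by simp
qed

lemma elem_sym_one: "elem_sym n k (\<lambda>_. 1) = real (n choose k)"
  by (simp add: elem_sym_def n_subsets)

text \<open>The binomial coefficient is the elementary symmetric polynomial at \<open>(1, \<dots>, 1)\<close>, so the same
  estimates control numerator and denominator.\<close>

lemma ln_elem_sym_mean:
  assumes y: "\<And>i. i < n \<Longrightarrow> 0 \<le> y i" and k: "1 \<le> k" "k \<le> n"
    and c: "c = real (k choose 2)" and s: "s = (\<Sum>i<n. y i)" "0 < s" and q: "q = (\<Sum>i<n. (y i)\<^sup>2) / s\<^sup>2"
    and small: "c * q \<le> 1 / 2" "c / n \<le> 1 / 2"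
  shows "0 < elem_sym n k y / real (n choose k)"
    and "\<bar>ln (elem_sym n k y / real (n choose k)) - k * ln (s / n)\<bar> \<le> 2 * c * (q + 1 / n)"
proof -
  obtain j where j: "k = Suc j" using k by (cases k) auto
  have n: "0 < real n" using k by simp
  have c0: "0 \<le> c" and q0: "0 \<le> q" using c q s by (auto intro!: divide_nonneg_nonneg sum_nonneg)
  \<comment> \<open>Up to \<open>1 / 2\<close> the quadratic term in the bound
    \<open>- x - 2 * x\<^sup>2\<close> is at most \<open>x\<close>.\<close>
  have ln2: "- 2 * x \<le> ln (1 - x)" if "0 \<le> x" "x \<le> 1 / 2" for x :: real
  proof -
    have "- 2 * x \<le> - x - 2 * x\<^sup>2" using that mult_left_mono[of x "1 / 2" x] by (simp add: power2_eq_square)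
    also have "\<dots> \<le> ln (1 - x)" using ln_one_minus_pos_lower_bound[of x] that by simp
    finally show ?thesis .
  qed
  \<comment> \<open>\<open>r ^ (j - 1)\<close> is \<open>r ^ k / r\<^sup>2\<close> except for
    \<open>j = 0\<close>, where \<open>c = 0\<close>. Thus the error terms of
    \<open>elem_sym_lower\<close> become relative errors \<open>c * q\<close> and
    \<open>c / n\<close>.\<close>
  have pw: "c * (t * r ^ (j - 1)) = c * (t / r\<^sup>2) * r ^ k" if "0 < r" for t r :: real
    using that c by (cases j) (auto simp: j binomial_eq_0 power2_eq_square)
  define E where "E = fact k * elem_sym n k y"
  have E: "s ^ k * (1 - c * q) \<le> E" "E \<le> s ^ k"
    using elem_sym_lower[of n y j] elem_sym_upper[of n y k] y pw[OF s(2), of "\<Sum>i<n. (y i)\<^sup>2"]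
    by (simp_all add: E_def s j c q algebra_simps)
  define B where "B = fact k * real (n choose k)"
  have B: "real n ^ k * (1 - c / n) \<le> B" "B \<le> real n ^ k"
  proof -
    have "c * (real n * real n ^ (j - 1)) = c / n * real n ^ k"
      using pw[OF n, of "real n"] n by (simp add: power2_eq_square)
    moreover have "real n ^ k \<le> B + c * (real n * real n ^ (j - 1))"
      using elem_sym_lower[of n "\<lambda>_. 1" j] by (simp add: B_def elem_sym_one j c mult.assoc)
    ultimately show "real n ^ k * (1 - c / n) \<le> B" by (simp add: algebra_simps)
    show "B \<le> real n ^ k" using elem_sym_upper[of n "\<lambda>_. 1" k] by (simp add: B_def elem_sym_one)
  qed
  have cq: "0 < 1 - c * q" "0 < 1 - c / n" using small by linarith+
  have sk: "0 < s ^ k" "0 < real n ^ k" using s n by auto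
  have pos: "0 < E" "0 < B"
    by (rule less_le_trans[OF mult_pos_pos[OF sk(1) cq(1)] E(1)]) (rule less_le_trans[OF mult_pos_pos[OF sk(2) cq(2)] B(1)])
  have EB: "elem_sym n k y / real (n choose k) = E / B" by (simp add: E_def B_def)
  show "0 < elem_sym n k y / real (n choose k)" unfolding EB using pos by simp
  have lnE: "k * ln s - 2 * (c * q) \<le> ln E" "ln E \<le> k * ln s"
  proof -
    have "k * ln s - 2 * (c * q) \<le> ln (s ^ k) + ln (1 - c * q)"
      using ln2[of "c * q"] c0 q0 small s by (simp add: ln_realpow)
    also have "\<dots> = ln (s ^ k * (1 - c * q))" by (rule ln_mult_pos[OF sk(1) cq(1), symmetric])
    also have "\<dots> \<le> ln E" using E sk cq by (intro ln_mono) auto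
    finally show "k * ln s - 2 * (c * q) \<le> ln E" .
    have "ln E \<le> ln (s ^ k)" using E pos by (intro ln_mono) auto
    then show "ln E \<le> k * ln s" using s by (simp add: ln_realpow)
  qed
  have lnB: "k * ln n - 2 * (c / n) \<le> ln B" "ln B \<le> k * ln n"
  proof -
    have "k * ln n - 2 * (c / n) \<le> ln (real n ^ k) + ln (1 - c / n)"
      using ln2[of "c / n"] c0 small n by (simp add: ln_realpow)
    also have "\<dots> = ln (real n ^ k * (1 - c / n))" by (rule ln_mult_pos[OF sk(2) cq(2), symmetric])
    also have "\<dots> \<le> ln B" using B sk cq by (intro ln_mono) auto
    finally show "k * ln n - 2 * (c / n) \<le> ln B" .
    have "ln B \<le> ln (real n ^ k)" using B pos by (intro ln_mono) auto
    then show "ln B \<le> k * ln n" using n by (simp add: ln_realpow)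
  qed
  have "ln (E / B) - k * ln (s / n) = (ln E - k * ln s) - (ln B - k * ln n)"
    using pos s n by (simp add: ln_div algebra_simps)
  moreover have "0 \<le> c * q" "0 \<le> c / n" using c0 q0 n by auto
  moreover have "2 * c * (q + 1 / n) = 2 * (c * q) + 2 * (c / n)" by (simp add: algebra_simps)
  ultimately show "\<bar>ln (elem_sym n k y / real (n choose k)) - k * ln (s / n)\<bar> \<le> 2 * c * (q + 1 / n)"
    unfolding EB using lnE lnB by (simp add: abs_le_iff)
qed

section \<open>Hausdorff measure\<close>

lemma ediam_image_le:
  assumes "0 < L" and "\<And>x y. x \<in> A \<Longrightarrow> y \<in> A \<Longrightarrow> d' (f x) (f y) \<le> L * d x y"
  shows "ediam d' (f ` A) \<le> ennreal L * ediam d A"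
proof -
  have "ennreal (d' (f x) (f y)) \<le> ennreal L * ediam d A" if "x \<in> A" "y \<in> A" for x y
  proof -
    have "ennreal (d' (f x) (f y)) \<le> ennreal (L * d x y)"
      using assms(2)[OF that] by (rule ennreal_leI)
    also have "\<dots> = ennreal L * ennreal (d x y)"
      using assms(1) by (simp add: ennreal_mult')
    also have "ennreal (d x y) \<le> ediam d A"
      unfolding ediam_def using that by (meson SUP_upper2 order_refl)
    finally show ?thesis by (simp add: mult_left_mono)
  qed
  then show ?thesis
    unfolding ediam_def[of d' "f ` A"] by (auto intro!: SUP_least)
qed

lemma ediam_mono: "A \<subseteq> B \<Longrightarrow> ediam d A \<le> ediam d B"
  unfolding ediam_def by (meson SUP_mono SUP_subset_mono order_refl)

lemma hausdorff_pre_empty: "hausdorff_pre d s \<delta> {} = 0"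
proof -
  have "hausdorff_pre d s \<delta> {} \<le> (\<Sum>i::nat. if {} = {} then 0 else ediam d {} ^ s)"
    unfolding hausdorff_pre_def by (rule INF_lower2[of "\<lambda>_. {}"]) (auto simp: ediam_def bot_ennreal)
  then show ?thesis by simp
qed

lemma hausdorff_empty: "hausdorff d s {} = 0"
  by (simp add: hausdorff_def hausdorff_pre_empty)

lemma hausdorff_pre_mono: "A \<subseteq> B \<Longrightarrow> hausdorff_pre d s \<delta> A \<le> hausdorff_pre d s \<delta> B"
  unfolding hausdorff_pre_def by (rule INF_superset_mono) auto

lemma hausdorff_mono: "A \<subseteq> B \<Longrightarrow> hausdorff d s A \<le> hausdorff d s B"
  unfolding hausdorff_def by (rule SUP_mono') (rule hausdorff_pre_mono)

lemma ennreal_less_add_pos: "(a::ennreal) < top \<Longrightarrow> 0 < b \<Longrightarrow> a < a + b"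
  using ennreal_add_left_cancel_less[of a 0 b] by (simp add: less_top[symmetric])

lemma hausdorff_pre_UN:
  fixes A :: "nat \<Rightarrow> 'a set"
  shows "hausdorff_pre d s \<delta> (\<Union>i. A i) \<le> (\<Sum>i. hausdorff_pre d s \<delta> (A i))"
proof (rule ennreal_le_epsilon)
  fix e :: real assume fin: "(\<Sum>i. hausdorff_pre d s \<delta> (A i)) < top" and e: "0 < e"
  let ?v = "\<lambda>U :: nat \<Rightarrow> 'a set. \<Sum>i. if U i = {} then 0 else ediam d (U i) ^ s"
  let ?C = "\<lambda>A. {U :: nat \<Rightarrow> 'a set. A \<subseteq> (\<Union>i. U i) \<and> (\<forall>i. ediam d (U i) \<le> ennreal \<delta>)}"
  have "\<exists>U\<in>?C (A n). ?v U \<le> hausdorff_pre d s \<delta> (A n) + ennreal (e * (1 / 2) ^ Suc n)" for n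
  proof -
    have "hausdorff_pre d s \<delta> (A n) < top"
      using fin ennreal_suminf_lessD by blast
    moreover define r where "r = hausdorff_pre d s \<delta> (A n) + ennreal (e * (1 / 2) ^ Suc n)"
    ultimately have "hausdorff_pre d s \<delta> (A n) < r"
      using e by (auto intro!: ennreal_less_add_pos)
    then have "\<exists>U\<in>?C (A n). ?v U < r"
      unfolding hausdorff_pre_def INF_less_iff .
    then show ?thesis
      unfolding r_def[symmetric] using less_imp_le by blast
  qed
  then have "\<exists>U. \<forall>n. U n \<in> ?C (A n) \<and> ?v (U n) \<le> hausdorff_pre d s \<delta> (A n) + ennreal (e * (1 / 2) ^ Suc n)"
    by (intro choice allI) (simp only: Bex_def)
  then obtain U where U: "\<And>n. U n \<in> ?C (A n)"
    and Ue: "\<And>n. ?v (U n) \<le> hausdorff_pre d s \<delta> (A n) + ennreal (e * (1 / 2) ^ Suc n)"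
    by (elim exE) blast
  define V where "V m = (case prod_decode m of (i, j) \<Rightarrow> U i j)" for m
  have V: "V \<in> ?C (\<Union>i. A i)"
  proof safe
    fix x i assume "x \<in> A i"
    then obtain j where "x \<in> U i j" using U[of i] by auto
    then have "x \<in> V (prod_encode (i, j))" by (simp add: V_def)
    then show "x \<in> (\<Union>m. V m)" by blast
  next
    fix m show "ediam d (V m) \<le> ennreal \<delta>"
      using U by (auto simp: V_def split: prod.split)
  qed
  have "hausdorff_pre d s \<delta> (\<Union>i. A i) \<le> ?v V"
    unfolding hausdorff_pre_def by (rule INF_lower[OF V])
  also have "\<dots> = (\<Sum>i. ?v (U i))"
  proof -
    let ?g = "\<lambda>B. if B = {} then 0 else ediam d B ^ s"
    have "?v V = (\<Sum>m. (\<lambda>(i, j). ?g (U i j)) (prod_decode m))"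
      by (auto simp: V_def split: prod.split intro!: suminf_cong)
    also have "\<dots> = (\<Sum>i. \<Sum>j. ?g (U i j))"
      by (rule suminf_ennreal_2dimen) simp
    finally show ?thesis .
  qed
  also have "\<dots> \<le> (\<Sum>n. hausdorff_pre d s \<delta> (A n) + ennreal (e * (1 / 2) ^ Suc n))"
    by (rule suminf_le[OF Ue]) auto
  also have "\<dots> = (\<Sum>n. hausdorff_pre d s \<delta> (A n)) + (\<Sum>n. ennreal (e * (1 / 2) ^ Suc n))"
    by (rule suminf_add[symmetric]) (rule summableI)+
  also have "(\<Sum>n. ennreal (e * (1 / 2) ^ Suc n)) = ennreal e"
    using e sums_mult[OF power_half_series, of e] by (intro suminf_ennreal_eq) auto
  finally show "hausdorff_pre d s \<delta> (\<Union>i. A i) \<le> (\<Sum>n. hausdorff_pre d s \<delta> (A n)) + ennreal e" .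
qed

lemma hausdorff_UN:
  fixes A :: "nat \<Rightarrow> 'a set"
  shows "hausdorff d s (\<Union>i. A i) \<le> (\<Sum>i. hausdorff d s (A i))"
proof -
  have "hausdorff_pre d s \<delta> (\<Union>i. A i) \<le> (\<Sum>i. hausdorff d s (A i))" if "0 < \<delta>" for \<delta>
  proof -
    note hausdorff_pre_UN
    also have "(\<Sum>i. hausdorff_pre d s \<delta> (A i)) \<le> (\<Sum>i. hausdorff d s (A i))"
      using that by (intro suminf_le) (auto simp: hausdorff_def intro: SUP_upper)
    finally show ?thesis .
  qed
  then show ?thesis unfolding hausdorff_def[of d s "\<Union>i. A i"] by (auto intro: SUP_least)
qed

lemma hausdorff_UN_countable:
  assumes "countable I"
  shows "hausdorff d s (\<Union>i\<in>I. A i) \<le> (\<integral>\<^sup>+i. hausdorff d s (A i) \<partial>count_space I)"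
proof -
  define f where "f n = (if n \<in> to_nat_on I ` I then A (from_nat_into I n) else {})" for n
  have f: "(\<Union>i\<in>I. A i) = (\<Union>n. f n)"
  proof safe
    fix x i assume "x \<in> A i" "i \<in> I"
    then have "x \<in> f (to_nat_on I i)" using assms by (simp add: f_def)
    then show "x \<in> (\<Union>n. f n)" by blast
  next
    fix x n assume "x \<in> f n"
    then show "x \<in> (\<Union>i\<in>I. A i)" using assms by (auto simp: f_def split: if_splits)
  qed
  have "(\<Sum>n. hausdorff d s (f n)) = (\<integral>\<^sup>+n. hausdorff d s (f n) \<partial>count_space UNIV)"
    by (simp add: nn_integral_count_space_nat)
  also have "\<dots> = (\<integral>\<^sup>+n. hausdorff d s (f n) \<partial>count_space (to_nat_on I ` I))"
    by (rule nn_integral_count_space_eq) (auto simp: f_def hausdorff_empty)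
  also have "\<dots> = (\<integral>\<^sup>+i. hausdorff d s (f (to_nat_on I i)) \<partial>count_space I)"
    by (rule nn_integral_bij_count_space[symmetric])
       (auto simp: bij_betw_def inj_on_to_nat_on assms)
  also have "\<dots> = (\<integral>\<^sup>+i. hausdorff d s (A i) \<partial>count_space I)"
    using assms by (intro nn_integral_cong) (auto simp: f_def)
  finally show ?thesis using hausdorff_UN[of d s f] f by simp
qed

lemma hausdorff_Un: "hausdorff d s (A \<union> B) \<le> hausdorff d s A + hausdorff d s B"
proof -
  have "A \<union> B = (\<Union>i\<in>{True, False}. if i then A else B)" by auto
  then have "hausdorff d s (A \<union> B) \<le>
      (\<integral>\<^sup>+i. hausdorff d s (if i then A else B) \<partial>count_space {True, False})"
    using hausdorff_UN_countable[of "{True, False}" d s "\<lambda>i. if i then A else B"] by auto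
  also have "\<dots> = hausdorff d s A + hausdorff d s B"
    by (subst nn_integral_count_space_finite) auto
  finally show ?thesis .
qed

lemma hausdorff_image_le:
  assumes L: "0 < L" and lip: "\<And>x y. x \<in> A \<Longrightarrow> y \<in> A \<Longrightarrow> d' (f x) (f y) \<le> L * d x y"
  shows "hausdorff d' s (f ` A) \<le> ennreal (L ^ s) * hausdorff d s A"
proof -
  have "hausdorff_pre d' s \<delta> (f ` A) \<le> ennreal (L ^ s) * hausdorff_pre d s (\<delta> / L) A" for \<delta>
  proof -
    let ?C = "{U :: nat \<Rightarrow> 'a set. A \<subseteq> (\<Union>i. U i) \<and> (\<forall>i. ediam d (U i) \<le> ennreal (\<delta> / L))}"
    have "hausdorff_pre d' s \<delta> (f ` A) \<le>
        ennreal (L ^ s) * (\<Sum>i. if U i = {} then 0 else ediam d (U i) ^ s)" if U: "U \<in> ?C" for U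
    proof -
      \<comment> \<open>The Lipschitz bound holds on \<open>A\<close> only, so the covering sets are
        cut down to \<open>A\<close> before they are mapped.\<close>
      define V where "V i = f ` (U i \<inter> A)" for i
      have V: "ediam d' (V i) \<le> ennreal L * ediam d (U i)" for i
        unfolding V_def
        by (rule order_trans[OF ediam_image_le[OF L]]) (auto intro: lip mult_left_mono ediam_mono)
      have "ediam d' (V i) \<le> ennreal \<delta>" for i
      proof -
        note V[of i]
        also have "ennreal L * ediam d (U i) \<le> ennreal L * ennreal (\<delta> / L)"
          using U by (intro mult_left_mono) auto
        also have "\<dots> = ennreal \<delta>" using L by (simp add: ennreal_mult'[symmetric])
        finally show ?thesis .
      qed
      then have "hausdorff_pre d' s \<delta> (f ` A) \<le> (\<Sum>i. if V i = {} then 0 else ediam d' (V i) ^ s)"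
      proof -
        assume "\<And>i. ediam d' (V i) \<le> ennreal \<delta>"
        moreover have "f ` A \<subseteq> (\<Union>i. V i)" using U unfolding V_def by blast
        ultimately show ?thesis unfolding hausdorff_pre_def by (intro INF_lower) auto
      qed
      also have "\<dots> \<le> (\<Sum>i. ennreal (L ^ s) * (if U i = {} then 0 else ediam d (U i) ^ s))"
      proof (intro suminf_le)
        fix i
        have "ediam d' (V i) ^ s \<le> (ennreal L * ediam d (U i)) ^ s"
          by (rule power_mono[OF V]) simp
        then show "(if V i = {} then 0 else ediam d' (V i) ^ s) \<le>
            ennreal (L ^ s) * (if U i = {} then 0 else ediam d (U i) ^ s)"
          using L by (auto simp: V_def power_mult_distrib ennreal_power)
      qed auto
      finally show ?thesis by simp
    qed
    \<comment> \<open>The constant is moved to the left so that the infimum over all covers can be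
      taken on the right.\<close>
    then have "hausdorff_pre d' s \<delta> (f ` A) / ennreal (L ^ s) \<le>
        (\<Sum>i. if U i = {} then 0 else ediam d (U i) ^ s)" if "U \<in> ?C" for U
      using L divide_right_mono_ennreal[OF \<open>\<And>U. _ \<Longrightarrow> _\<close>[OF that], of "ennreal (L ^ s)"]
      by (simp add: mult.commute[of "ennreal (L ^ s)"] mult_divide_eq_ennreal)
    then have "hausdorff_pre d' s \<delta> (f ` A) / ennreal (L ^ s) \<le> hausdorff_pre d s (\<delta> / L) A"
      unfolding hausdorff_pre_def[of d s] by (rule INF_greatest)
    then have "ennreal (L ^ s) * (hausdorff_pre d' s \<delta> (f ` A) / ennreal (L ^ s)) \<le>
        ennreal (L ^ s) * hausdorff_pre d s (\<delta> / L) A"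
      by (rule mult_left_mono) simp
    then show ?thesis
      using L by (simp add: ennreal_times_divide mult.commute[of "ennreal (L ^ s)"] mult_divide_eq_ennreal)
  qed
  also have "\<dots> \<delta> \<le> ennreal (L ^ s) * hausdorff d s A" if "0 < \<delta>" for \<delta>
    unfolding hausdorff_def using that L by (intro mult_left_mono SUP_upper) auto
  finally show ?thesis
    unfolding hausdorff_def[of d' s "f ` A"] by (auto intro!: SUP_least)
qed

section \<open>Invariance of Lebesgue measure\<close>

lemma space_leb: "space (leb n) = extensional {..<n}"
  by (auto simp: leb_def space_PiM PiE_def)

lemma measurable_leb_component [measurable (raw)]:
  "f \<in> measurable M (leb n) \<Longrightarrow> i \<in> {..<n} \<Longrightarrow> (\<lambda>x. f x i) \<in> borel_measurable M"
  unfolding leb_def by (drule measurable_compose[OF _ measurable_component_singleton]) auto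

lemma measurable_leb_restrict [measurable (raw)]:
  "(\<And>i. i \<in> {..<n} \<Longrightarrow> (\<lambda>x. f x i) \<in> borel_measurable M) \<Longrightarrow>
    (\<lambda>x. \<lambda>i\<in>{..<n}. f x i) \<in> measurable M (leb n)"
  unfolding leb_def by (rule measurable_restrict) simp

lemma restrict_in_space_leb [simp]: "(\<lambda>i\<in>{..<n}. f i) \<in> space (leb n)"
  by (simp add: space_leb)

interpretation lborel_product: product_sigma_finite "\<lambda>_. lborel :: real measure"
  by standard

lemma sigma_finite_leb: "sigma_finite_measure (leb n)"
  unfolding leb_def by (rule lborel_product.sigma_finite) simp

interpretation leb_pair: pair_sigma_finite "leb n" "leb m" for n m
  by (intro pair_sigma_finite.intro sigma_finite_leb)

lemma emeasure_leb_PiE: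
  "(\<And>i. i < n \<Longrightarrow> A i \<in> sets borel) \<Longrightarrow> emeasure (leb n) (Pi\<^sub>E {..<n} A) = (\<Prod>i<n. emeasure lborel (A i))"
  unfolding leb_def by (rule lborel_product.emeasure_PiM) auto

lemma sets_leb_PiE: "(\<And>i. i < n \<Longrightarrow> A i \<in> sets borel) \<Longrightarrow> Pi\<^sub>E {..<n} A \<in> sets (leb n)"
  unfolding leb_def by (rule sets_PiM_I_finite) auto

lemma leb_affine:
  assumes c: "c \<noteq> 0"
  shows "leb n = density (distr (leb n) (leb n) (\<lambda>x. \<lambda>i\<in>{..<n}. v i + c * x i)) (\<lambda>_. ennreal (\<bar>c\<bar> ^ n))"
proof -
  let ?T = "\<lambda>x. \<lambda>i\<in>{..<n}. v i + c * x i"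
  have T[measurable]: "?T \<in> measurable (leb n) (leb n)" by measurable
  have "density (distr (leb n) (leb n) ?T) (\<lambda>_. ennreal (\<bar>c\<bar> ^ n)) = (\<Pi>\<^sub>M i\<in>{..<n}. lborel)"
  proof (rule lborel_product.PiM_eqI)
    fix A :: "nat \<Rightarrow> real set" assume A: "\<And>i. i \<in> {..<n} \<Longrightarrow> A i \<in> sets lborel"
    have [measurable]: "Pi\<^sub>E {..<n} A \<in> sets (leb n)" using A by (intro sets_leb_PiE) auto
    have one: "emeasure lborel B = ennreal \<bar>c\<bar> * emeasure lborel ((\<lambda>y. a + c * y) -` B)"
      if "B \<in> sets borel" for B and a :: real
    proof -
      have "emeasure lborel B = emeasure (density (distr lborel borel (\<lambda>x. a + c * x)) (\<lambda>_. ennreal \<bar>c\<bar>)) B"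
        using lborel_real_affine[OF c, of a] by simp
      then show ?thesis using that by (simp add: emeasure_density_const emeasure_distr)
    qed
    have pre: "?T -` Pi\<^sub>E {..<n} A \<inter> space (leb n) = Pi\<^sub>E {..<n} (\<lambda>i. (\<lambda>y. v i + c * y) -` A i)"
      by (auto simp: space_leb PiE_def Pi_def)
    have "emeasure (density (distr (leb n) (leb n) ?T) (\<lambda>_. ennreal (\<bar>c\<bar> ^ n))) (Pi\<^sub>E {..<n} A)
        = ennreal (\<bar>c\<bar> ^ n) * (\<Prod>i<n. emeasure lborel ((\<lambda>y. v i + c * y) -` A i))"
      using A by (simp add: emeasure_density_const emeasure_distr pre emeasure_leb_PiE)
         (subst emeasure_leb_PiE, auto intro!: measurable_sets_borel[of _ borel])
    also have "\<dots> = (\<Prod>i<n. ennreal \<bar>c\<bar> * emeasure lborel ((\<lambda>y. v i + c * y) -` A i))"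
      by (simp add: prod.distrib ennreal_power)
    also have "\<dots> = (\<Prod>i<n. emeasure lborel (A i))"
      using A by (intro prod.cong refl one[symmetric]) auto
    finally show "emeasure (density (distr (leb n) (leb n) ?T) (\<lambda>_. ennreal (\<bar>c\<bar> ^ n))) (Pi\<^sub>E {..<n} A)
        = (\<Prod>i<n. emeasure lborel (A i))" .
  qed (auto simp: leb_def cong: sets_PiM_cong)
  then show ?thesis by (simp add: leb_def)
qed

lemma nn_integral_leb_affine:
  assumes [measurable]: "f \<in> borel_measurable (leb n)" and c: "c \<noteq> 0"
  shows "(\<integral>\<^sup>+x. f x \<partial>leb n) = ennreal (\<bar>c\<bar> ^ n) * (\<integral>\<^sup>+x. f (\<lambda>i\<in>{..<n}. v i + c * x i) \<partial>leb n)"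
  by (subst leb_affine[OF c, of n v]) (simp add: nn_integral_density nn_integral_distr nn_integral_cmult)

lemma measurable_scale_vec [measurable (raw)]:
  assumes [measurable]: "f \<in> borel_measurable M" "g \<in> measurable M (leb n)"
  shows "(\<lambda>x. scale_vec n (f x) (g x)) \<in> measurable M (leb n)"
  unfolding scale_vec_def by measurable

lemma nn_integral_leb_scale:
  assumes "f \<in> borel_measurable (leb n)" and "0 < c"
  shows "(\<integral>\<^sup>+x. f x \<partial>leb n) = ennreal (c ^ n) * (\<integral>\<^sup>+x. f (scale_vec n c x) \<partial>leb n)"
  using nn_integral_leb_affine[of f n c "\<lambda>_. 0"] assms by (simp add: scale_vec_def)

text \<open>The Householder reflection in the hyperplane orthogonal to \<open>u\<close>. For
  \<open>u = 0\<close> division by zero makes it the identity, so no case distinction is needed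
  where the reflection vector degenerates.\<close>

definition reflect :: "nat \<Rightarrow> (nat \<Rightarrow> real) \<Rightarrow> (nat \<Rightarrow> real) \<Rightarrow> (nat \<Rightarrow> real)" where
  "reflect n u x = (\<lambda>i\<in>{..<n}. x i - 2 * (\<Sum>j<n. u j * x j) / (\<Sum>j<n. (u j)\<^sup>2) * u i)"

lemma measurable_reflect [measurable (raw)]:
  assumes [measurable]: "g \<in> measurable M (leb n)"
  shows "(\<lambda>x. reflect n u (g x)) \<in> measurable M (leb n)"
  unfolding reflect_def by measurable

lemma reflect_in_space [simp]: "reflect n u x \<in> space (leb n)"
  unfolding reflect_def by simp

lemma reflect_apply: "i < n \<Longrightarrow>
    reflect n u x i = x i - 2 * (\<Sum>j<n. u j * x j) / (\<Sum>j<n. (u j)\<^sup>2) * u i"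
  by (simp add: reflect_def)

lemma reflect_lincomb:
  "i < n \<Longrightarrow> reflect n u (\<lambda>i\<in>{..<n}. a * x i + b * y i) i = a * reflect n u x i + b * reflect n u y i"
proof -
  assume i: "i < n"
  have "(\<Sum>j<n. u j * (\<lambda>i\<in>{..<n}. a * x i + b * y i) j) = (\<Sum>j<n. a * (u j * x j) + b * (u j * y j))"
    by (rule sum.cong) (auto simp: algebra_simps)
  also have "\<dots> = a * (\<Sum>j<n. u j * x j) + b * (\<Sum>j<n. u j * y j)"
    by (simp add: sum.distrib sum_distrib_left)
  finally show ?thesis using i
    by (simp add: reflect_def add_divide_distrib algebra_simps)
qed

lemma reflect_dot: "(\<Sum>i<n. reflect n u x i * reflect n u y i) = (\<Sum>i<n. x i * y i)"
proof -
  define a b s where "a = (\<Sum>j<n. u j * x j)" and "b = (\<Sum>j<n. u j * y j)" and "s = (\<Sum>j<n. (u j)\<^sup>2)"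
  have Q: "reflect n u x i = x i - 2 * a / s * u i" "reflect n u y i = y i - 2 * b / s * u i" if "i < n" for i
    using that by (simp_all add: reflect_apply a_def b_def s_def)
  have "(\<Sum>i<n. reflect n u x i * reflect n u y i) =
      (\<Sum>i<n. x i * y i - 2 * b / s * (u i * x i) - 2 * a / s * (u i * y i) + 4 * a * b / (s * s) * (u i)\<^sup>2)"
    by (intro sum.cong refl, simp only: lessThan_iff Q) (simp add: algebra_simps power2_eq_square)
  also have "\<dots> = (\<Sum>i<n. x i * y i) - 2 * b / s * a - 2 * a / s * b + 4 * a * b / (s * s) * s"
    by (simp only: sum.distrib sum_subtractf sum_distrib_left[symmetric] a_def[symmetric] b_def[symmetric] s_def[symmetric])
  also have "\<dots> = (\<Sum>i<n. x i * y i)" by (cases "s = 0") (auto simp: field_simps)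
  finally show ?thesis .
qed

lemma reflect_reflect: "x \<in> space (leb n) \<Longrightarrow> reflect n u (reflect n u x) = x"
proof
  fix i assume x: "x \<in> space (leb n)"
  define a s where "a = (\<Sum>j<n. u j * x j)" and "s = (\<Sum>j<n. (u j)\<^sup>2)"
  have Q: "reflect n u x i = x i - 2 * a / s * u i" if "i < n" for i
    using that by (simp add: reflect_apply a_def s_def)
  have "(\<Sum>j<n. u j * reflect n u x j) = (\<Sum>j<n. u j * x j - 2 * a / s * (u j)\<^sup>2)"
    by (intro sum.cong refl, simp only: lessThan_iff Q) (simp add: algebra_simps power2_eq_square)
  also have "\<dots> = a - 2 * a / s * s"
    by (simp only: sum_subtractf sum_distrib_left[symmetric] a_def[symmetric] s_def[symmetric])
  finally have D: "(\<Sum>j<n. u j * reflect n u x j) = a - 2 * a / s * s" .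
  have "reflect n u (reflect n u x) i = x i" if "i < n"
  proof -
    have "reflect n u (reflect n u x) i = x i - 2 * a / s * u i - 2 * (a - 2 * a / s * s) / s * u i"
      using reflect_apply[OF that, of u "reflect n u x"] by (simp only: D Q[OF that] s_def[symmetric])
    then show ?thesis by (cases "s = 0") (auto simp: field_simps)
  qed
  then show "reflect n u (reflect n u x) i = x i"
    using x by (cases "i < n") (auto simp: reflect_def space_leb extensional_def)
qed

text \<open>With Q for the reflection, y - Qx = Q(Qy - x) because Q is a linear involution, and Q
  preserves inner products.\<close>

lemma sum_square_reflect_diff:
  assumes "x \<in> space (leb n)" "y \<in> space (leb n)"
  shows "(\<Sum>i<n. (y i - reflect n u x i)\<^sup>2) = (\<Sum>i<n. (reflect n u y i - x i)\<^sup>2)"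
proof -
  let ?z = "\<lambda>i\<in>{..<n}. 1 * reflect n u y i + (- 1) * x i"
  have "(\<Sum>i<n. (reflect n u y i - x i)\<^sup>2) = (\<Sum>i<n. ?z i * ?z i)"
    by (rule sum.cong) (auto simp: power2_eq_square)
  also have "\<dots> = (\<Sum>i<n. reflect n u ?z i * reflect n u ?z i)"
    by (rule reflect_dot[symmetric])
  also have "\<dots> = (\<Sum>i<n. (y i - reflect n u x i)\<^sup>2)"
  proof (intro sum.cong refl)
    fix i assume "i \<in> {..<n}"
    then have "reflect n u ?z i = y i - reflect n u x i"
      using reflect_lincomb[of i n u 1 "reflect n u y" "- 1" x] reflect_reflect[OF assms(2), of u] by auto
    then show "reflect n u ?z i * reflect n u ?z i = (y i - reflect n u x i)\<^sup>2"
      by (simp only: power2_eq_square)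
  qed
  finally show ?thesis ..
qed

lemma emeasure_euclid_ball:
  "emeasure (leb n) {x\<in>space (leb n). (\<Sum>i<n. (x i)\<^sup>2) \<le> 1} \<noteq> 0" (is "emeasure _ ?B \<noteq> 0")
  "emeasure (leb n) {x\<in>space (leb n). (\<Sum>i<n. (x i)\<^sup>2) \<le> 1} \<noteq> \<infinity>"
proof -
  have [measurable]: "?B \<in> sets (leb n)" by measurable
  \<comment> \<open>Half the side of a cube inside the ball:
    \<open>n * a\<^sup>2 \<le> n * a \<le> 1\<close>. The \<open>+ 1\<close> also covers dimension
    0.\<close>
  define a where "a = 1 / (real n + 1)"
  have a: "0 < a" "a \<le> 1" "real n * a \<le> 1" by (auto simp: a_def field_simps)
  have sub: "Pi\<^sub>E {..<n} (\<lambda>_. {-a..a}) \<subseteq> ?B"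
  proof
    fix x assume x: "x \<in> Pi\<^sub>E {..<n} (\<lambda>_. {-a..a})"
    have "(\<Sum>i<n. (x i)\<^sup>2) \<le> (\<Sum>i<n. a)"
    proof (rule sum_mono)
      fix i assume "i \<in> {..<n}"
      then have "\<bar>x i\<bar> \<le> a" using x by (auto simp: PiE_def Pi_def abs_le_iff)
      then have "\<bar>x i\<bar> * \<bar>x i\<bar> \<le> a * 1" using a by (intro mult_mono) auto
      then show "(x i)\<^sup>2 \<le> a" by (simp add: power2_eq_square)
    qed
    then show "x \<in> ?B" using x a by (auto simp: space_leb PiE_def)
  qed
  have "0 < ennreal ((2 * a) ^ n)" using a by (simp add: ennreal_less_zero_iff)
  also have "\<dots> = (\<Prod>i<n. emeasure lborel {-a..a})"
    using a by (simp add: ennreal_power)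
  also have "\<dots> = emeasure (leb n) (Pi\<^sub>E {..<n} (\<lambda>_. {-a..a}))" by (rule emeasure_leb_PiE[symmetric]) auto
  also have "\<dots> \<le> emeasure (leb n) ?B" by (rule emeasure_mono[OF sub]) measurable
  finally show "emeasure (leb n) ?B \<noteq> 0" by simp
  have sup: "?B \<subseteq> Pi\<^sub>E {..<n} (\<lambda>_. {-1..1})"
  proof
    fix x assume x: "x \<in> ?B"
    have "x i \<in> {-1..1}" if "i < n" for i
    proof -
      have "(x i)\<^sup>2 \<le> (\<Sum>i<n. (x i)\<^sup>2)" using that by (intro member_le_sum) auto
      then have "(x i)\<^sup>2 \<le> 1" using x by simp
      then show ?thesis by (simp add: abs_square_le_1 abs_le_iff)
    qed
    then show "x \<in> Pi\<^sub>E {..<n} (\<lambda>_. {-1..1})" using x by (auto simp: space_leb PiE_def)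
  qed
  have "emeasure (leb n) ?B \<le> emeasure (leb n) (Pi\<^sub>E {..<n} (\<lambda>_. {-1..1}))"
    by (rule emeasure_mono[OF sup]) (auto intro: sets_leb_PiE)
  also have "\<dots> = (\<Prod>i<n. emeasure lborel {-1..1::real})" by (rule emeasure_leb_PiE) auto
  also have "\<dots> < \<infinity>" by (simp add: power_less_top_ennreal)
  finally show "emeasure (leb n) ?B \<noteq> \<infinity>" by simp
qed

text \<open>Both sides, multiplied by the volume of the Euclidean ball, are rewritten by Fubini's theorem and
  translation invariance; only the invariance of the ball under the reflection enters.\<close>

lemma nn_integral_leb_reflect:
  assumes f[measurable]: "f \<in> borel_measurable (leb n)"
  shows "(\<integral>\<^sup>+x. f (reflect n u x) \<partial>leb n) = (\<integral>\<^sup>+x. f x \<partial>leb n)"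
proof -
  define B where "B = {x\<in>space (leb n). (\<Sum>i<n. (x i)\<^sup>2) \<le> 1}"
  have [measurable]: "B \<in> sets (leb n)" unfolding B_def by measurable
  let ?g = "indicator B :: (nat \<Rightarrow> real) \<Rightarrow> ennreal"
  let ?Q = "reflect n u"
  have add: "?Q (\<lambda>i\<in>{..<n}. ?Q y i + 1 * x i) = (\<lambda>i\<in>{..<n}. ?Q x i + 1 * y i)" if "y \<in> space (leb n)" for x y
  proof
    fix i
    have "?Q (\<lambda>i\<in>{..<n}. 1 * ?Q y i + 1 * x i) i = 1 * ?Q (?Q y) i + 1 * ?Q x i" if "i < n"
      by (rule reflect_lincomb[OF that])
    then show "?Q (\<lambda>i\<in>{..<n}. ?Q y i + 1 * x i) i = (\<lambda>i\<in>{..<n}. ?Q x i + 1 * y i) i"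
      using reflect_reflect[OF that, of u] reflect_in_space[of n u "\<lambda>i\<in>{..<n}. ?Q y i + 1 * x i"]
      by (cases "i < n") (auto simp: space_leb extensional_def)
  qed
  have "(\<integral>\<^sup>+y. ?g y \<partial>leb n) * (\<integral>\<^sup>+x. f (?Q x) \<partial>leb n) = (\<integral>\<^sup>+y. ?g y * (\<integral>\<^sup>+x. f (?Q x) \<partial>leb n) \<partial>leb n)"
    by (subst nn_integral_multc) auto
  also have "\<dots> = (\<integral>\<^sup>+y. (\<integral>\<^sup>+x. ?g y * f (\<lambda>i\<in>{..<n}. ?Q x i + 1 * y i) \<partial>leb n) \<partial>leb n)"
  proof (rule nn_integral_cong)
    fix y assume y: "y \<in> space (leb n)"
    have "(\<integral>\<^sup>+x. f (?Q x) \<partial>leb n) = (\<integral>\<^sup>+x. f (?Q (\<lambda>i\<in>{..<n}. ?Q y i + 1 * x i)) \<partial>leb n)"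
      by (subst nn_integral_leb_affine[of _ n 1 "?Q y"]) auto
    then show "?g y * (\<integral>\<^sup>+x. f (?Q x) \<partial>leb n) = (\<integral>\<^sup>+x. ?g y * f (\<lambda>i\<in>{..<n}. ?Q x i + 1 * y i) \<partial>leb n)"
      by (simp only: add[OF y]) (subst nn_integral_cmult, auto)
  qed
  also have "\<dots> = (\<integral>\<^sup>+x. (\<integral>\<^sup>+y. ?g y * f (\<lambda>i\<in>{..<n}. ?Q x i + 1 * y i) \<partial>leb n) \<partial>leb n)"
    by (rule leb_pair.Fubini') measurable
  also have "\<dots> = (\<integral>\<^sup>+x. (\<integral>\<^sup>+y. ?g (\<lambda>i\<in>{..<n}. y i - ?Q x i) * f y \<partial>leb n) \<partial>leb n)"
  proof (rule nn_integral_cong)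
    fix x assume x: "x \<in> space (leb n)"
    have "(\<integral>\<^sup>+y. ?g (\<lambda>i\<in>{..<n}. y i - ?Q x i) * f y \<partial>leb n) =
      (\<integral>\<^sup>+y. ?g (\<lambda>i\<in>{..<n}. (\<lambda>i\<in>{..<n}. ?Q x i + 1 * y i) i - ?Q x i) * f (\<lambda>i\<in>{..<n}. ?Q x i + 1 * y i) \<partial>leb n)"
      by (subst nn_integral_leb_affine[of _ n 1 "?Q x"]) auto
    also have "\<dots> = (\<integral>\<^sup>+y. ?g y * f (\<lambda>i\<in>{..<n}. ?Q x i + 1 * y i) \<partial>leb n)"
    proof (rule nn_integral_cong)
      fix y assume "y \<in> space (leb n)"
      then have "(\<lambda>i\<in>{..<n}. (\<lambda>i\<in>{..<n}. ?Q x i + 1 * y i) i - ?Q x i) = y"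
        by (auto simp: space_leb extensional_def)
      then show "?g (\<lambda>i\<in>{..<n}. (\<lambda>i\<in>{..<n}. ?Q x i + 1 * y i) i - ?Q x i) * f (\<lambda>i\<in>{..<n}. ?Q x i + 1 * y i)
          = ?g y * f (\<lambda>i\<in>{..<n}. ?Q x i + 1 * y i)" by simp
    qed
    finally show "(\<integral>\<^sup>+y. ?g y * f (\<lambda>i\<in>{..<n}. ?Q x i + 1 * y i) \<partial>leb n) =
      (\<integral>\<^sup>+y. ?g (\<lambda>i\<in>{..<n}. y i - ?Q x i) * f y \<partial>leb n)" ..
  qed
  also have "\<dots> = (\<integral>\<^sup>+y. (\<integral>\<^sup>+x. ?g (\<lambda>i\<in>{..<n}. y i - ?Q x i) * f y \<partial>leb n) \<partial>leb n)"
    by (rule leb_pair.Fubini') measurable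
  also have "\<dots> = (\<integral>\<^sup>+y. (\<integral>\<^sup>+x. ?g x \<partial>leb n) * f y \<partial>leb n)"
  proof (rule nn_integral_cong)
    fix y assume y: "y \<in> space (leb n)"
    have "(\<integral>\<^sup>+x. ?g (\<lambda>i\<in>{..<n}. y i - ?Q x i) * f y \<partial>leb n) = (\<integral>\<^sup>+x. ?g (\<lambda>i\<in>{..<n}. y i - ?Q x i) \<partial>leb n) * f y"
      by (rule nn_integral_multc) measurable
    \<comment> \<open>The vectors y - Qx and Qy - x have the same length. This moves the reflection
      from the integration variable to the fixed \<open>y\<close>, where it is a mere
      translation.\<close>
    also have "(\<integral>\<^sup>+x. ?g (\<lambda>i\<in>{..<n}. y i - ?Q x i) \<partial>leb n) = (\<integral>\<^sup>+x. ?g (\<lambda>i\<in>{..<n}. ?Q y i + (- 1) * x i) \<partial>leb n)"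
    proof (rule nn_integral_cong)
      fix x assume x: "x \<in> space (leb n)"
      show "?g (\<lambda>i\<in>{..<n}. y i - ?Q x i) = ?g (\<lambda>i\<in>{..<n}. ?Q y i + (- 1) * x i)"
        using sum_square_reflect_diff[OF x y, of u] by (simp add: B_def indicator_def)
    qed
    also have "\<dots> = (\<integral>\<^sup>+x. ?g x \<partial>leb n)"
      by (subst nn_integral_leb_affine[of ?g n "- 1" "?Q y"]) auto
    finally show "(\<integral>\<^sup>+x. ?g (\<lambda>i\<in>{..<n}. y i - ?Q x i) * f y \<partial>leb n) = (\<integral>\<^sup>+x. ?g x \<partial>leb n) * f y" .
  qed
  also have "\<dots> = (\<integral>\<^sup>+x. ?g x \<partial>leb n) * (\<integral>\<^sup>+y. f y \<partial>leb n)"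
    by (rule nn_integral_cmult) measurable
  finally show ?thesis
    using emeasure_euclid_ball[of n] by (simp add: B_def[symmetric] ennreal_mult_cancel_left)
qed

section \<open>Dyadic regularity\<close>

text \<open>The half-open dyadic cube of side \<open>(1 / 2) ^ m\<close> containing
  \<open>x\<close>. Equality of floors makes the cubes of one level a partition that refines those
  of lower levels, so any two cubes are nested or disjoint.\<close>

definition dcube :: "nat \<Rightarrow> nat \<Rightarrow> (nat \<Rightarrow> real) \<Rightarrow> (nat \<Rightarrow> real) set" where
  "dcube n m x = {y \<in> space (leb n). \<forall>i<n. \<lfloor>2 ^ m * y i\<rfloor> = \<lfloor>2 ^ m * x i\<rfloor>}"

text \<open>Openness in the topology generated by the half-open cubes. It is finer than the
  Euclidean topology: the cubes themselves are open, so intersecting with \<open>unit_cube\<close>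
  stays within the class.\<close>

definition dopen :: "nat \<Rightarrow> (nat \<Rightarrow> real) set \<Rightarrow> bool" where
  "dopen n U \<longleftrightarrow> U \<subseteq> space (leb n) \<and> (\<forall>x\<in>U. \<exists>m. dcube n m x \<subseteq> U)"

lemma dcube_self: "x \<in> space (leb n) \<Longrightarrow> x \<in> dcube n m x"
  by (simp add: dcube_def)

lemma dcube_eq: "y \<in> dcube n m x \<Longrightarrow> dcube n m y = dcube n m x"
  by (auto simp: dcube_def)

lemma sets_dcube [measurable]: "dcube n m x \<in> sets (leb n)"
proof -
  have "dcube n m x = {y \<in> space (leb n). \<forall>i\<in>{..<n}. \<lfloor>2 ^ m * y i\<rfloor> = \<lfloor>2 ^ m * x i\<rfloor>}"
    by (auto simp: dcube_def)
  also have "\<dots> \<in> sets (leb n)" by measurable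
  finally show ?thesis .
qed

lemma dcube_antimono:
  assumes "m \<le> m'" shows "dcube n m' x \<subseteq> dcube n m x"
proof -
  obtain k where k: "m' = m + k" using assms by (auto simp: le_iff_add)
  have "\<lfloor>2 ^ m * t\<rfloor> = \<lfloor>2 ^ m' * t\<rfloor> div 2 ^ k" for t :: real
    using floor_divide_real_eq_div[of "2 ^ k" "2 ^ m' * t"] by (simp add: k power_add)
  then show ?thesis by (auto simp: dcube_def)
qed

lemma dcube_dist:
  assumes "y \<in> dcube n m x" "i < n" shows "\<bar>y i - x i\<bar> < (1 / 2) ^ m"
proof -
  have "\<lfloor>2 ^ m * y i\<rfloor> = \<lfloor>2 ^ m * x i\<rfloor>" using assms by (auto simp: dcube_def)
  then have "\<bar>2 ^ m * y i - 2 ^ m * x i\<bar> < 1" by linarith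
  also have "\<bar>2 ^ m * y i - 2 ^ m * x i\<bar> = 2 ^ m * \<bar>y i - x i\<bar>"
    by (simp add: right_diff_distrib[symmetric] abs_mult)
  finally show ?thesis by (simp add: field_simps)
qed

lemma dopen_dcube: "dopen n (dcube n m x)"
  unfolding dopen_def
proof (intro conjI ballI)
  show "dcube n m x \<subseteq> space (leb n)" by (auto simp: dcube_def)
  fix y assume "y \<in> dcube n m x"
  then show "\<exists>k. dcube n k y \<subseteq> dcube n m x" using dcube_eq by blast
qed

lemma dopen_Un: "(\<And>U. U \<in> \<U> \<Longrightarrow> dopen n U) \<Longrightarrow> dopen n (\<Union>\<U>)"
  unfolding dopen_def by (meson Sup_least Sup_upper UnionE order_trans)

lemma dopen_Int:
  assumes "dopen n U" "dopen n V" shows "dopen n (U \<inter> V)"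
  unfolding dopen_def
proof (intro conjI ballI)
  show "U \<inter> V \<subseteq> space (leb n)" using assms by (auto simp: dopen_def)
  fix x assume "x \<in> U \<inter> V"
  then obtain a b where "dcube n a x \<subseteq> U" "dcube n b x \<subseteq> V" using assms unfolding dopen_def by blast
  then have "dcube n (max a b) x \<subseteq> U \<inter> V"
    using dcube_antimono[of a "max a b" n x] dcube_antimono[of b "max a b" n x] by auto
  then show "\<exists>m. dcube n m x \<subseteq> U \<inter> V" ..
qed

lemma dopen_space: "dopen n (space (leb n))"
  by (auto simp: dopen_def dcube_def)

lemma countable_dcubes: "countable (range (\<lambda>(m, x). dcube n m x))"
proof -
  let ?D = "\<lambda>(m, z). {y \<in> space (leb n). \<forall>i<n. \<lfloor>2 ^ m * y i\<rfloor> = z i}"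
  have "range (\<lambda>(m, x). dcube n m x) \<subseteq> ?D ` (UNIV \<times> Pi\<^sub>E {..<n} (\<lambda>_. UNIV))"
  proof safe
    fix m x
    have "dcube n m x = ?D (m, \<lambda>i\<in>{..<n}. \<lfloor>2 ^ m * x i\<rfloor>)" by (auto simp: dcube_def)
    then show "dcube n m x \<in> ?D ` (UNIV \<times> Pi\<^sub>E {..<n} (\<lambda>_. UNIV))"
      by (rule image_eqI) auto
  qed
  then show ?thesis
    by (rule countable_subset) (auto intro!: countable_SIGMA countable_PiE)
qed

text \<open>The pieces are the maximal dyadic cubes inside \<open>U\<close>: cubes that meet are
  nested, and maximality of both makes them equal.\<close>

lemma dopen_decompose:
  assumes "dopen n U"
  obtains \<C> where "countable \<C>" "disjoint \<C>" "\<forall>Q\<in>\<C>. \<exists>m x. Q = dcube n m x" "U = \<Union>\<C>"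
proof -
  define l where "l x = (LEAST m. dcube n m x \<subseteq> U)" for x
  define \<C> where "\<C> = (\<lambda>x. dcube n (l x) x) ` U"
  have l: "dcube n (l x) x \<subseteq> U" if "x \<in> U" for x
    using assms that unfolding l_def dopen_def by (metis (lifting) LeastI)
  have lmin: "l x \<le> m" if "dcube n m x \<subseteq> U" for x m
    unfolding l_def using that by (rule Least_le)
  have U: "U \<subseteq> space (leb n)" using assms by (simp add: dopen_def)
  show thesis
  proof (rule that[of \<C>])
    show "countable \<C>"
      using countable_dcubes[of n] by (rule countable_subset[rotated]) (auto simp: \<C>_def)
    have *: "dcube n (l x) x = dcube n (l x') x'"
      if "x \<in> U" "x' \<in> U" "y \<in> dcube n (l x) x" "y \<in> dcube n (l x') x'" "l x \<le> l x'" for x x' y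
    proof -
      have "dcube n (l x) x' = dcube n (l x) y"
        using that dcube_antimono[OF that(5), of n x'] dcube_eq by blast
      also have eq: "\<dots> = dcube n (l x) x" using that dcube_eq by blast
      finally have "dcube n (l x) x' \<subseteq> U" using l that by simp
      then have "l x' \<le> l x" by (rule lmin)
      then have "l x' = l x" using that by simp
      then show ?thesis using \<open>dcube n (l x) x' = dcube n (l x) y\<close> eq by simp
    qed
    show "disjoint \<C>"
      unfolding disjoint_def
    proof (intro ballI impI)
      fix A B assume "A \<in> \<C>" "B \<in> \<C>" "A \<noteq> B"
      then obtain x x' where x: "x \<in> U" "A = dcube n (l x) x" "x' \<in> U" "B = dcube n (l x') x'"
        by (auto simp: \<C>_def)
      show "A \<inter> B = {}"
      proof (rule ccontr)
        assume "A \<inter> B \<noteq> {}"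
        then obtain y where "y \<in> dcube n (l x) x" "y \<in> dcube n (l x') x'" using x by auto
        then have "A = B"
          using *[OF x(1,3), of y] *[OF x(3,1), of y] unfolding x(2,4) by (cases "l x \<le> l x'") simp_all
        then show False using \<open>A \<noteq> B\<close> by simp
      qed
    qed
    show "\<forall>Q\<in>\<C>. \<exists>m x. Q = dcube n m x" by (auto simp: \<C>_def)
    show "U = \<Union>\<C>"
    proof (intro subset_antisym subsetI)
      fix x assume "x \<in> U"
      then show "x \<in> \<Union>\<C>" using dcube_self[of x n "l x"] U unfolding \<C>_def by auto
    next
      fix x assume "x \<in> \<Union>\<C>"
      then show "x \<in> U" using l unfolding \<C>_def by auto
    qed
  qed
qed

lemma sets_dopen: "dopen n U \<Longrightarrow> U \<in> sets (leb n)"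
proof (erule dopen_decompose)
  fix \<C> assume "countable \<C>" and *: "\<forall>Q\<in>\<C>. \<exists>m x. Q = dcube n m x" "U = \<Union>\<C>"
  moreover have "\<C> \<subseteq> sets (leb n)" using * sets_dcube by fastforce
  ultimately show "U \<in> sets (leb n)" by (simp add: sets.countable_Union)
qed

section \<open>Outer regularity of finite measures with respect to unions of dyadic cubes\<close>

definition dregular :: "nat \<Rightarrow> (nat \<Rightarrow> real) measure \<Rightarrow> (nat \<Rightarrow> real) set \<Rightarrow> bool" where
  "dregular n \<mu> E \<longleftrightarrow> (\<forall>e>0. \<exists>U. dopen n U \<and> E \<subseteq> U \<and> measure \<mu> (U - E) < e)"

lemma dregular_dopen: "dopen n U \<Longrightarrow> dregular n \<mu> U"
  unfolding dregular_def by (metis Diff_cancel measure_empty order_refl)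

context
  fixes n :: nat and \<mu> :: "(nat \<Rightarrow> real) measure"
  assumes fin: "finite_measure \<mu>" and sets_mu [measurable_cong]: "sets \<mu> = sets (leb n)"
begin

interpretation finite_measure \<mu> by (rule fin)

lemma space_mu: "space \<mu> = space (leb n)"
  using sets_mu by (rule sets_eq_imp_space_eq)

lemma sets_dopen_mu: "dopen n U \<Longrightarrow> U \<in> sets \<mu>"
  by (simp add: sets_dopen sets_mu)

lemma dregular_UN:
  assumes E: "\<And>j::nat. E j \<in> sets \<mu>" "\<And>j. dregular n \<mu> (E j)"
  shows "dregular n \<mu> (\<Union>j. E j)"
  unfolding dregular_def
proof (intro allI impI)
  fix e :: real assume e: "0 < e"
  have "\<forall>j. \<exists>U. dopen n U \<and> E j \<subseteq> U \<and> measure \<mu> (U - E j) < e / 2 * (1 / 2) ^ Suc j"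
  proof
    fix j show "\<exists>U. dopen n U \<and> E j \<subseteq> U \<and> measure \<mu> (U - E j) < e / 2 * (1 / 2) ^ Suc j"
      using E(2)[of j, unfolded dregular_def, rule_format, of "e / 2 * (1 / 2) ^ Suc j"] e by simp
  qed
  then obtain U where U: "\<And>j. dopen n (U j)" "\<And>j. E j \<subseteq> U j" "\<And>j. measure \<mu> (U j - E j) < e / 2 * (1 / 2) ^ Suc j"
    by metis
  have s: "(\<lambda>j. e / 2 * (1 / 2) ^ Suc j) sums (e / 2)"
    using sums_mult[OF power_half_series, of "e / 2"] by simp
  have sm: "summable (\<lambda>j. measure \<mu> (U j - E j))"
    using U(3) by (intro summable_comparison_test'[OF sums_summable[OF s], of 0]) (simp add: less_imp_le)
  have [measurable]: "U j \<in> sets \<mu>" "E j \<in> sets \<mu>" for j using U(1) E(1) by (auto intro: sets_dopen_mu)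
  have "measure \<mu> ((\<Union>j. U j) - (\<Union>j. E j)) \<le> measure \<mu> (\<Union>j. U j - E j)"
    by (rule finite_measure_mono) auto
  also have "\<dots> \<le> (\<Sum>j. measure \<mu> (U j - E j))"
    by (rule finite_measure_subadditive_countably) (auto simp: sm)
  also have "\<dots> \<le> (\<Sum>j. e / 2 * (1 / 2) ^ Suc j)"
    using U(3) by (intro suminf_le sm sums_summable[OF s]) (simp add: less_imp_le)
  also have "\<dots> < e" using sums_unique[OF s] e by simp
  finally show "\<exists>V. dopen n V \<and> (\<Union>j. E j) \<subseteq> V \<and> measure \<mu> (V - (\<Union>j. E j)) < e"
    using U by (intro exI[of _ "\<Union>j. U j"]) (auto intro: dopen_Un)
qed

lemma dregular_Int:
  assumes E: "E \<in> sets \<mu>" "F \<in> sets \<mu>" "dregular n \<mu> E" "dregular n \<mu> F"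
  shows "dregular n \<mu> (E \<inter> F)"
  unfolding dregular_def
proof (intro allI impI)
  fix e :: real assume e: "0 < e"
  then obtain U V where U: "dopen n U" "E \<subseteq> U" "measure \<mu> (U - E) < e / 2"
    and V: "dopen n V" "F \<subseteq> V" "measure \<mu> (V - F) < e / 2"
    using E(3,4) unfolding dregular_def by (meson half_gt_zero)
  have [measurable]: "U \<in> sets \<mu>" "V \<in> sets \<mu>" using U V by (auto intro: sets_dopen_mu)
  have "measure \<mu> (U \<inter> V - E \<inter> F) \<le> measure \<mu> ((U - E) \<union> (V - F))"
    using E by (intro finite_measure_mono) auto
  also have "\<dots> \<le> measure \<mu> (U - E) + measure \<mu> (V - F)"
    using E by (intro measure_Un_le) auto
  also have "\<dots> < e" using U V by simp
  finally show "\<exists>W. dopen n W \<and> E \<inter> F \<subseteq> W \<and> measure \<mu> (W - E \<inter> F) < e"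
    using U V dopen_Int by blast
qed

text \<open>Finite intersections inherit regularity, and by continuity from above one of them has
  measure close to that of the whole intersection; an open set chosen for it serves for the latter
  too.\<close>

lemma dregular_INT:
  assumes E: "\<And>j::nat. E j \<in> sets \<mu>" "\<And>j. dregular n \<mu> (E j)"
  shows "dregular n \<mu> (\<Inter>j. E j)"
  unfolding dregular_def
proof (intro allI impI)
  fix e :: real assume e: "0 < e"
  define F where "F k = (\<Inter>j\<le>k. E j)" for k
  have F: "F k \<in> sets \<mu>" "dregular n \<mu> (F k)" for k
  proof (induction k)
    case (Suc k)
    have eq: "F (Suc k) = F k \<inter> E (Suc k)" by (auto simp: F_def atMost_Suc)
    { case 1 then show ?case using Suc E eq by auto }
    { case 2 then show ?case using Suc E dregular_Int eq by auto }
  qed (use E in \<open>auto simp: F_def\<close>)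
  have "decseq F" unfolding F_def decseq_def by (auto intro: order_trans)
  then have "(\<lambda>k. measure \<mu> (F k)) \<longlonglongrightarrow> measure \<mu> (\<Inter>k. F k)"
    using F by (intro finite_Lim_measure_decseq) auto
  moreover have eq: "(\<Inter>k. F k) = (\<Inter>j. E j)" by (auto simp: F_def)
  ultimately have "eventually (\<lambda>k. measure \<mu> (F k) < measure \<mu> (\<Inter>j. E j) + e / 2) sequentially"
    using e by (intro order_tendstoD(2)[of _ "measure \<mu> (\<Inter>j. E j)"]) auto
  then obtain k where k: "measure \<mu> (F k) < measure \<mu> (\<Inter>j. E j) + e / 2"
    by (auto simp: eventually_sequentially)
  obtain U where U: "dopen n U" "F k \<subseteq> U" "measure \<mu> (U - F k) < e / 2"
    using F(2)[of k] e unfolding dregular_def by (meson half_gt_zero)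
  have [measurable]: "U \<in> sets \<mu>" "F k \<in> sets \<mu>" "(\<Inter>j. E j) \<in> sets \<mu>" using U F E by (auto intro: sets_dopen_mu)
  have "(\<Inter>j. E j) \<subseteq> F k" by (auto simp: F_def)
  then have "measure \<mu> (U - (\<Inter>j. E j)) = measure \<mu> U - measure \<mu> (\<Inter>j. E j)"
    using U by (intro finite_measure_Diff) auto
  also have "\<dots> < e"
    using k U finite_measure_Diff[of U "F k"] by simp
  finally show "\<exists>V. dopen n V \<and> (\<Inter>j. E j) \<subseteq> V \<and> measure \<mu> (V - (\<Inter>j. E j)) < e"
    using U \<open>(\<Inter>j. E j) \<subseteq> F k\<close> by (intro exI[of _ U]) auto
qed

text \<open>The sets that are outer regular together with their complements form a sigma-algebra:
  unlike outer regularity alone, this property is stable under complements. It contains the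
  half-spaces, which generate the Borel sets.\<close>

lemma dregular_all:
  assumes "E \<in> sets (leb n)" shows "dregular n \<mu> E"
proof -
  let ?S = "space (leb n)"
  define \<G> where "\<G> = {E \<in> sets \<mu>. dregular n \<mu> E \<and> dregular n \<mu> (?S - E)}"
  have sa: "sigma_algebra ?S \<G>"
    unfolding sigma_algebra_iff2
  proof safe
    fix E x assume "E \<in> \<G>" "x \<in> E" then show "x \<in> ?S"
      using sets.sets_into_space[of E \<mu>] by (auto simp: \<G>_def space_mu)
  next
    show "{} \<in> \<G>" by (auto simp: \<G>_def intro!: dregular_dopen dopen_space) (auto simp: dopen_def)
  next
    fix E assume "E \<in> \<G>"
    then show "?S - E \<in> \<G>"
      using sets.sets_into_space[of E \<mu>] by (auto simp: \<G>_def double_diff space_mu[symmetric])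
  next
    fix E :: "nat \<Rightarrow> (nat \<Rightarrow> real) set" assume "range E \<subseteq> \<G>"
    then have E: "E j \<in> sets \<mu>" "dregular n \<mu> (E j)" "dregular n \<mu> (?S - E j)" for j by (auto simp: \<G>_def)
    have eq: "?S - (\<Union>j. E j) = (\<Inter>j. ?S - E j)" by auto
    show "(\<Union>j. E j) \<in> \<G>"
      unfolding \<G>_def mem_Collect_eq eq
      using E dregular_UN[of E] dregular_INT[of "\<lambda>j. ?S - E j"] by (auto simp: space_mu[symmetric])
  qed
  \<comment> \<open>A zero measure as carrier of \<G>: measurability of the identity from
    \<open>N\<close> into \<open>leb n\<close> then says that every Borel set belongs to
    \<G>.\<close>
  define N where "N = measure_of ?S \<G> (\<lambda>_. 0)"
  have GS: "\<G> \<subseteq> Pow ?S" using sa by (simp add: sigma_algebra_iff2)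
  have N: "space N = ?S" "sets N = \<G>"
    unfolding N_def using GS sa by (auto simp: sigma_algebra.sigma_sets_eq)
  have half: "{x \<in> ?S. a < x i} \<in> \<G> \<and> {x \<in> ?S. x i < a} \<in> \<G>" if i: "i < n" for a i
  proof -
    have near: "\<exists>m. \<forall>y\<in>dcube n m x. \<bar>y i - x i\<bar> < r" if r: "0 < r" for r :: real and x
    proof -
      obtain m where "(1 / 2 :: real) ^ m < r" using real_arch_pow_inv[OF r, of "1 / 2"] by auto
      then show ?thesis using dcube_dist[OF _ i] by (intro exI[of _ m]) (auto intro: less_trans)
    qed
    have o1: "dopen n {x \<in> ?S. b < x i}" for b
      unfolding dopen_def
    proof (intro conjI ballI)
      fix x assume "x \<in> {x \<in> ?S. b < x i}"
      then obtain m where "\<forall>y\<in>dcube n m x. \<bar>y i - x i\<bar> < x i - b" using near[of "x i - b" x] by auto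
      then show "\<exists>m. dcube n m x \<subseteq> {x \<in> ?S. b < x i}"
        by (intro exI[of _ m]) (auto simp: dcube_def abs_less_iff)
    qed auto
    have o2: "dopen n {x \<in> ?S. x i < b}" for b
      unfolding dopen_def
    proof (intro conjI ballI)
      fix x assume "x \<in> {x \<in> ?S. x i < b}"
      then obtain m where "\<forall>y\<in>dcube n m x. \<bar>y i - x i\<bar> < b - x i" using near[of "b - x i" x] by auto
      then show "\<exists>m. dcube n m x \<subseteq> {x \<in> ?S. x i < b}"
        by (intro exI[of _ m]) (auto simp: dcube_def abs_less_iff)
    qed auto
    have lim: "t \<le> a" if "\<And>j::nat. t < a + 1 / (real j + 1)" for t a :: real
    proof (rule ccontr)
      assume "\<not> t \<le> a"
      then obtain j where "inverse (real (Suc j)) < t - a" using reals_Archimedean[of "t - a"] by auto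
      then show False using that[of j] by (simp add: inverse_eq_divide add.commute)
    qed
    \<comment> \<open>Closed half-spaces are countable intersections of open ones, so
      \<open>dregular_INT\<close> applies to them.\<close>
    have c1: "?S - {x \<in> ?S. a < x i} = (\<Inter>j::nat. {x \<in> ?S. x i < a + 1 / (real j + 1)})"
    proof safe
      fix x and j :: nat assume "\<not> a < x i" then show "x i < a + 1 / (real j + 1)"
        by (smt (verit) divide_pos_pos of_nat_0_le_iff)
    next
      fix x assume *: "x \<in> (\<Inter>j::nat. {x \<in> ?S. x i < a + 1 / (real j + 1)})"
      then show "x \<in> ?S" by auto
      assume "a < x i" moreover have "x i \<le> a" using * by (intro lim) auto
      ultimately show False by simp
    qed
    have c2: "?S - {x \<in> ?S. x i < a} = (\<Inter>j::nat. {x \<in> ?S. a - 1 / (real j + 1) < x i})"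
    proof safe
      fix x and j :: nat assume "\<not> x i < a" then show "a - 1 / (real j + 1) < x i"
        by (smt (verit) divide_pos_pos of_nat_0_le_iff)
    next
      fix x assume *: "x \<in> (\<Inter>j::nat. {x \<in> ?S. a - 1 / (real j + 1) < x i})"
      then show "x \<in> ?S" by auto
      have "- x i \<le> - a" using * by (intro lim) (auto simp: algebra_simps)
      moreover assume "x i < a"
      ultimately show False by simp
    qed
    show ?thesis
      unfolding \<G>_def mem_Collect_eq c1 c2
      by (intro conjI dregular_INT dregular_dopen o1 o2 sets_dopen_mu)
  qed
  have "(\<lambda>x. x) \<in> measurable N (leb n)"
    unfolding leb_def
  proof (rule measurable_PiM_single')
    fix i assume "i \<in> {..<n}"
    then show "(\<lambda>x. x i) \<in> measurable N lborel"
      using half by (auto simp: borel_measurable_iff_less N)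
  qed (auto simp: N space_leb PiE_def)
  then have "E \<in> sets N"
    using assms measurable_sets[of "\<lambda>x. x" N "leb n" E] sets.sets_into_space[OF assms]
    by (simp add: N Int_absorb2)
  then show ?thesis by (simp add: N \<G>_def)
qed

end

section \<open>Hausdorff measure of flat sets\<close>

lemma euclid_dist_eq_L2_set: "euclid_dist n x y = L2_set (\<lambda>i. x i - y i) {..<n}"
  by (simp add: euclid_dist_def L2_set_def)

lemma euclid_dist_le:
  assumes "\<And>i. i < n \<Longrightarrow> \<bar>x i - y i\<bar> \<le> r" "0 \<le> r"
  shows "euclid_dist n x y \<le> sqrt (real n) * r"
proof -
  have "(\<Sum>i<n. (x i - y i)\<^sup>2) \<le> (\<Sum>i<n. r\<^sup>2)"
    using assms by (intro sum_mono) (metis abs_ge_zero lessThan_iff power2_abs power_mono)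
  then have "sqrt (\<Sum>i<n. (x i - y i)\<^sup>2) \<le> sqrt (real n * r\<^sup>2)" by simp
  then show ?thesis using assms by (simp add: euclid_dist_def real_sqrt_mult)
qed

lemma abs_diff_le_euclid_dist: "i < n \<Longrightarrow> \<bar>x i - y i\<bar> \<le> euclid_dist n x y"
  unfolding euclid_dist_def
  by (rule real_le_rsqrt) (use member_le_sum[of i "{..<n}" "\<lambda>i. (x i - y i)\<^sup>2"] in simp)

lemma euclid_dist_affine:
  assumes "0 < c"
  shows "euclid_dist n (\<lambda>i\<in>{..<n}. v i + c * x i) (\<lambda>i\<in>{..<n}. v i + c * y i) = c * euclid_dist n x y"
proof -
  have "(\<Sum>i<n. ((\<lambda>i\<in>{..<n}. v i + c * x i) i - (\<lambda>i\<in>{..<n}. v i + c * y i) i)\<^sup>2) = c\<^sup>2 * (\<Sum>i<n. (x i - y i)\<^sup>2)"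
    by (simp add: sum_distrib_left power_mult_distrib[symmetric] right_diff_distrib)
  then show ?thesis using assms by (simp add: euclid_dist_def real_sqrt_mult)
qed

definition flat_haus :: "nat \<Rightarrow> (nat \<Rightarrow> real) set \<Rightarrow> ennreal" where
  "flat_haus d = hausdorff (euclid_dist d) d"

definition unit_cube :: "nat \<Rightarrow> (nat \<Rightarrow> real) set" where
  "unit_cube d = {x \<in> space (leb d). \<forall>i<d. 0 \<le> x i \<and> x i < 1}"

text \<open>The ratio of \<open>hausdorff\<close> to Lebesgue measure in dimension \<open>d\<close>.
  It is an unspecified factor in all that follows and cancels when the surface measure is
  normalized.\<close>

definition haus_const :: "nat \<Rightarrow> ennreal" where
  "haus_const d = flat_haus d (unit_cube d)"

lemma unit_cube_eq_dcube: "unit_cube d = dcube d 0 (\<lambda>_. 0)"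
proof -
  have "(0 \<le> t \<and> t < 1) \<longleftrightarrow> \<lfloor>t\<rfloor> = 0" for t :: real by linarith
  then show ?thesis by (simp add: unit_cube_def dcube_def)
qed

lemma emeasure_dcube: "emeasure (leb d) (dcube d m x) = ennreal (((1 / 2) ^ m) ^ d)"
proof -
  have *: "\<lfloor>2 ^ m * t\<rfloor> = z \<longleftrightarrow> t \<in> {real_of_int z / 2 ^ m ..< (real_of_int z + 1) / 2 ^ m}" for t :: real and z
    by (auto simp: field_simps floor_eq_iff)
  have "dcube d m x = Pi\<^sub>E {..<d} (\<lambda>i. {real_of_int \<lfloor>2 ^ m * x i\<rfloor> / 2 ^ m ..< (real_of_int \<lfloor>2 ^ m * x i\<rfloor> + 1) / 2 ^ m})"
    unfolding dcube_def * by (auto simp: space_leb PiE_def)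
  then have "emeasure (leb d) (dcube d m x) =
      (\<Prod>i<d. emeasure lborel {real_of_int \<lfloor>2 ^ m * x i\<rfloor> / 2 ^ m ..< (real_of_int \<lfloor>2 ^ m * x i\<rfloor> + 1) / 2 ^ m})"
    by (simp add: emeasure_leb_PiE)
  also have "\<dots> = (\<Prod>i<d. ennreal ((1 / 2) ^ m))"
    by (intro prod.cong refl) (simp add: divide_right_mono add_divide_distrib power_one_over)
  finally show ?thesis by (simp add: ennreal_power)
qed

text \<open>The \<open>(2 ^ k) ^ d\<close> dyadic subcubes of level \<open>k\<close> have diameter
  at most \<open>sqrt d / 2 ^ k\<close>, so the sum over this cover is bounded by
  \<open>sqrt d ^ d\<close>, whatever the fineness.\<close>

lemma haus_const_finite: "haus_const d < \<infinity>"
proof -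
  have "hausdorff_pre (euclid_dist d) d \<delta> (unit_cube d) \<le> ennreal (sqrt (real d) ^ d)" if "0 < \<delta>" for \<delta>
  proof -
    \<comment> \<open>The \<open>+ 1\<close> keeps the denominator positive in dimension 0.\<close>
    define \<eta> where "\<eta> = \<delta> / (sqrt (real d) + 1)"
    have "0 < \<eta>" using that unfolding \<eta>_def
      by (intro divide_pos_pos) (auto intro: add_nonneg_pos)
    then obtain k where k: "(1 / 2 :: real) ^ k < \<eta>" using real_arch_pow_inv[of \<eta> "1 / 2"] by auto
    let ?s = "sqrt (real d) * (1 / 2) ^ k"
    have "?s \<le> (sqrt (real d) + 1) * \<eta>" using k by (intro mult_mono) auto
    also have "(sqrt (real d) + 1) * \<eta> = \<delta>"
      unfolding \<eta>_def using add_nonneg_pos[of "sqrt (real d)" 1] by (simp add: field_simps)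
    finally have s: "?s \<le> \<delta>" .
    define I where "I = Pi\<^sub>E {..<d} (\<lambda>_. {..<2 ^ k :: nat})"
    define V where "V v = dcube d k (\<lambda>i. real (v i) / 2 ^ k)" for v :: "nat \<Rightarrow> nat"
    have fin: "finite I" unfolding I_def by (intro finite_PiE) auto
    have card: "card I = (2 ^ k) ^ d" by (simp add: I_def card_PiE)
    obtain h where h: "bij_betw h {0..<card I} I" using ex_bij_betw_nat_finite[OF fin] by auto
    define U where "U j = (if j < card I then V (h j) else {})" for j
    have dV: "ediam (euclid_dist d) (V v) \<le> ennreal ?s" for v
      unfolding ediam_def
    proof (intro SUP_least ennreal_leI)
      fix x y assume "x \<in> V v" "y \<in> V v"
      then have "y \<in> dcube d k x" unfolding V_def using dcube_eq by blast
      then show "euclid_dist d x y \<le> ?s"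
        using dcube_dist[of y d k x] by (intro euclid_dist_le) (auto simp: abs_minus_commute less_imp_le)
    qed
    have cov: "unit_cube d \<subseteq> (\<Union>j. U j)"
    proof
      fix x assume x: "x \<in> unit_cube d"
      define v where "v = (\<lambda>i\<in>{..<d}. nat \<lfloor>2 ^ k * x i\<rfloor>)"
      have lt: "nat \<lfloor>2 ^ k * x i\<rfloor> < 2 ^ k" "real (nat \<lfloor>2 ^ k * x i\<rfloor>) = real_of_int \<lfloor>2 ^ k * x i\<rfloor>" if "i < d" for i
      proof -
        have "0 \<le> 2 ^ k * x i" "2 ^ k * x i < 2 ^ k" using x that by (auto simp: unit_cube_def)
        then have "0 \<le> \<lfloor>2 ^ k * x i\<rfloor>" "\<lfloor>2 ^ k * x i\<rfloor> < 2 ^ k" by (auto simp: floor_less_iff)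
        then show "nat \<lfloor>2 ^ k * x i\<rfloor> < 2 ^ k" "real (nat \<lfloor>2 ^ k * x i\<rfloor>) = real_of_int \<lfloor>2 ^ k * x i\<rfloor>"
          by (auto simp: nat_less_iff)
      qed
      have "v \<in> I" unfolding I_def v_def using lt by auto
      moreover have "x \<in> V v"
        using x lt by (auto simp: V_def v_def dcube_def unit_cube_def)
      moreover obtain j where "j < card I" "v = h j"
        using h \<open>v \<in> I\<close> by (metis atLeastLessThan_iff bij_betw_imp_surj_on imageE)
      ultimately show "x \<in> (\<Union>j. U j)" by (auto simp: U_def)
    qed
    have dU: "ediam (euclid_dist d) (U j) \<le> ennreal \<delta>" for j
      using order_trans[OF dV ennreal_leI[OF s]] by (auto simp: U_def ediam_def bot_ennreal)
    have "hausdorff_pre (euclid_dist d) d \<delta> (unit_cube d) \<le> (\<Sum>j. if U j = {} then 0 else ediam (euclid_dist d) (U j) ^ d)"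
      unfolding hausdorff_pre_def by (rule INF_lower) (use cov dU in auto)
    also have "\<dots> = (\<Sum>j<card I. if U j = {} then 0 else ediam (euclid_dist d) (U j) ^ d)"
      by (rule suminf_finite) (auto simp: U_def)
    also have "\<dots> \<le> (\<Sum>j<card I. ennreal (?s ^ d))"
    proof (rule sum_mono)
      fix j assume "j \<in> {..<card I}"
      have "ediam (euclid_dist d) (U j) ^ d \<le> ennreal ?s ^ d"
        using dV \<open>j \<in> _\<close> by (intro power_mono) (auto simp: U_def)
      then show "(if U j = {} then 0 else ediam (euclid_dist d) (U j) ^ d) \<le> ennreal (?s ^ d)"
        by (simp add: ennreal_power)
    qed
    also have "\<dots> = ennreal (real (card I) * ?s ^ d)"
      by (simp add: ennreal_of_nat_eq_real_of_nat ennreal_mult)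
    also have "real (card I) * ?s ^ d = sqrt (real d) ^ d"
    proof -
      have "real (card I) * ?s ^ d = (2 ^ k * ?s) ^ d"
        by (simp only: card power_mult_distrib of_nat_power of_nat_numeral)
      also have "2 ^ k * ?s = sqrt (real d)" by (simp add: power_one_over)
      finally show ?thesis .
    qed
    finally show ?thesis .
  qed
  then have "haus_const d \<le> ennreal (sqrt (real d) ^ d)"
    unfolding haus_const_def flat_haus_def hausdorff_def by (auto intro: SUP_least)
  also have "\<dots> < \<infinity>" by simp
  finally show ?thesis .
qed

lemma flat_haus_affine_le:
  assumes "0 < c"
  shows "flat_haus d ((\<lambda>x. \<lambda>i\<in>{..<d}. v i + c * x i) ` E) \<le> ennreal (c ^ d) * flat_haus d E"
  unfolding flat_haus_def using assms by (intro hausdorff_image_le) (auto simp: euclid_dist_affine)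

lemma flat_haus_dcube_le: "flat_haus d (dcube d m x) \<le> haus_const d * emeasure (leb d) (dcube d m x)"
proof -
  let ?f = "\<lambda>y. \<lambda>i\<in>{..<d}. real_of_int \<lfloor>2 ^ m * x i\<rfloor> / 2 ^ m + (1 / 2) ^ m * y i"
  have "dcube d m x \<subseteq> ?f ` unit_cube d"
  proof
    fix y assume y: "y \<in> dcube d m x"
    let ?z = "\<lambda>i\<in>{..<d}. 2 ^ m * y i - real_of_int \<lfloor>2 ^ m * x i\<rfloor>"
    have "0 \<le> 2 ^ m * y i - real_of_int \<lfloor>2 ^ m * x i\<rfloor> \<and> 2 ^ m * y i - real_of_int \<lfloor>2 ^ m * x i\<rfloor> < 1" if "i < d" for i
    proof -
      have "\<lfloor>2 ^ m * y i\<rfloor> = \<lfloor>2 ^ m * x i\<rfloor>" using y that by (auto simp: dcube_def)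
      then show ?thesis by linarith
    qed
    then have "?z \<in> unit_cube d" by (auto simp: unit_cube_def)
    moreover have "y = ?f ?z"
      using y by (auto simp: dcube_def space_leb extensional_def power_one_over field_simps)
    ultimately show "y \<in> ?f ` unit_cube d" by blast
  qed
  then have "flat_haus d (dcube d m x) \<le> flat_haus d (?f ` unit_cube d)"
    unfolding flat_haus_def by (rule hausdorff_mono)
  also have "\<dots> \<le> ennreal (((1 / 2) ^ m) ^ d) * flat_haus d (unit_cube d)"
    by (rule flat_haus_affine_le) simp
  finally show ?thesis by (simp add: emeasure_dcube haus_const_def mult.commute)
qed

lemma flat_haus_dopen_le:
  assumes "dopen d U" shows "flat_haus d U \<le> haus_const d * emeasure (leb d) U"
proof -
  obtain \<C> where C: "countable \<C>" "disjoint \<C>" "\<forall>Q\<in>\<C>. \<exists>m x. Q = dcube d m x" "U = \<Union>\<C>"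
    by (rule dopen_decompose[OF assms])
  have s: "Q \<in> sets (leb d)" if "Q \<in> \<C>" for Q using C(3) that sets_dcube by fastforce
  have U: "U = (\<Union>Q\<in>\<C>. Q)" using C by simp
  have "flat_haus d U \<le> (\<integral>\<^sup>+Q. flat_haus d Q \<partial>count_space \<C>)"
    unfolding U flat_haus_def by (rule hausdorff_UN_countable[OF C(1)])
  also have "\<dots> \<le> (\<integral>\<^sup>+Q. haus_const d * emeasure (leb d) Q \<partial>count_space \<C>)"
  proof (intro nn_integral_mono)
    fix Q assume "Q \<in> space (count_space \<C>)"
    then obtain m x where "Q = dcube d m x" using C(3) by auto
    then show "flat_haus d Q \<le> haus_const d * emeasure (leb d) Q" using flat_haus_dcube_le by simp
  qed
  also have "\<dots> = haus_const d * (\<integral>\<^sup>+Q. emeasure (leb d) Q \<partial>count_space \<C>)"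
    by (rule nn_integral_cmult) simp
  also have "(\<integral>\<^sup>+Q. emeasure (leb d) Q \<partial>count_space \<C>) = emeasure (leb d) U"
    unfolding U using C s by (intro emeasure_UN_countable[symmetric]) (auto simp: disjoint_def disjoint_family_on_def)
  finally show ?thesis .
qed

text \<open>Outer regularity reduces the claim to dyadic open sets, which are countable disjoint
  unions of cubes, each a scaled copy of the unit cube. Lebesgue measure is restricted to the unit
  cube because \<open>dregular_all\<close> is about finite measures.\<close>

lemma flat_haus_le:
  assumes E: "E \<in> sets (leb d)" "E \<subseteq> unit_cube d"
  shows "flat_haus d E \<le> haus_const d * emeasure (leb d) E"
proof (rule ennreal_le_epsilon)
  fix e :: real assume e: "0 < e"
  let ?Q = "unit_cube d"
  obtain h where h: "haus_const d = ennreal h" "0 \<le> h"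
    using haus_const_finite[of d] by (cases "haus_const d") auto
  have Q[measurable]: "?Q \<in> sets (leb d)" by (simp add: unit_cube_eq_dcube)
  have Q1: "emeasure (leb d) ?Q = 1" by (simp add: unit_cube_eq_dcube emeasure_dcube)
  define \<mu> where "\<mu> = density (leb d) (indicator ?Q)"
  have mu: "emeasure \<mu> A = emeasure (leb d) (A \<inter> ?Q)" if "A \<in> sets (leb d)" for A
  proof -
    have "emeasure \<mu> A = (\<integral>\<^sup>+x. indicator ?Q x * indicator A x \<partial>leb d)"
      unfolding \<mu>_def using that by (intro emeasure_density) auto
    also have "\<dots> = (\<integral>\<^sup>+x. indicator (A \<inter> ?Q) x \<partial>leb d)"
      by (intro nn_integral_cong) (auto simp: indicator_def)
    finally show ?thesis using that by simp
  qed
  have fin: "finite_measure \<mu>"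
    by standard (use mu[of "space (leb d)"] Q1 in \<open>auto simp: \<mu>_def Int_absorb1 sets.sets_into_space[OF Q]\<close>)
  have smu: "sets \<mu> = sets (leb d)" by (simp add: \<mu>_def)
  define \<eta> where "\<eta> = e / (h + 1)"
  have \<eta>: "0 < \<eta>" "h * \<eta> \<le> e" using e h by (auto simp: \<eta>_def field_simps)
  obtain U where U: "dopen d U" "E \<subseteq> U" "measure \<mu> (U - E) < \<eta>"
    using dregular_all[OF fin smu E(1)] \<eta> unfolding dregular_def by blast
  have Us: "U \<in> sets (leb d)" by (rule sets_dopen[OF U(1)])
  have "emeasure (leb d) ((U - E) \<inter> ?Q) = emeasure \<mu> (U - E)" using E Us by (subst mu) auto
  also have "\<dots> \<le> ennreal \<eta>"
    using U(3) finite_measure.emeasure_eq_measure[OF fin, of "U - E"] by (simp add: ennreal_leI less_imp_le)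
  finally have d: "emeasure (leb d) ((U - E) \<inter> ?Q) \<le> ennreal \<eta>" .
  have "flat_haus d E \<le> flat_haus d (U \<inter> ?Q)"
    unfolding flat_haus_def using U E by (intro hausdorff_mono) auto
  also have "\<dots> \<le> haus_const d * emeasure (leb d) (U \<inter> ?Q)"
    using U by (intro flat_haus_dopen_le dopen_Int) (auto simp: unit_cube_eq_dcube dopen_dcube)
  also have "U \<inter> ?Q = E \<union> ((U - E) \<inter> ?Q)" using U E by auto
  also have "emeasure (leb d) \<dots> \<le> emeasure (leb d) E + emeasure (leb d) ((U - E) \<inter> ?Q)"
    using E Us by (intro emeasure_subadditive) auto
  also have "\<dots> \<le> emeasure (leb d) E + ennreal \<eta>" using d by (intro add_mono) auto
  also have "haus_const d * (emeasure (leb d) E + ennreal \<eta>) = haus_const d * emeasure (leb d) E + ennreal (h * \<eta>)"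
    using h \<eta> by (simp add: distrib_left ennreal_mult)
  also have "\<dots> \<le> haus_const d * emeasure (leb d) E + ennreal e"
    using \<eta> by (intro add_mono ennreal_leI) auto
  finally show "flat_haus d E \<le> haus_const d * emeasure (leb d) E + ennreal e"
    by (simp add: mult_left_mono)
qed

text \<open>The lower bound comes from the upper bound for the complement in the cube: by
  subadditivity a strict inequality for \<open>E\<close> would make the measure of the whole cube
  smaller than \<open>haus_const d\<close>.\<close>

lemma flat_haus_eq:
  assumes E: "E \<in> sets (leb d)" "E \<subseteq> unit_cube d"
  shows "flat_haus d E = haus_const d * emeasure (leb d) E"
proof (rule antisym[OF flat_haus_le[OF E]])
  let ?Q = "unit_cube d"
  have Q[measurable]: "?Q \<in> sets (leb d)" by (simp add: unit_cube_eq_dcube)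
  have Q1: "emeasure (leb d) ?Q = 1" by (simp add: unit_cube_eq_dcube emeasure_dcube)
  let ?h = "haus_const d"
  have fin: "emeasure (leb d) (?Q - E) \<noteq> \<infinity>" "emeasure (leb d) (?Q - E) \<le> 1"
    using emeasure_mono[of "?Q - E" ?Q "leb d"] Q1 by (auto simp: top_unique)
  have "emeasure (leb d) E + emeasure (leb d) (?Q - E) = emeasure (leb d) (E \<union> (?Q - E))"
    using E by (intro plus_emeasure) auto
  also have "E \<union> (?Q - E) = ?Q" using E by auto
  finally have "?h * emeasure (leb d) E + ?h * emeasure (leb d) (?Q - E) = ?h"
    by (simp add: distrib_left[symmetric] Q1)
  also have "\<dots> = flat_haus d ?Q" by (simp add: haus_const_def)
  also have "\<dots> \<le> flat_haus d E + flat_haus d (?Q - E)"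
    unfolding flat_haus_def by (rule order_trans[OF hausdorff_mono hausdorff_Un]) auto
  also have "\<dots> \<le> flat_haus d E + ?h * emeasure (leb d) (?Q - E)"
    using E by (intro add_mono flat_haus_le) auto
  finally show "?h * emeasure (leb d) E \<le> flat_haus d E"
    using haus_const_finite[of d] fin
    by (auto simp: add.commute[of _ "?h * emeasure (leb d) (?Q - E)"] ennreal_add_left_cancel_le ennreal_mult_eq_top_iff)
qed

text \<open>Extends \<open>flat_haus_eq\<close> to sets that fit into a translated unit cube; the
  images of the charts are chosen that small.\<close>

lemma flat_haus_translate:
  assumes E: "E \<in> sets (leb d)" and a: "\<And>x i. x \<in> E \<Longrightarrow> i < d \<Longrightarrow> a i \<le> x i \<and> x i < a i + 1"
  shows "flat_haus d E = haus_const d * emeasure (leb d) E"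
proof -
  let ?f = "\<lambda>x. \<lambda>i\<in>{..<d}. a i + 1 * x i" and ?g = "\<lambda>x. \<lambda>i\<in>{..<d}. - a i + 1 * x i"
  define F where "F = ?f -` E \<inter> space (leb d)"
  have Es: "E \<subseteq> space (leb d)" using sets.sets_into_space[OF E] .
  have fg: "?f (?g x) = x" "?g (?f x) = x" if "x \<in> space (leb d)" for x
    using that by (auto simp: space_leb extensional_def)
  have fF: "?f ` F = E"
  proof (intro subset_antisym subsetI)
    fix x assume x: "x \<in> E"
    then have "?g x \<in> F" unfolding F_def using fg(1)[of x] Es by (auto simp only: vimage_eq Int_iff restrict_in_space_leb)
    moreover have "x \<in> space (leb d)" using x Es by auto
    ultimately show "x \<in> ?f ` F" by (intro image_eqI[of x ?f "?g x", OF fg(1)[symmetric]])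
  qed (auto simp: F_def)
  have gE: "?g ` E = F"
    unfolding fF[symmetric] image_image by (rule trans[OF image_cong[OF refl fg(2)]]) (auto simp: F_def)
  have [measurable]: "F \<in> sets (leb d)" unfolding F_def by (rule measurable_sets[OF _ E]) measurable
  have "F \<subseteq> unit_cube d"
    unfolding gE[symmetric] using a by (force simp: unit_cube_def)
  then have "flat_haus d F = haus_const d * emeasure (leb d) F" by (intro flat_haus_eq) auto
  moreover have "flat_haus d F = flat_haus d E"
    using flat_haus_affine_le[of 1 d a F, unfolded fF] flat_haus_affine_le[of 1 d "\<lambda>i. - a i" E, unfolded gE]
    by (intro antisym) simp_all
  moreover have "emeasure (leb d) F = emeasure (leb d) E"
  proof -
    have "emeasure (leb d) E = (\<integral>\<^sup>+x. indicator E (?f x) \<partial>leb d)"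
      using E nn_integral_leb_affine[of "indicator E" d 1 a] by simp
    also have "\<dots> = (\<integral>\<^sup>+x. indicator F x \<partial>leb d)"
      by (intro nn_integral_cong) (simp add: F_def indicator_def)
    finally show ?thesis by simp
  qed
  ultimately show ?thesis by simp
qed

section \<open>Charts of the sphere by central projection\<close>

text \<open>The reflection vector is the difference between \<open>e\<close> and the last basis
  vector. The reflection exchanges these two, so the last coordinate of the image is the component
  along \<open>e\<close>.\<close>

lemma reflect_to_axis:
  assumes e: "(\<Sum>i<Suc d. (e i)\<^sup>2) = 1"
  obtains u where "\<And>x. reflect (Suc d) u x d = (\<Sum>i<Suc d. e i * x i)"
proof -
  define u where "u i = e i - (if i = d then 1 else 0)" for i
  have ux: "(\<Sum>j<Suc d. u j * y j) = (\<Sum>i<Suc d. e i * y i) - y d" for y :: "nat \<Rightarrow> real"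
    by (simp add: u_def left_diff_distrib sum_subtractf if_distrib if_distribR cong: if_cong)
  have "(\<Sum>j<Suc d. (u j)\<^sup>2) = (\<Sum>j<Suc d. u j * u j)" by (simp only: power2_eq_square)
  also have "\<dots> = (\<Sum>i<Suc d. e i * u i) - u d" by (rule ux)
  also have "(\<Sum>i<Suc d. e i * u i) = (\<Sum>i<Suc d. u i * e i)" by (simp add: mult.commute)
  also have "\<dots> = (\<Sum>i<Suc d. (e i)\<^sup>2) - e d" unfolding ux by (simp only: power2_eq_square)
  finally have uu: "(\<Sum>j<Suc d. (u j)\<^sup>2) = 2 - 2 * e d" using e by (simp add: u_def)
  have "reflect (Suc d) u x d = (\<Sum>i<Suc d. e i * x i)" for x
  proof (cases "e d = 1")
    \<comment> \<open>Here \<open>e\<close> is the axis itself, \<open>u\<close> vanishes on all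
      indices, and the reflection is the identity.\<close>
    case True
    have "(\<Sum>i<d. (e i)\<^sup>2) = 0" using e True by simp
    then have "e i = 0" if "i < d" for i using that by (simp add: sum_nonneg_eq_0_iff)
    then show ?thesis using True uu by (simp add: reflect_apply)
  next
    case False
    have "reflect (Suc d) u x d = x d - 2 * ((\<Sum>i<Suc d. e i * x i) - x d) / (2 - 2 * e d) * u d"
      by (subst reflect_apply) (simp_all only: ux uu lessI)
    also have "u d = - (2 - 2 * e d) / 2" by (simp add: u_def)
    also have "x d - 2 * ((\<Sum>i<Suc d. e i * x i) - x d) / (2 - 2 * e d) * (- (2 - 2 * e d) / 2) = (\<Sum>i<Suc d. e i * x i)"
      if "2 - 2 * e d \<noteq> 0"
    proof -
      have "a - 2 * (b - a) / c * (- c / 2) = b" if "c \<noteq> 0" for a b c :: real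
      proof -
        have "2 * (b - a) / c * (- c / 2) = a - b" using that by (simp add: field_simps)
        then show ?thesis by simp
      qed
      then show ?thesis using that by blast
    qed
    finally show ?thesis using False by simp
  qed
  then show thesis by (rule that)
qed

section \<open>Radial projection onto the sphere and volumes of cones\<close>

lemma scale_vec_apply: "i < n \<Longrightarrow> scale_vec n c x i = c * x i"
  by (simp add: scale_vec_def)

lemma scale_vec_in_space [simp]: "scale_vec n c x \<in> space (leb n)"
  by (simp add: scale_vec_def)

lemma scale_vec_scale_vec: "scale_vec n a (scale_vec n b x) = scale_vec n (a * b) x"
  by (auto simp: scale_vec_def)

lemma scale_vec_1: "x \<in> space (leb n) \<Longrightarrow> scale_vec n 1 x = x"
  by (auto simp: scale_vec_def space_leb extensional_def)

lemma reflect_scale_vec: "reflect n u (scale_vec n c x) = scale_vec n c (reflect n u x)"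
proof
  fix i
  have *: "scale_vec n c x = (\<lambda>i\<in>{..<n}. c * x i + 0 * x i)" by (simp add: scale_vec_def)
  have "reflect n u (scale_vec n c x) i = c * reflect n u x i" if "i < n"
    unfolding * using reflect_lincomb[OF that, of u c x 0 x] by simp
  then show "reflect n u (scale_vec n c x) i = scale_vec n c (reflect n u x) i"
    using reflect_in_space[of n u "scale_vec n c x"]
    by (cases "i < n") (auto simp: scale_vec_def space_leb extensional_def)
qed

lemma euclid_dist_reflect:
  assumes "x \<in> space (leb n)" "y \<in> space (leb n)"
  shows "euclid_dist n (reflect n u x) (reflect n u y) = euclid_dist n x y"
  using sum_square_reflect_diff[of "reflect n u y" n x u] assms
  by (simp add: euclid_dist_def reflect_reflect)

lemma euclid_dist_scale: "euclid_dist n (scale_vec n c x) (scale_vec n c y) = \<bar>c\<bar> * euclid_dist n x y"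
proof -
  have "(\<Sum>i<n. (scale_vec n c x i - scale_vec n c y i)\<^sup>2) = c\<^sup>2 * (\<Sum>i<n. (x i - y i)\<^sup>2)"
    by (simp add: scale_vec_apply sum_distrib_left power_mult_distrib[symmetric] right_diff_distrib)
  then show ?thesis by (simp add: euclid_dist_def real_sqrt_mult)
qed

lemma lp_norm_nonneg [simp]: "0 \<le> lp_norm p n x"
  by (simp add: lp_norm_def)

lemma measurable_lp_norm [measurable]: "lp_norm p n \<in> borel_measurable (leb n)"
  unfolding lp_norm_def by measurable

lemma lp_norm_scale:
  assumes "0 \<le> c" "0 < p" shows "lp_norm p n (scale_vec n c x) = c * lp_norm p n x"
proof -
  have "(\<Sum>i<n. \<bar>scale_vec n c x i\<bar> powr p) = c powr p * (\<Sum>i<n. \<bar>x i\<bar> powr p)"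
    using assms by (simp add: scale_vec_apply abs_mult powr_mult sum_distrib_left)
  then show ?thesis
    using assms by (simp add: lp_norm_def powr_mult sum_nonneg powr_powr)
qed

definition sph :: "real \<Rightarrow> nat \<Rightarrow> (nat \<Rightarrow> real) \<Rightarrow> (nat \<Rightarrow> real)" where
  "sph p n x = scale_vec n (1 / lp_norm p n x) x"

lemma measurable_sph [measurable]: "sph p n \<in> measurable (leb n) (leb n)"
  unfolding sph_def by measurable

lemma sph_in_space [simp]: "sph p n x \<in> space (leb n)" by (simp add: sph_def)

lemma sph_scale:
  assumes "0 < c" "0 < p" shows "sph p n (scale_vec n c x) = sph p n x"
  using assms by (simp add: sph_def lp_norm_scale scale_vec_scale_vec)

lemma sph_on_sphere: "x \<in> lp_sphere p n \<Longrightarrow> sph p n x = x"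
  by (simp add: lp_sphere_def sph_def scale_vec_1)

lemma lp_norm_sph: "0 < p \<Longrightarrow> 0 < lp_norm p n x \<Longrightarrow> lp_norm p n (sph p n x) = 1"
  by (simp add: sph_def lp_norm_scale)

lemma sph_in_sphere: "0 < p \<Longrightarrow> 0 < lp_norm p n x \<Longrightarrow> sph p n x \<in> lp_sphere p n"
  by (simp add: lp_sphere_def lp_norm_sph)

lemma scale_vec_sph: "x \<in> space (leb n) \<Longrightarrow> 0 < lp_norm p n x \<Longrightarrow> scale_vec n (lp_norm p n x) (sph p n x) = x"
  by (simp add: sph_def scale_vec_scale_vec scale_vec_1)

lemma sets_lp_sphere [measurable]: "lp_sphere p n \<in> sets (leb n)"
  unfolding lp_sphere_def by measurable

text \<open>The volume of the cone over \<open>A\<close> up to norm 1. The origin is left out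
  because the radial projection has no meaning there.\<close>

definition cone_vol :: "real \<Rightarrow> nat \<Rightarrow> (nat \<Rightarrow> real) set \<Rightarrow> ennreal" where
  "cone_vol p n A = emeasure (leb n) {x \<in> space (leb n). 0 < lp_norm p n x \<and> lp_norm p n x \<le> 1 \<and> sph p n x \<in> A}"

lemma emeasure_cone_scale:
  assumes [measurable]: "A \<in> sets (leb n)" and r: "0 < r" and p: "0 < p"
  shows "emeasure (leb n) {x \<in> space (leb n). 0 < lp_norm p n x \<and> lp_norm p n x \<le> r \<and> sph p n x \<in> A}
    = ennreal (r ^ n) * cone_vol p n A"
proof -
  let ?B = "\<lambda>r. {x \<in> space (leb n). 0 < lp_norm p n x \<and> lp_norm p n x \<le> r \<and> sph p n x \<in> A}"
  have [measurable]: "?B r \<in> sets (leb n)" for r by measurable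
  have "emeasure (leb n) (?B r) = (\<integral>\<^sup>+x. indicator (?B r) x \<partial>leb n)" by simp
  also have "\<dots> = ennreal (r ^ n) * (\<integral>\<^sup>+x. indicator (?B r) (scale_vec n r x) \<partial>leb n)"
    by (rule nn_integral_leb_scale[OF _ r]) measurable
  also have "(\<integral>\<^sup>+x. indicator (?B r) (scale_vec n r x) \<partial>leb n) = (\<integral>\<^sup>+x. indicator (?B 1) x \<partial>leb n)"
    using r p by (intro nn_integral_cong) (auto simp: indicator_def lp_norm_scale sph_scale zero_less_mult_iff mult_le_cancel_left1)
  finally show ?thesis by (simp add: cone_vol_def)
qed

section \<open>Slicing along the last coordinate\<close>

lemma nn_integral_leb_Suc:
  assumes [measurable]: "f \<in> borel_measurable (leb (Suc d))"
  shows "(\<integral>\<^sup>+x. f x \<partial>leb (Suc d)) = (\<integral>\<^sup>+t. (\<integral>\<^sup>+z. f (z(d := t)) \<partial>leb d) \<partial>lborel)"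
proof -
  have "{..<Suc d} = insert d {..<d}" by auto
  then show ?thesis
    using lborel_product.product_nn_integral_insert_rev[of "{..<d}" d f] assms by (simp add: leb_def)
qed

lemma measurable_fun_upd_leb [measurable]: "(\<lambda>z. z(d := t)) \<in> measurable (leb d) (leb (Suc d))"
proof -
  have "(\<lambda>z. \<lambda>i\<in>{..<Suc d}. if i = d then t else z i) \<in> measurable (leb d) (leb (Suc d))"
  proof (rule measurable_leb_restrict)
    fix i assume "i \<in> {..<Suc d}"
    then show "(\<lambda>z. if i = d then t else z i) \<in> borel_measurable (leb d)"
      by (cases "i = d") (auto intro!: measurable_leb_component[OF measurable_ident, unfolded id_def])
  qed
  moreover have "z(d := t) = (\<lambda>i\<in>{..<Suc d}. if i = d then t else z i)" if "z \<in> space (leb d)" for z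
    using that by (auto simp: space_leb extensional_def)
  ultimately show ?thesis by (simp cong: measurable_cong)
qed

lemma fun_upd_in_space: "z \<in> space (leb d) \<Longrightarrow> z(d := t) \<in> space (leb (Suc d))"
  by (auto simp: space_leb extensional_def)

lemma nn_integral_power_unit: "(\<integral>\<^sup>+t. ennreal (t ^ d) * indicator {0<..1} t \<partial>lborel) = ennreal (1 / real (Suc d))"
proof -
  have "(\<integral>\<^sup>+t. ennreal (t ^ d) * indicator {0<..1} t \<partial>lborel) = (\<integral>\<^sup>+t. ennreal (t ^ d) * indicator {0..1::real} t \<partial>lborel)"
    by (intro nn_integral_cong_AE eventually_mono[OF AE_lborel_singleton[of 0]]) (simp add: indicator_def)
  also have "\<dots> = ennreal (1 ^ Suc d / real (Suc d) - 0 ^ Suc d / real (Suc d))"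
  proof (rule nn_integral_FTC_Icc)
    show "((\<lambda>t. t ^ Suc d / real (Suc d)) has_real_derivative t ^ d) (at t)" for t
      using DERIV_cdivide[OF DERIV_pow[of "Suc d" t], of "real (Suc d)"] by simp
  qed auto
  finally show ?thesis by simp
qed

text \<open>In the application \<open>w\<close> is the gradient norm, \<open>g = 1\<close> is the
  tangent plane rescaled to distance 1 from the origin, and \<open>\<rho>\<close> bounds all
  deviations. Central projection onto this plane scales distances by about \<open>w\<close>, and the
  cone over the projected set, cut off at height 1, is about the \<open>w\<close>-dilate of the cone
  over \<open>A\<close>. Its volume is that of the projected set divided by \<open>n\<close>. So the
  Hausdorff measure of \<open>A\<close> is about
  \<open>haus_const d * n * w ^ n * cone_vol p n A\<close> divided by \<open>w ^ d\<close>, and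
  \<open>n = d + 1\<close> leaves one factor \<open>w\<close>.\<close>

theorem hausdorff_chart_estimate:
  fixes p w \<rho> :: real and d :: nat and A :: "(nat \<Rightarrow> real) set"
  defines "n \<equiv> Suc d"
  assumes p: "0 < p" and A[measurable]: "A \<in> sets (leb n)" and AS: "A \<subseteq> lp_sphere p n"
    and e: "(\<Sum>i<n. (e i)\<^sup>2) = 1" and w: "0 < w" and \<rho>: "0 < \<rho>"
    and g_def: "\<And>a. g a = (\<Sum>i<n. e i * a i)"
    and g: "\<And>a. a \<in> A \<Longrightarrow> 1 / (w * \<rho>) \<le> g a \<and> g a \<le> \<rho> / w"
    and lip: "\<And>a b. a \<in> A \<Longrightarrow> b \<in> A \<Longrightarrow>
        w / \<rho> * euclid_dist n a b \<le> euclid_dist n (scale_vec n (1 / g a) a) (scale_vec n (1 / g b) b) \<and>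
        euclid_dist n (scale_vec n (1 / g a) a) (scale_vec n (1 / g b) b) \<le> w * \<rho> * euclid_dist n a b"
    and small: "\<And>a b. a \<in> A \<Longrightarrow> b \<in> A \<Longrightarrow> euclid_dist n (scale_vec n (1 / g a) a) (scale_vec n (1 / g b) b) < 1 / 2"
  shows "hausdorff (euclid_dist n) d A \<le> ennreal (\<rho> ^ (d + n)) * (haus_const d * of_nat n * ennreal w * cone_vol p n A)"
    and "haus_const d * of_nat n * ennreal w * cone_vol p n A \<le> ennreal (\<rho> ^ (d + n)) * hausdorff (euclid_dist n) d A"
proof -
  have As: "A \<subseteq> space (leb n)" using sets.sets_into_space[OF A] .
  obtain u where u: "\<And>x. reflect n u x d = g x"
    using reflect_to_axis[of e d] e unfolding g_def n_def by metis
  let ?Q = "reflect n u"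
  have dn: "d < n" and n0: "{..<n} = insert d {..<d}" by (auto simp: n_def)
  have gpos: "0 < g a" if "a \<in> A" for a
    using g[OF that] w \<rho> by (meson divide_pos_pos less_le_trans mult_pos_pos zero_less_one)
  \<comment> \<open>After the reflection, the height \<open>g\<close> is the last coordinate:
    \<open>\<Phi>\<close> parametrizes the hyperplane \<open>g = 1\<close> by \<open>leb d\<close>,
    and \<open>\<psi>\<close> is the central projection in these coordinates.\<close>
  define \<psi> where "\<psi> a = (\<lambda>i\<in>{..<d}. ?Q a i / g a)" for a
  define \<Phi> where "\<Phi> z = ?Q (z(d := 1))" for z
  define E where "E = {z \<in> space (leb d). 0 < lp_norm p n (\<Phi> z) \<and> sph p n (\<Phi> z) \<in> A}"
  have \<Phi>[measurable]: "\<Phi> \<in> measurable (leb d) (leb n)" unfolding \<Phi>_def n_def by measurable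
  have E[measurable]: "E \<in> sets (leb d)" unfolding E_def by measurable
  have \<Phi>\<psi>: "\<Phi> (\<psi> a) = scale_vec n (1 / g a) a" if "a \<in> A" for a
  proof -
    have "(\<psi> a)(d := 1) = scale_vec n (1 / g a) (?Q a)"
      using gpos[OF that] by (auto simp: \<psi>_def scale_vec_def n_def u[unfolded n_def] less_Suc_eq)
    then show ?thesis
      using that As by (auto simp: \<Phi>_def reflect_scale_vec reflect_reflect)
  qed
  have \<psi>E: "\<psi> a \<in> E" if "a \<in> A" for a
  proof -
    have a: "a \<in> lp_sphere p n" using that AS by auto
    have "lp_norm p n (\<Phi> (\<psi> a)) = 1 / g a"
      using a gpos[OF that] p by (simp add: \<Phi>\<psi>[OF that] lp_norm_scale lp_sphere_def)
    moreover have "sph p n (\<Phi> (\<psi> a)) = a"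
      using a gpos[OF that] p by (simp add: \<Phi>\<psi>[OF that] sph_scale sph_on_sphere)
    moreover have "\<psi> a \<in> space (leb d)" by (simp add: \<psi>_def)
    ultimately show ?thesis using that gpos[OF that] by (simp add: E_def)
  qed
  have \<psi>sph: "\<psi> (sph p n (\<Phi> z)) = z" if "z \<in> E" for z
  proof -
    have z: "z \<in> space (leb d)" and N: "0 < lp_norm p n (\<Phi> z)" using that by (auto simp: E_def)
    have Q: "?Q (sph p n (\<Phi> z)) = scale_vec n (1 / lp_norm p n (\<Phi> z)) (z(d := 1))"
      using fun_upd_in_space[OF z, of 1] by (simp add: sph_def reflect_scale_vec) (simp add: \<Phi>_def reflect_reflect n_def)
    have "g (sph p n (\<Phi> z)) = 1 / lp_norm p n (\<Phi> z)"
      using Q dn by (simp add: u[symmetric] scale_vec_apply)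
    then show ?thesis
      using z N unfolding \<psi>_def Q by (auto simp: scale_vec_def n_def space_leb extensional_def)
  qed
  have E_eq: "E = \<psi> ` A"
  proof (intro subset_antisym subsetI)
    fix z assume z: "z \<in> E"
    then have "sph p n (\<Phi> z) \<in> A" by (simp add: E_def)
    then show "z \<in> \<psi> ` A" using \<psi>sph[OF z] by (metis image_eqI)
  qed (auto intro: \<psi>E)
  have dist\<psi>: "euclid_dist d (\<psi> a) (\<psi> b) = euclid_dist n (scale_vec n (1 / g a) a) (scale_vec n (1 / g b) b)"
    if "a \<in> A" "b \<in> A" for a b
  proof -
    have "euclid_dist n (scale_vec n (1 / g a) a) (scale_vec n (1 / g b) b)
        = euclid_dist n (?Q (scale_vec n (1 / g a) a)) (?Q (scale_vec n (1 / g b) b))"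
      by (rule euclid_dist_reflect[symmetric]) auto
    also have "\<dots> = euclid_dist d (\<psi> a) (\<psi> b)"
      using gpos[OF that(1)] gpos[OF that(2)]
      by (simp add: euclid_dist_def reflect_scale_vec n0 scale_vec_apply dn u \<psi>_def) (simp add: n_def scale_vec_apply)
    finally show ?thesis ..
  qed
  \<comment> \<open>The premise \<open>small\<close> fits the chart image into a cube of side 1,
    where Hausdorff and Lebesgue measure are proportional.\<close>
  have HE: "flat_haus d E = haus_const d * emeasure (leb d) E"
  proof (cases "A = {}")
    case True then show ?thesis by (simp add: E_eq flat_haus_def hausdorff_empty)
  next
    case False
    then obtain b where b: "b \<in> A" by auto
    show ?thesis
    proof (rule flat_haus_translate[OF E, of "\<lambda>i. \<psi> b i - 1 / 2"])
      fix z i assume "z \<in> E" and i: "i < d"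
      then obtain a where a: "a \<in> A" "z = \<psi> a" by (auto simp: E_eq)
      have "\<bar>\<psi> a i - \<psi> b i\<bar> \<le> euclid_dist d (\<psi> a) (\<psi> b)" by (rule abs_diff_le_euclid_dist[OF i])
      also have "\<dots> < 1 / 2" using small[OF a(1) b] dist\<psi>[OF a(1) b] by simp
      finally have "\<bar>\<psi> a i - \<psi> b i\<bar> < 1 / 2" .
      then show "\<psi> b i - 1 / 2 \<le> z i \<and> z i < \<psi> b i - 1 / 2 + 1" unfolding a(2) by linarith
    qed
  qed
  have up: "flat_haus d E \<le> ennreal ((w * \<rho>) ^ d) * hausdorff (euclid_dist n) d A"
    unfolding E_eq flat_haus_def using w \<rho> lip dist\<psi> by (intro hausdorff_image_le) auto
  have lo: "hausdorff (euclid_dist n) d A \<le> ennreal ((\<rho> / w) ^ d) * flat_haus d E"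
  proof -
    have A_eq: "A = (\<lambda>z. sph p n (\<Phi> z)) ` E"
      using \<psi>E AS p gpos by (force simp: E_def \<Phi>\<psi> sph_scale sph_on_sphere image_iff intro!: bexI[OF _ \<psi>E])
    have "hausdorff (euclid_dist n) d ((\<lambda>z. sph p n (\<Phi> z)) ` E) \<le> ennreal ((\<rho> / w) ^ d) * hausdorff (euclid_dist d) d E"
    proof (rule hausdorff_image_le)
      show "0 < \<rho> / w" using w \<rho> by simp
      fix z z' assume z: "z \<in> E" "z' \<in> E"
      then have zA: "sph p n (\<Phi> z) \<in> A" "sph p n (\<Phi> z') \<in> A" by (auto simp: E_def)
      have "w / \<rho> * euclid_dist n (sph p n (\<Phi> z)) (sph p n (\<Phi> z')) \<le> euclid_dist d z z'"
        using lip[OF zA] dist\<psi>[OF zA] z by (simp add: \<psi>sph)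
      then show "euclid_dist n (sph p n (\<Phi> z)) (sph p n (\<Phi> z')) \<le> \<rho> / w * euclid_dist d z z'"
        using w \<rho> by (simp add: field_simps)
    qed
    then show ?thesis by (simp add: A_eq[symmetric] flat_haus_def)
  qed
  \<comment> \<open>The cone over the flat image \<open>E\<close> up to height 1. Its volume is
    computed by slices and compared with the cone over the curved set \<open>A\<close>.\<close>
  define V where "V = {x \<in> space (leb n). 0 < lp_norm p n x \<and> 0 < g x \<and> g x \<le> 1 \<and> sph p n x \<in> A}"
  have [measurable]: "g \<in> borel_measurable (leb n)" unfolding g_def by measurable
  have V[measurable]: "V \<in> sets (leb n)" unfolding V_def by measurable
  have volV: "of_nat n * emeasure (leb n) V = emeasure (leb d) E"
  proof -
    have V'[measurable]: "V \<in> sets (leb (Suc d))" using V by (simp add: n_def)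
    have m: "(\<lambda>z. indicator V (?Q (z(d := t))) :: ennreal) \<in> borel_measurable (leb d)" for t
      unfolding n_def by measurable
    \<comment> \<open>In reflected coordinates the slice of \<open>V\<close> at height
      \<open>t\<close> is \<open>E\<close> scaled by \<open>t\<close>; this yields the factor
      \<open>1 / n\<close> for the volume of the cone.\<close>
    have inner: "(\<integral>\<^sup>+z. indicator V (?Q (z(d := t))) \<partial>leb d) = ennreal (t ^ d) * indicator {0<..1} t * emeasure (leb d) E" for t :: real
    proof (cases "0 < t \<and> t \<le> 1")
      case True
      have "(\<integral>\<^sup>+z. indicator V (?Q (z(d := t))) \<partial>leb d) = ennreal (t ^ d) * (\<integral>\<^sup>+z. indicator V (?Q ((scale_vec d t z)(d := t))) \<partial>leb d)"
        using True m by (intro nn_integral_leb_scale) auto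
      also have "(\<integral>\<^sup>+z. indicator V (?Q ((scale_vec d t z)(d := t))) \<partial>leb d) = (\<integral>\<^sup>+z. indicator E z \<partial>leb d)"
      proof (intro nn_integral_cong)
        fix z assume z: "z \<in> space (leb d)"
        have "(scale_vec d t z)(d := t) = scale_vec n t (z(d := 1))"
          by (auto simp: scale_vec_def n_def)
        then have "?Q ((scale_vec d t z)(d := t)) = scale_vec n t (\<Phi> z)"
          by (simp add: reflect_scale_vec \<Phi>_def)
        moreover have "g (scale_vec n t (\<Phi> z)) = t"
          using fun_upd_in_space[OF z, of 1] dn
          by (simp add: u[symmetric] reflect_scale_vec scale_vec_apply \<Phi>_def reflect_reflect n_def)
        ultimately show "indicator V (?Q ((scale_vec d t z)(d := t))) = (indicator E z :: ennreal)"
          using True z p by (simp add: indicator_def V_def E_def lp_norm_scale sph_scale zero_less_mult_iff)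
      qed
      finally show ?thesis using True by (simp add: fun_upd_def)
    next
      case False
      have "?Q (z(d := t)) \<notin> V" if "z \<in> space (leb d)" for z
        using False fun_upd_in_space[OF that, of t] dn
        by (auto simp: V_def u[symmetric] reflect_reflect n_def)
      then have "(\<integral>\<^sup>+z. indicator V (?Q (z(d := t))) \<partial>leb d) = (\<integral>\<^sup>+z. 0 \<partial>leb d)"
        by (intro nn_integral_cong) (simp add: indicator_def)
      then show ?thesis using False by (auto simp: indicator_def)
    qed
    have "emeasure (leb n) V = (\<integral>\<^sup>+x. indicator V (?Q x) \<partial>leb n)"
      by (subst nn_integral_leb_reflect) auto
    also have "\<dots> = (\<integral>\<^sup>+t. ennreal (t ^ d) * indicator {0<..1} t * emeasure (leb d) E \<partial>lborel)"
      unfolding n_def by (subst nn_integral_leb_Suc) (auto simp: inner[unfolded n_def] V[unfolded n_def])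
    also have "\<dots> = ennreal (1 / real (Suc d)) * emeasure (leb d) E"
      by (subst nn_integral_multc) (auto simp: nn_integral_power_unit)
    finally have "emeasure (leb n) V = ennreal (1 / real n) * emeasure (leb d) E" by (simp add: n_def)
    moreover have "of_nat n * ennreal (1 / real n) = 1"
    proof -
      have "of_nat n * ennreal (1 / real n) = ennreal (real n * (1 / real n))"
        by (subst ennreal_mult) (auto simp: ennreal_of_nat_eq_real_of_nat)
      also have "real n * (1 / real n) = 1" by (simp add: n_def)
      finally show ?thesis by simp
    qed
    ultimately show ?thesis by (simp add: mult.assoc[symmetric])
  qed
  \<comment> \<open>By linearity of \<open>g\<close>, the condition \<open>g x \<le> 1\<close>
    bounds the norm of \<open>x\<close> by \<open>1 / g (sph p n x)\<close>, a number between
    \<open>w / \<rho>\<close> and \<open>w * \<rho>\<close>. Thus \<open>V\<close> lies between two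
    dilates of the cone over \<open>A\<close>.\<close>
  have gx: "g x = lp_norm p n x * g (sph p n x)" if "x \<in> space (leb n)" "0 < lp_norm p n x" for x
    using that by (subst scale_vec_sph[OF that, symmetric])
      (simp add: g_def scale_vec_apply sum_distrib_left mult_ac)
  have "emeasure (leb n) V \<le> ennreal ((w * \<rho>) ^ n) * cone_vol p n A"
  proof -
    have "V \<subseteq> {x \<in> space (leb n). 0 < lp_norm p n x \<and> lp_norm p n x \<le> w * \<rho> \<and> sph p n x \<in> A}"
    proof safe
      fix x assume "x \<in> V"
      then have x: "x \<in> space (leb n)" "0 < lp_norm p n x" "g x \<le> 1" "sph p n x \<in> A" by (auto simp: V_def)
      have "lp_norm p n x * (1 / (w * \<rho>)) \<le> lp_norm p n x * g (sph p n x)"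
        using g[OF x(4)] by (intro mult_left_mono) auto
      also have "\<dots> \<le> 1" using gx[OF x(1,2)] x(3) by simp
      finally show "lp_norm p n x \<le> w * \<rho>" using w \<rho> by (simp add: field_simps)
    qed (auto simp: V_def)
    then have "emeasure (leb n) V \<le> emeasure (leb n) {x \<in> space (leb n). 0 < lp_norm p n x \<and> lp_norm p n x \<le> w * \<rho> \<and> sph p n x \<in> A}"
      by (rule emeasure_mono) measurable
    then show ?thesis using w \<rho> p by (simp add: emeasure_cone_scale)
  qed
  then have vol_up: "emeasure (leb d) E \<le> of_nat n * (ennreal ((w * \<rho>) ^ n) * cone_vol p n A)"
    unfolding volV[symmetric] by (rule mult_left_mono) simp
  have "ennreal ((w / \<rho>) ^ n) * cone_vol p n A \<le> emeasure (leb n) V"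
  proof -
    have "{x \<in> space (leb n). 0 < lp_norm p n x \<and> lp_norm p n x \<le> w / \<rho> \<and> sph p n x \<in> A} \<subseteq> V"
    proof safe
      fix x assume x: "x \<in> space (leb n)" "0 < lp_norm p n x" "lp_norm p n x \<le> w / \<rho>" "sph p n x \<in> A"
      have "lp_norm p n x * g (sph p n x) \<le> (w / \<rho>) * (\<rho> / w)"
        using g[OF x(4)] gpos[OF x(4)] x w \<rho> by (intro mult_mono) auto
      then have "g x \<le> 1" using gx[OF x(1,2)] w \<rho> by simp
      moreover have "0 < g x" using gx[OF x(1,2)] gpos[OF x(4)] x by simp
      ultimately show "x \<in> V" using x by (simp add: V_def)
    qed
    then have "emeasure (leb n) {x \<in> space (leb n). 0 < lp_norm p n x \<and> lp_norm p n x \<le> w / \<rho> \<and> sph p n x \<in> A} \<le> emeasure (leb n) V"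
      by (rule emeasure_mono) measurable
    then show ?thesis using w \<rho> p by (simp add: emeasure_cone_scale)
  qed
  then have vol_lo: "of_nat n * (ennreal ((w / \<rho>) ^ n) * cone_vol p n A) \<le> emeasure (leb d) E"
    unfolding volV[symmetric] by (rule mult_left_mono) simp
  \<comment> \<open>The comparison of distances contributes \<open>\<rho> ^ d\<close>, that of
    volumes \<open>\<rho> ^ n\<close>.\<close>
  have c1: "(\<rho> / w) ^ d * (w * \<rho>) ^ n = \<rho> ^ (d + n) * w"
    using w by (simp add: n_def power_mult_distrib power_divide power_add)
  have "hausdorff (euclid_dist n) d A \<le> ennreal ((\<rho> / w) ^ d) * (haus_const d * (of_nat n * (ennreal ((w * \<rho>) ^ n) * cone_vol p n A)))"
    by (rule order_trans[OF lo]) (unfold HE, intro mult_left_mono vol_up, auto)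
  also have "\<dots> = ennreal ((\<rho> / w) ^ d) * ennreal ((w * \<rho>) ^ n) * (haus_const d * of_nat n * cone_vol p n A)"
    by (simp only: mult_ac)
  also have "ennreal ((\<rho> / w) ^ d) * ennreal ((w * \<rho>) ^ n) = ennreal (\<rho> ^ (d + n)) * ennreal w"
    using w \<rho> by (simp add: ennreal_mult[symmetric] c1)
  finally show "hausdorff (euclid_dist n) d A \<le> ennreal (\<rho> ^ (d + n)) * (haus_const d * of_nat n * ennreal w * cone_vol p n A)"
    by (simp only: mult_ac)
  have c2: "(w / \<rho>) ^ n * ((\<rho> ^ (d + n)) * (1 / (w * \<rho>)) ^ d) = w"
    using w \<rho> by (simp add: n_def power_mult_distrib power_divide power_add)
  have c3: "ennreal ((1 / (w * \<rho>)) ^ d) * ennreal ((w * \<rho>) ^ d) = 1"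
    using w \<rho> by (simp add: ennreal_mult[symmetric] power_mult_distrib[symmetric])
  have "haus_const d * of_nat n * ennreal w * cone_vol p n A =
      ennreal (\<rho> ^ (d + n)) * ennreal ((1 / (w * \<rho>)) ^ d) * (haus_const d * (of_nat n * (ennreal ((w / \<rho>) ^ n) * cone_vol p n A)))"
  proof -
    have "ennreal w = ennreal ((w / \<rho>) ^ n) * (ennreal (\<rho> ^ (d + n)) * ennreal ((1 / (w * \<rho>)) ^ d))"
      using w \<rho> by (subst c2[symmetric]) (simp add: ennreal_mult[symmetric])
    then show ?thesis by (simp only: mult_ac)
  qed
  also have "\<dots> \<le> ennreal (\<rho> ^ (d + n)) * ennreal ((1 / (w * \<rho>)) ^ d) * (ennreal ((w * \<rho>) ^ d) * hausdorff (euclid_dist n) d A)"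
    by (intro mult_left_mono order_trans[OF mult_left_mono[OF vol_lo] up[unfolded HE]]) auto
  also have "\<dots> = ennreal (\<rho> ^ (d + n)) * (ennreal ((1 / (w * \<rho>)) ^ d) * ennreal ((w * \<rho>) ^ d)) * hausdorff (euclid_dist n) d A"
    by (simp only: mult_ac)
  finally show "haus_const d * of_nat n * ennreal w * cone_vol p n A \<le> ennreal (\<rho> ^ (d + n)) * hausdorff (euclid_dist n) d A"
    by (simp only: c3 mult_1_right)
qed

text \<open>Strict differentiability: both points vary near \<open>t0\<close>, and the error is
  relative to their mutual distance. The Lipschitz bounds for a chart require this, as they concern
  arbitrary pairs of points. It follows from the mean value theorem and continuity of the
  derivative.\<close>

lemma abs_powr_strict_deriv:
  fixes p t0 \<eta> :: real
  assumes p: "1 \<le> p" and t0: "t0 \<noteq> 0" and \<eta>: "0 < \<eta>"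
  shows "\<exists>\<delta>>0. \<forall>s t. \<bar>s - t0\<bar> < \<delta> \<longrightarrow> \<bar>t - t0\<bar> < \<delta> \<longrightarrow>
    \<bar>\<bar>s\<bar> powr p - \<bar>t\<bar> powr p - p * (\<bar>t0\<bar> powr (p - 1) * sgn t0) * (s - t)\<bar> \<le> \<eta> * \<bar>s - t\<bar>"
proof -
  have pos: "\<exists>\<delta>>0. \<forall>s t. \<bar>s - u\<bar> < \<delta> \<longrightarrow> \<bar>t - u\<bar> < \<delta> \<longrightarrow>
    \<bar>\<bar>s\<bar> powr p - \<bar>t\<bar> powr p - p * u powr (p - 1) * (s - t)\<bar> \<le> \<eta> * \<bar>s - t\<bar>" if u: "0 < u" for u
  proof -
    have "isCont (\<lambda>z. p * z powr (p - 1)) u" using u by (intro continuous_intros) auto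
    then obtain r where r: "0 < r" "\<And>z. \<bar>z - u\<bar> < r \<Longrightarrow> \<bar>p * z powr (p - 1) - p * u powr (p - 1)\<bar> < \<eta>"
      using \<eta> unfolding continuous_at_eps_delta dist_real_def by metis
    have main: "\<bar>t powr p - s powr p - p * u powr (p - 1) * (t - s)\<bar> \<le> \<eta> * \<bar>t - s\<bar>"
      if st: "\<bar>s - u\<bar> < min r u" "\<bar>t - u\<bar> < min r u" "s < t" for s t
    proof -
      have "\<exists>z>s. z < t \<and> t powr p - s powr p = (t - s) * (p * z powr (p - 1))"
      proof (rule MVT2[OF st(3)])
        fix x assume "s \<le> x" "x \<le> t"
        then show "((\<lambda>t. t powr p) has_real_derivative p * x powr (p - 1)) (at x)"
          using st by (intro has_real_derivative_powr) (auto simp: abs_if split: if_splits)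
      qed
      then obtain z where z: "s < z" "z < t" "t powr p - s powr p = (t - s) * (p * z powr (p - 1))" by blast
      have "\<bar>z - u\<bar> < r" using z st by (auto simp: abs_if split: if_splits)
      then have "\<bar>p * z powr (p - 1) - p * u powr (p - 1)\<bar> \<le> \<eta>" using r by (simp add: less_imp_le)
      then have "\<bar>t - s\<bar> * \<bar>p * z powr (p - 1) - p * u powr (p - 1)\<bar> \<le> \<bar>t - s\<bar> * \<eta>" by (rule mult_left_mono) simp
      then show ?thesis unfolding z(3) abs_mult[symmetric] by (simp add: algebra_simps)
    qed
    have sym: "\<bar>a - b - c * (s - t)\<bar> = \<bar>b - a - c * (t - s)\<bar>" for a b c s t :: real
    proof -
      have "a - b - c * (s - t) = - (b - a - c * (t - s))" by (simp add: algebra_simps)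
      then show ?thesis by (simp only: abs_minus_cancel)
    qed
    show ?thesis
    proof (intro exI[of _ "min r u"] conjI allI impI)
      show "0 < min r u" using r u by simp
      fix s t assume st: "\<bar>s - u\<bar> < min r u" "\<bar>t - u\<bar> < min r u"
      then have "0 < s" "0 < t" by (auto simp: abs_if split: if_splits)
      then show "\<bar>\<bar>s\<bar> powr p - \<bar>t\<bar> powr p - p * u powr (p - 1) * (s - t)\<bar> \<le> \<eta> * \<bar>s - t\<bar>"
        using main[OF st] main[OF st(2,1)] sym[of "s powr p" "t powr p" "p * u powr (p - 1)" s t]
        by (cases s t rule: linorder_cases) simp_all
    qed
  qed
  show ?thesis
  proof (cases "0 < t0")
    case True then show ?thesis using pos[of t0] by (simp add: mult.assoc)
  next
    case False
    then have n: "0 < - t0" using t0 by simp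
    from pos[OF n] obtain \<delta> where d: "\<delta> > 0" and
      h: "\<And>s t. \<bar>s - (- t0)\<bar> < \<delta> \<Longrightarrow> \<bar>t - (- t0)\<bar> < \<delta> \<Longrightarrow>
        \<bar>\<bar>s\<bar> powr p - \<bar>t\<bar> powr p - p * (- t0) powr (p - 1) * (s - t)\<bar> \<le> \<eta> * \<bar>s - t\<bar>" by blast
    show ?thesis
    proof (intro exI[of _ \<delta>] conjI allI impI d)
      fix s t assume "\<bar>s - t0\<bar> < \<delta>" "\<bar>t - t0\<bar> < \<delta>"
      then have "\<bar>- s - (- t0)\<bar> < \<delta>" "\<bar>- t - (- t0)\<bar> < \<delta>" by auto
      from h[OF this] show "\<bar>\<bar>s\<bar> powr p - \<bar>t\<bar> powr p - p * (\<bar>t0\<bar> powr (p - 1) * sgn t0) * (s - t)\<bar> \<le> \<eta> * \<bar>s - t\<bar>"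
        using n by (simp add: sgn_if algebra_simps abs_minus_commute)
    qed
  qed
qed

text \<open>On the unit sphere, away from the coordinate hyperplanes, this is the Euclidean norm of
  the gradient of the p-norm.\<close>

definition grad_norm :: "real \<Rightarrow> nat \<Rightarrow> (nat \<Rightarrow> real) \<Rightarrow> real" where
  "grad_norm p n x = sqrt (\<Sum>i<n. (\<bar>x i\<bar> powr (p - 1))\<^sup>2)"

lemma grad_norm_nonneg [simp]: "0 \<le> grad_norm p n x"
  by (simp add: grad_norm_def sum_nonneg)

lemma measurable_grad_norm [measurable]: "grad_norm p n \<in> borel_measurable (leb n)"
  unfolding grad_norm_def by measurable

lemma lp_sphere_sum: "x \<in> lp_sphere p n \<Longrightarrow> 0 < p \<Longrightarrow> (\<Sum>i<n. \<bar>x i\<bar> powr p) = 1"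
proof -
  assume x: "x \<in> lp_sphere p n" and p: "0 < p"
  have "(\<Sum>i<n. \<bar>x i\<bar> powr p) = (lp_norm p n x) powr p"
    using p by (simp add: lp_norm_def powr_powr sum_nonneg)
  then show ?thesis using x by (simp add: lp_sphere_def)
qed

lemma lp_sphere_abs_le: "x \<in> lp_sphere p n \<Longrightarrow> 0 < p \<Longrightarrow> i < n \<Longrightarrow> \<bar>x i\<bar> \<le> 1"
proof -
  assume x: "x \<in> lp_sphere p n" "0 < p" "i < n"
  have "\<bar>x i\<bar> powr p \<le> (\<Sum>i<n. \<bar>x i\<bar> powr p)" using x by (intro member_le_sum) auto
  then have "\<bar>x i\<bar> powr p \<le> 1 powr p" using lp_sphere_sum[OF x(1,2)] by simp
  then show ?thesis using x by (meson abs_ge_zero not_le powr_less_mono2 zero_le_one)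
qed

text \<open>Central projection onto a tangent hyperplane is nearly isometric, because its denominator is
  nearly constant on the sphere.\<close>

lemma projection_dist:
  fixes a b :: "nat \<Rightarrow> real"
  assumes h: "\<bar>ha - 1\<bar> \<le> \<eta>" "\<bar>hb - 1\<bar> \<le> \<eta>" "\<bar>ha - hb\<bar> \<le> \<eta> * euclid_dist n a b" and \<eta>: "0 < \<eta>" "\<eta> \<le> 1 / 2"
    and b: "\<And>i. i < n \<Longrightarrow> \<bar>b i\<bar> \<le> 1"
  shows "(1 / (1 + \<eta>) - 4 * real n * \<eta>) * euclid_dist n a b \<le> euclid_dist n (scale_vec n (1 / ha) a) (scale_vec n (1 / hb) b)"
    and "euclid_dist n (scale_vec n (1 / ha) a) (scale_vec n (1 / hb) b) \<le> (1 / (1 - \<eta>) + 4 * real n * \<eta>) * euclid_dist n a b"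
proof -
  have ha: "1 - \<eta> \<le> ha" "ha \<le> 1 + \<eta>" "1 / 2 \<le> ha" and hb: "1 / 2 \<le> hb" using h(1,2) \<eta> by (auto simp: abs_if split: if_splits)
  let ?L = "\<lambda>f. L2_set f {..<n}"
  let ?D = "euclid_dist n (scale_vec n (1 / ha) a) (scale_vec n (1 / hb) b)"
  \<comment> \<open>The difference of the projections is split as \<open>(a - b) / ha\<close> plus
    \<open>(1 / ha - 1 / hb) * b\<close>. The first part is nearly isometric; in the bound for the
    second, 4 comes from \<open>ha, hb \<ge> 1 / 2\<close> and \<open>n\<close> from estimating the
    Euclidean norm by the sum of the coordinates.\<close>
  let ?f = "\<lambda>i. (1 / ha) * (a i - b i)" and ?g = "\<lambda>i. (1 / ha - 1 / hb) * b i"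
  have D: "?D = ?L (\<lambda>i. ?f i + ?g i)"
    unfolding euclid_dist_eq_L2_set by (rule L2_set_cong) (auto simp: scale_vec_apply algebra_simps)
  have f: "?L ?f = (1 / ha) * euclid_dist n a b"
    unfolding euclid_dist_eq_L2_set using ha by (subst L2_set_right_distrib) auto
  have "?L ?g \<le> (\<Sum>i<n. \<bar>?g i\<bar>)" by (rule L2_set_le_sum_abs)
  also have "\<dots> \<le> (\<Sum>i<n. 4 * \<eta> * euclid_dist n a b)"
  proof (rule sum_mono)
    fix i assume i: "i \<in> {..<n}"
    have "1 / ha - 1 / hb = (hb - ha) * ((1 / ha) * (1 / hb))" using ha hb by (simp add: field_simps)
    then have "\<bar>?g i\<bar> = \<bar>ha - hb\<bar> * ((1 / ha) * (1 / hb)) * \<bar>b i\<bar>"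
      using ha hb by (simp add: abs_mult abs_minus_commute)
    also have "\<dots> \<le> (\<eta> * euclid_dist n a b) * (2 * 2) * 1"
      using i ha hb b h(3) \<eta> by (intro mult_mono) (auto simp: field_simps euclid_dist_def sum_nonneg)
    finally show "\<bar>?g i\<bar> \<le> 4 * \<eta> * euclid_dist n a b" by simp
  qed
  finally have g: "?L ?g \<le> 4 * real n * \<eta> * euclid_dist n a b" by simp
  have nn: "0 \<le> euclid_dist n a b" by (simp add: euclid_dist_def sum_nonneg)
  have "?D \<le> ?L ?f + ?L ?g" unfolding D by (rule L2_set_triangle_ineq)
  also have "\<dots> \<le> (1 / ha) * euclid_dist n a b + 4 * real n * \<eta> * euclid_dist n a b" using f g by simp
  also have "(1 / ha) * euclid_dist n a b \<le> (1 / (1 - \<eta>)) * euclid_dist n a b"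
    using ha \<eta> nn by (intro mult_right_mono divide_left_mono) auto
  finally show "?D \<le> (1 / (1 - \<eta>) + 4 * real n * \<eta>) * euclid_dist n a b" by (simp add: algebra_simps)
  have "?L ?f = ?L (\<lambda>i. (?f i + ?g i) + (- ?g i))" by simp
  also have "\<dots> \<le> ?L (\<lambda>i. ?f i + ?g i) + ?L (\<lambda>i. - ?g i)" by (rule L2_set_triangle_ineq)
  also have "?L (\<lambda>i. - ?g i) = ?L ?g" by (simp add: L2_set_def)
  finally have "(1 / ha) * euclid_dist n a b \<le> ?D + 4 * real n * \<eta> * euclid_dist n a b" using f g D by simp
  moreover have "(1 / (1 + \<eta>)) * euclid_dist n a b \<le> (1 / ha) * euclid_dist n a b"
    using ha \<eta> nn by (intro mult_right_mono divide_left_mono) auto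
  ultimately show "(1 / (1 + \<eta>) - 4 * real n * \<eta>) * euclid_dist n a b \<le> ?D" by (simp add: algebra_simps)
qed

text \<open>Each premise covers all smaller radii as well, so the minimum of finitely many radii
  works without monotonicity of \<open>P i\<close>.\<close>

lemma uniform_radius:
  assumes "\<And>i. i < (n::nat) \<Longrightarrow> \<exists>\<delta>>0::real. \<forall>\<epsilon>. 0 < \<epsilon> \<longrightarrow> \<epsilon> \<le> \<delta> \<longrightarrow> P i \<epsilon>"
  shows "\<exists>\<delta>>0. \<forall>\<epsilon>. 0 < \<epsilon> \<longrightarrow> \<epsilon> \<le> \<delta> \<longrightarrow> (\<forall>i<n. P i \<epsilon>)"
  using assms
proof (induction n)
  case 0 then show ?case by (auto intro: exI[of _ 1])
next
  case (Suc n)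
  then obtain a where a: "a > 0" "\<And>\<epsilon>. 0 < \<epsilon> \<Longrightarrow> \<epsilon> \<le> a \<Longrightarrow> \<forall>i<n. P i \<epsilon>" by (metis less_Suc_eq)
  obtain b where b: "b > 0" "\<And>\<epsilon>. 0 < \<epsilon> \<Longrightarrow> \<epsilon> \<le> b \<Longrightarrow> P n \<epsilon>" using Suc.prems[of n] by auto
  show ?case
    using a b by (intro exI[of _ "min a b"]) (auto simp: less_Suc_eq)
qed

text \<open>The chart is the central projection onto the tangent hyperplane at \<open>x0\<close>.
  The p-th power sum is constant on the sphere, so by strict differentiability its linearization
  \<open>h\<close> is nearly constant there close to \<open>x0\<close>. This gives both the
  Lipschitz bounds, by \<open>projection_dist\<close>, and the bounds on the height
  \<open>g = h / w\<close>.\<close>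

lemma sphere_local_estimate:
  fixes p \<rho> :: real and d :: nat and x0 :: "nat \<Rightarrow> real"
  defines "n \<equiv> Suc d"
  assumes p: "1 \<le> p" and x0: "x0 \<in> lp_sphere p n" and nz: "\<And>i. i < n \<Longrightarrow> x0 i \<noteq> 0" and \<rho>: "1 < \<rho>"
  shows "\<exists>\<delta>>0. \<forall>A\<in>sets (leb n). A \<subseteq> lp_sphere p n \<longrightarrow> (\<forall>a\<in>A. \<forall>i<n. \<bar>a i - x0 i\<bar> < \<delta>) \<longrightarrow>
    hausdorff (euclid_dist n) d A \<le> ennreal (\<rho> ^ (d + n)) * (haus_const d * of_nat n * ennreal (grad_norm p n x0) * cone_vol p n A) \<and>
    haus_const d * of_nat n * ennreal (grad_norm p n x0) * cone_vol p n A \<le> ennreal (\<rho> ^ (d + n)) * hausdorff (euclid_dist n) d A"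
proof -
  define \<nu> where "\<nu> i = \<bar>x0 i\<bar> powr (p - 1) * sgn (x0 i)" for i
  define w where "w = grad_norm p n x0"
  have \<nu>2: "(\<nu> i)\<^sup>2 = (\<bar>x0 i\<bar> powr (p - 1))\<^sup>2" if "i < n" for i
    using nz[OF that] by (simp add: \<nu>_def power_mult_distrib sgn_if)
  have w2: "w\<^sup>2 = (\<Sum>i<n. (\<nu> i)\<^sup>2)"
    unfolding w_def grad_norm_def by (subst real_sqrt_pow2) (auto intro: sum_nonneg simp: \<nu>2)
  have w: "0 < w"
  proof -
    have "0 < (\<Sum>i<n. (\<nu> i)\<^sup>2)"
      using nz by (intro sum_pos) (auto simp: \<nu>2 n_def)
    then have "w \<noteq> 0" using w2 by auto
    then show ?thesis using grad_norm_nonneg[of p n x0] unfolding w_def by linarith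
  qed
  define h where "h a = (\<Sum>i<n. \<nu> i * a i)" for a
  \<comment> \<open>Euler's relation for the homogeneous power sum: the tangent hyperplane at
    \<open>x0\<close> is \<open>h = 1\<close>.\<close>
  have hx0: "h x0 = 1"
  proof -
    have "h x0 = (\<Sum>i<n. \<bar>x0 i\<bar> powr p)"
      unfolding h_def
    proof (intro sum.cong refl)
      fix i assume "i \<in> {..<n}"
      then have "x0 i \<noteq> 0" using nz by simp
      have "\<nu> i * x0 i = \<bar>x0 i\<bar> powr (p - 1) * \<bar>x0 i\<bar>" by (simp add: \<nu>_def mult.assoc abs_sgn mult.commute[of "sgn _"])
      also have "\<dots> = \<bar>x0 i\<bar> powr p" using \<open>x0 i \<noteq> 0\<close> powr_mult_base[of "\<bar>x0 i\<bar>" "p - 1"] by (simp add: mult.commute)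
      finally show "\<nu> i * x0 i = \<bar>x0 i\<bar> powr p" .
    qed
    then show ?thesis using lp_sphere_sum[OF x0] p by simp
  qed
  \<comment> \<open>The tolerance has to keep the distortion in \<open>projection_dist\<close> and
    the values of \<open>h\<close> within the factor \<open>\<rho>\<close>. Since
    \<open>\<rho> > 1\<close>, every small positive value will do.\<close>
  have "\<forall>\<^sub>F \<eta> in at_right 0. 1 / \<rho> < 1 / (1 + \<eta>) - 4 * real n * \<eta> \<and> 1 / (1 - \<eta>) + 4 * real n * \<eta> < \<rho> \<and> 1 / \<rho> < 1 - \<eta> \<and> 1 + \<eta> < \<rho> \<and> \<eta> < 1 / 2 \<and> 0 < \<eta>"
  proof (intro eventually_conj)
    have "((\<lambda>\<eta>. 1 / (1 + \<eta>) - 4 * real n * \<eta>) \<longlongrightarrow> 1) (at_right (0::real))" by (auto intro!: tendsto_eq_intros)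
    then show "\<forall>\<^sub>F \<eta> in at_right 0. 1 / \<rho> < 1 / (1 + \<eta>) - 4 * real n * \<eta>" using \<rho> by (intro order_tendstoD) auto
    have "((\<lambda>\<eta>. 1 / (1 - \<eta>) + 4 * real n * \<eta>) \<longlongrightarrow> 1) (at_right (0::real))" by (auto intro!: tendsto_eq_intros)
    then show "\<forall>\<^sub>F \<eta> in at_right 0. 1 / (1 - \<eta>) + 4 * real n * \<eta> < \<rho>" using \<rho> by (intro order_tendstoD) auto
    have "((\<lambda>\<eta>. 1 - \<eta>) \<longlongrightarrow> 1 - 0) (at_right (0::real))" by (intro tendsto_intros)
    then show "\<forall>\<^sub>F \<eta> in at_right 0. 1 / \<rho> < 1 - \<eta>" using \<rho> by (intro order_tendstoD) auto
    have "((\<lambda>\<eta>. 1 + \<eta>) \<longlongrightarrow> 1 + 0) (at_right (0::real))" by (intro tendsto_intros)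
    then show "\<forall>\<^sub>F \<eta> in at_right 0. 1 + \<eta> < \<rho>" using \<rho> by (intro order_tendstoD) auto
    have "((\<lambda>\<eta>. \<eta>) \<longlongrightarrow> 0) (at_right (0::real))" by (intro tendsto_intros)
    then show "\<forall>\<^sub>F \<eta> in at_right 0. \<eta> < (1 / 2 :: real)" by (intro order_tendstoD) auto
    show "\<forall>\<^sub>F \<eta> in at_right 0. 0 < (\<eta>::real)" by (simp add: eventually_at_right_less)
  qed
  then obtain \<eta> where \<eta>: "1 / \<rho> \<le> 1 / (1 + \<eta>) - 4 * real n * \<eta>" "1 / (1 - \<eta>) + 4 * real n * \<eta> \<le> \<rho>" "1 / \<rho> \<le> 1 - \<eta>" "1 + \<eta> \<le> \<rho>" "\<eta> \<le> 1 / 2" "0 < \<eta>"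
  proof -
    assume that: "\<And>\<eta>. \<lbrakk>1 / \<rho> \<le> 1 / (1 + \<eta>) - 4 * real n * \<eta>; 1 / (1 - \<eta>) + 4 * real n * \<eta> \<le> \<rho>; 1 / \<rho> \<le> 1 - \<eta>;
      1 + \<eta> \<le> \<rho>; \<eta> \<le> 1 / 2; 0 < \<eta>\<rbrakk> \<Longrightarrow> thesis"
    assume "\<forall>\<^sub>F \<eta> in at_right 0. 1 / \<rho> < 1 / (1 + \<eta>) - 4 * real n * \<eta> \<and> 1 / (1 - \<eta>) + 4 * real n * \<eta> < \<rho> \<and>
      1 / \<rho> < 1 - \<eta> \<and> 1 + \<eta> < \<rho> \<and> \<eta> < 1 / 2 \<and> 0 < \<eta>"
    from eventually_happens'[OF trivial_limit_at_right_real this] show thesis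
      by (elim exE conjE) (rule that; (erule less_imp_le)?; assumption?)
  qed
  have n1: "1 \<le> real n" by (simp add: n_def)
  let ?P = "\<lambda>i \<delta>. \<forall>s t. \<bar>s - x0 i\<bar> < \<delta> \<longrightarrow> \<bar>t - x0 i\<bar> < \<delta> \<longrightarrow>
    \<bar>\<bar>s\<bar> powr p - \<bar>t\<bar> powr p - p * \<nu> i * (s - t)\<bar> \<le> \<eta> / n * \<bar>s - t\<bar>"
  have "\<exists>\<delta>>0. \<forall>\<epsilon>. 0 < \<epsilon> \<longrightarrow> \<epsilon> \<le> \<delta> \<longrightarrow> (\<forall>i<n. ?P i \<epsilon>)"
  proof (rule uniform_radius)
    fix i assume "i < n"
    then obtain \<delta> where d: "\<delta> > 0" "?P i \<delta>"
      using abs_powr_strict_deriv[OF p nz, of i "\<eta> / n"] \<eta> n1 unfolding \<nu>_def by auto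
    have "?P i \<epsilon>" if "\<epsilon> \<le> \<delta>" for \<epsilon>
      using d(2) that by (meson less_le_trans)
    then show "\<exists>\<delta>>0. \<forall>\<epsilon>. 0 < \<epsilon> \<longrightarrow> \<epsilon> \<le> \<delta> \<longrightarrow> ?P i \<epsilon>" using d(1) by blast
  qed
  then obtain \<delta>1 where \<delta>1: "\<delta>1 > 0" "\<And>\<epsilon>. 0 < \<epsilon> \<Longrightarrow> \<epsilon> \<le> \<delta>1 \<Longrightarrow> \<forall>i<n. ?P i \<epsilon>" by blast
  \<comment> \<open>The first bound makes strict differentiability applicable, the second keeps
    points within distance 1 of \<open>x0\<close>, whence
    \<open>\<bar>h a - 1\<bar> \<le> \<eta>\<close>, and the third keeps projected points within
    \<open>1 / 3\<close> of each other.\<close>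
  define \<delta> where "\<delta> = Min {\<delta>1, 1 / sqrt n, 1 / (6 * w * \<rho> * sqrt n)}"
  have \<delta>: "0 < \<delta>" "\<delta> \<le> \<delta>1" "\<delta> \<le> 1 / sqrt n" "\<delta> \<le> 1 / (6 * w * \<rho> * sqrt n)"
    using \<delta>1 w \<rho> n1 unfolding \<delta>_def by auto
  have sq: "0 < sqrt n" using n1 by simp
  have \<delta>': "sqrt n * \<delta> \<le> 1" "6 * w * \<rho> * (sqrt n * \<delta>) \<le> 1"
    using \<delta>(3,4) sq w \<rho> by (auto simp: field_simps)
  note P = \<delta>1(2)[OF \<delta>(1,2)]
  show ?thesis
  proof (intro exI[of _ \<delta>] conjI ballI impI)
    show "0 < \<delta>" by fact
    fix A assume A: "A \<in> sets (leb n)" and AS: "A \<subseteq> lp_sphere p n" and near: "\<forall>a\<in>A. \<forall>i<n. \<bar>a i - x0 i\<bar> < \<delta>"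
    \<comment> \<open>The power sums of \<open>a\<close> and \<open>b\<close> cancel, so
      \<open>p * (h a - h b)\<close> consists of linearization errors alone, each with tolerance
      \<open>\<eta> / n\<close>.\<close>
    have diff: "\<bar>h a - h b\<bar> \<le> \<eta> * euclid_dist n a b"
      if ab: "a \<in> lp_sphere p n" "b \<in> lp_sphere p n" "\<forall>i<n. \<bar>a i - x0 i\<bar> < \<delta>" "\<forall>i<n. \<bar>b i - x0 i\<bar> < \<delta>" for a b
    proof -
      have "(\<Sum>i<n. \<bar>a i\<bar> powr p - \<bar>b i\<bar> powr p) = 0"
        using ab p by (simp add: sum_subtractf lp_sphere_sum)
      then have "p * (h a - h b) = - (\<Sum>i<n. \<bar>a i\<bar> powr p - \<bar>b i\<bar> powr p - p * \<nu> i * (a i - b i))"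
        by (simp add: h_def sum_subtractf sum_distrib_left[symmetric] right_diff_distrib mult.assoc)
      then have "\<bar>p * (h a - h b)\<bar> \<le> (\<Sum>i<n. \<bar>\<bar>a i\<bar> powr p - \<bar>b i\<bar> powr p - p * \<nu> i * (a i - b i)\<bar>)"
        by (simp only: abs_minus_cancel sum_abs)
      also have "\<dots> \<le> (\<Sum>i<n. \<eta> / n * euclid_dist n a b)"
      proof (rule sum_mono)
        fix i assume i: "i \<in> {..<n}"
        then have "\<bar>\<bar>a i\<bar> powr p - \<bar>b i\<bar> powr p - p * \<nu> i * (a i - b i)\<bar> \<le> \<eta> / n * \<bar>a i - b i\<bar>"
          using P ab by auto
        also have "\<dots> \<le> \<eta> / n * euclid_dist n a b"
          using i \<eta> by (intro mult_left_mono abs_diff_le_euclid_dist) auto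
        finally show "\<bar>\<bar>a i\<bar> powr p - \<bar>b i\<bar> powr p - p * \<nu> i * (a i - b i)\<bar> \<le> \<eta> / n * euclid_dist n a b" .
      qed
      also have "\<dots> = \<eta> * euclid_dist n a b" using n1 by simp
      finally have "p * \<bar>h a - h b\<bar> \<le> \<eta> * euclid_dist n a b" using p by (simp add: abs_mult)
      moreover have "1 * \<bar>h a - h b\<bar> \<le> p * \<bar>h a - h b\<bar>" using p by (intro mult_right_mono) auto
      ultimately show ?thesis by simp
    qed
    have AA: "a \<in> lp_sphere p n" "\<forall>i<n. \<bar>a i - x0 i\<bar> < \<delta>" if "a \<in> A" for a using that AS near by auto
    have h1: "\<bar>h a - 1\<bar> \<le> \<eta>" if "a \<in> A" for a
    proof -
      have "\<bar>h a - h x0\<bar> \<le> \<eta> * euclid_dist n a x0"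
        using AA[OF that] x0 \<delta>(1) by (intro diff) auto
      also have "euclid_dist n a x0 \<le> sqrt n * \<delta>"
        using AA[OF that] \<delta>(1) by (intro euclid_dist_le) (auto intro: less_imp_le)
      also have "\<eta> * (sqrt n * \<delta>) \<le> \<eta> * 1" using \<delta>' \<eta> by (intro mult_left_mono) auto
      finally show ?thesis using \<eta> by (simp add: hx0)
    qed
    define e where "e i = \<nu> i / w" for i
    have e1: "(\<Sum>i<n. (e i)\<^sup>2) = 1"
      using w by (simp add: e_def power_divide sum_divide_distrib[symmetric] w2[symmetric])
    define g where "g a = (\<Sum>i<n. e i * a i)" for a
    have gh: "g a = h a / w" for a by (simp add: g_def h_def e_def sum_divide_distrib)
    have hA: "1 / \<rho> \<le> h a" "h a \<le> \<rho>" if "a \<in> A" for a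
      using h1[OF that] \<eta>(3,4) by (auto simp: abs_if split: if_splits)
    have g_sc: "scale_vec n (1 / g a) a = scale_vec n w (scale_vec n (1 / h a) a)" for a
      by (simp add: gh scale_vec_scale_vec)
    have D: "1 / \<rho> * euclid_dist n a b \<le> euclid_dist n (scale_vec n (1 / h a) a) (scale_vec n (1 / h b) b)"
      "euclid_dist n (scale_vec n (1 / h a) a) (scale_vec n (1 / h b) b) \<le> \<rho> * euclid_dist n a b"
      if ab: "a \<in> A" "b \<in> A" for a b
    proof -
      have nn: "0 \<le> euclid_dist n a b" by (simp add: euclid_dist_def sum_nonneg)
      have b1: "\<And>i. i < n \<Longrightarrow> \<bar>b i\<bar> \<le> 1" using AA[OF ab(2)] p by (intro lp_sphere_abs_le) auto
      note pd = projection_dist[OF h1[OF ab(1)] h1[OF ab(2)] diff[OF AA(1)[OF ab(1)] AA(1)[OF ab(2)] AA(2)[OF ab(1)] AA(2)[OF ab(2)]] \<eta>(6,5) b1]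
      show "1 / \<rho> * euclid_dist n a b \<le> euclid_dist n (scale_vec n (1 / h a) a) (scale_vec n (1 / h b) b)"
        by (rule order_trans[OF mult_right_mono[OF \<eta>(1) nn] pd(1)])
      show "euclid_dist n (scale_vec n (1 / h a) a) (scale_vec n (1 / h b) b) \<le> \<rho> * euclid_dist n a b"
        by (rule order_trans[OF pd(2) mult_right_mono[OF \<eta>(2) nn]])
    qed
    have lip: "w / \<rho> * euclid_dist n a b \<le> euclid_dist n (scale_vec n (1 / g a) a) (scale_vec n (1 / g b) b) \<and>
        euclid_dist n (scale_vec n (1 / g a) a) (scale_vec n (1 / g b) b) \<le> w * \<rho> * euclid_dist n a b"
      if ab: "a \<in> A" "b \<in> A" for a b
      using mult_left_mono[OF D(1)[OF ab], of w] mult_left_mono[OF D(2)[OF ab], of w] w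
      by (simp add: g_sc euclid_dist_scale mult.assoc)
    have small: "euclid_dist n (scale_vec n (1 / g a) a) (scale_vec n (1 / g b) b) < 1 / 2"
      if ab: "a \<in> A" "b \<in> A" for a b
    proof -
      have "euclid_dist n a b \<le> sqrt n * (2 * \<delta>)"
      proof (rule euclid_dist_le)
        fix i assume i: "i < n"
        have "\<bar>a i - x0 i\<bar> < \<delta>" "\<bar>b i - x0 i\<bar> < \<delta>" using AA(2)[OF ab(1)] AA(2)[OF ab(2)] i by auto
        then show "\<bar>a i - b i\<bar> \<le> 2 * \<delta>" by linarith
      qed (use \<delta> in simp)
      then have "w * \<rho> * euclid_dist n a b \<le> w * \<rho> * (sqrt n * (2 * \<delta>))"
        using w \<rho> by (intro mult_left_mono) auto
      also have "\<dots> \<le> 1 / 3" using \<delta>'(2) by (simp add: mult_ac)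
      finally show ?thesis using lip[OF ab] by linarith
    qed
    have gA: "1 / (w * \<rho>) \<le> g a \<and> g a \<le> \<rho> / w" if "a \<in> A" for a
      using hA[OF that] w \<rho> by (auto simp: gh field_simps)
    have pp: "0 < p" and rr: "0 < \<rho>" using p \<rho> by auto
    note est = hausdorff_chart_estimate[of p A d e w \<rho> g, folded n_def, OF pp A AS e1 w rr g_def gA lip small]
    show "hausdorff (euclid_dist n) d A \<le> ennreal (\<rho> ^ (d + n)) * (haus_const d * of_nat n * ennreal (grad_norm p n x0) * cone_vol p n A)"
      using est(1) by (simp add: w_def)
    show "haus_const d * of_nat n * ennreal (grad_norm p n x0) * cone_vol p n A \<le> ennreal (\<rho> ^ (d + n)) * hausdorff (euclid_dist n) d A"
      using est(2) by (simp add: w_def)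
  qed
qed

section \<open>The Hausdorff measure of the sphere\<close>

text \<open>Once the cover is made disjoint, the local inequalities with the common factor
  \<open>c\<close> add up.\<close>

lemma emeasure_le_countable_cover:
  assumes s: "sets M = sets N" and D: "countable \<D>" "\<D> \<subseteq> sets M" and A: "A \<in> sets M" "A \<subseteq> \<Union>\<D>"
    and le: "\<And>D B. D \<in> \<D> \<Longrightarrow> B \<in> sets M \<Longrightarrow> B \<subseteq> A \<Longrightarrow> B \<subseteq> D \<Longrightarrow> emeasure M B \<le> c * emeasure N B"
  shows "emeasure M A \<le> c * emeasure N A"
proof (cases "\<D> = {}")
  case True then show ?thesis using A by simp
next
  case False
  define U where "U = from_nat_into \<D>"
  have U: "range U = \<D>" unfolding U_def by (rule range_from_nat_into[OF False D(1)])
  define B where "B i = A \<inter> disjointed U i" for i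
  have dU: "range (disjointed U) \<subseteq> sets M" by (rule sets.range_disjointed_sets) (use U D in simp)
  have Bs: "B i \<in> sets M" for i unfolding B_def using dU A by auto
  have dB: "disjoint_family B" using disjoint_family_disjointed[of U] by (auto simp: B_def disjoint_family_on_def)
  have UB: "(\<Union>i. B i) = A" using A U UN_disjointed_eq[of U] by (auto simp: B_def)
  have "emeasure M A = (\<Sum>i. emeasure M (B i))"
    using Bs dB UB by (subst suminf_emeasure) auto
  also have "\<dots> \<le> (\<Sum>i. c * emeasure N (B i))"
  proof (intro suminf_le)
    fix i
    have "U i \<in> \<D>" using U by auto
    then show "emeasure M (B i) \<le> c * emeasure N (B i)"
      using Bs disjointed_subset[of U i] by (intro le[of "U i"]) (auto simp: B_def)
  qed auto
  also have "\<dots> = c * (\<Sum>i. emeasure N (B i))" by simp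
  also have "(\<Sum>i. emeasure N (B i)) = emeasure N A"
    using Bs dB UB s by (subst suminf_emeasure) auto
  finally show ?thesis .
qed

text \<open>The candidate for the surface measure up to a factor: the unnormalized cone measure, as
  a push-forward under radial projection, with the gradient norm as density.\<close>

definition weighted_cone :: "real \<Rightarrow> nat \<Rightarrow> (nat \<Rightarrow> real) measure" where
  "weighted_cone p n = distr (density (leb n)
     (\<lambda>x. ennreal (grad_norm p n (sph p n x)) * indicator {x \<in> space (leb n). 0 < lp_norm p n x \<and> lp_norm p n x \<le> 1} x))
     (leb n) (sph p n)"

lemma sets_weighted_cone [measurable_cong, simp]: "sets (weighted_cone p n) = sets (leb n)"
  by (simp add: weighted_cone_def)

lemma emeasure_weighted_cone:
  assumes [measurable]: "A \<in> sets (leb n)"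
  shows "emeasure (weighted_cone p n) A = (\<integral>\<^sup>+x. ennreal (grad_norm p n (sph p n x)) *
     indicator {x \<in> space (leb n). 0 < lp_norm p n x \<and> lp_norm p n x \<le> 1 \<and> sph p n x \<in> A} x \<partial>leb n)"
  unfolding weighted_cone_def
  by (subst emeasure_distr, measurable, subst emeasure_density, measurable)
     (auto intro!: nn_integral_cong simp: indicator_def)

lemma weighted_cone_sphere:
  assumes "0 < p" and [measurable]: "A \<in> sets (leb n)"
  shows "emeasure (weighted_cone p n) (A \<inter> lp_sphere p n) = emeasure (weighted_cone p n) A"
  using assms by (subst (1 2) emeasure_weighted_cone) (auto intro!: nn_integral_cong simp: indicator_def sph_in_sphere)

lemma weighted_cone_bounds:
  assumes A[measurable]: "A \<in> sets (leb n)" and "0 \<le> a" "0 \<le> b"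
    and "\<And>x. x \<in> A \<Longrightarrow> a \<le> grad_norm p n x \<and> grad_norm p n x \<le> b"
  shows "ennreal a * cone_vol p n A \<le> emeasure (weighted_cone p n) A"
    and "emeasure (weighted_cone p n) A \<le> ennreal b * cone_vol p n A"
proof -
  let ?V = "{x \<in> space (leb n). 0 < lp_norm p n x \<and> lp_norm p n x \<le> 1 \<and> sph p n x \<in> A}"
  have V: "?V \<in> sets (leb n)" by measurable
  have c: "ennreal r * cone_vol p n A = (\<integral>\<^sup>+x. ennreal r * indicator ?V x \<partial>leb n)" for r
    unfolding cone_vol_def using V by (simp add: nn_integral_cmult_indicator)
  show "ennreal a * cone_vol p n A \<le> emeasure (weighted_cone p n) A"
    unfolding c emeasure_weighted_cone[OF A] using assms
    by (intro nn_integral_mono) (auto simp: indicator_def intro: ennreal_leI)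
  show "emeasure (weighted_cone p n) A \<le> ennreal b * cone_vol p n A"
    unfolding c emeasure_weighted_cone[OF A] using assms
    by (intro nn_integral_mono) (auto simp: indicator_def intro: ennreal_leI)
qed

lemma sets_leb_coord: "i < n \<Longrightarrow> {x \<in> space (leb n). x i = t} \<in> sets (leb n)"
  using measurable_sets[OF measurable_leb_component[OF measurable_ident], of i n "{t}"]
  by (simp add: vimage_def Int_def conj_commute)

lemma emeasure_leb_coord_zero: "i < n \<Longrightarrow> emeasure (leb n) {x \<in> space (leb n). x i = 0} = 0"
proof -
  assume i: "i < n"
  have eq: "{x \<in> space (leb n). x i = 0} = Pi\<^sub>E {..<n} (\<lambda>k. if k = i then {0} else UNIV)"
    using i by (auto simp: space_leb PiE_def Pi_def split: if_splits)
  have "emeasure (leb n) (Pi\<^sub>E {..<n} (\<lambda>k. if k = i then {0} else UNIV))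
    = (\<Prod>k<n. emeasure lborel (if k = i then {0} else UNIV :: real set))"
    by (rule emeasure_leb_PiE) auto
  also have "\<dots> = 0" using i by (intro prod_zero) auto
  finally show ?thesis unfolding eq .
qed

lemma weighted_cone_coord_zero:
  assumes i: "i < n"
  shows "emeasure (weighted_cone p n) {x \<in> space (leb n). x i = 0} = 0"
proof -
  have A: "{x \<in> space (leb n). x i = 0} \<in> sets (leb n)" using i by (rule sets_leb_coord)
  \<comment> \<open>Radial projection neither creates nor removes a zero coordinate off the origin,
    so the preimage is Lebesgue null and any bound on the weight, even infinity, will do.\<close>
  have "emeasure (weighted_cone p n) {x \<in> space (leb n). x i = 0} \<le> (\<integral>\<^sup>+x. \<infinity> * indicator {x \<in> space (leb n). x i = 0} x \<partial>leb n)"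
    unfolding emeasure_weighted_cone[OF A] using i
    by (intro nn_integral_mono) (auto simp: indicator_def sph_def scale_vec_apply)
  also have "\<dots> = 0"
    using A by (simp add: nn_integral_cmult_indicator emeasure_leb_coord_zero[OF i])
  finally show ?thesis by simp
qed

lemma grad_norm_local:
  assumes nz: "\<And>i. i < n \<Longrightarrow> x0 i \<noteq> 0" and \<rho>: "1 < \<rho>"
  shows "\<exists>\<delta>>0. \<forall>a. (\<forall>i<n. \<bar>a i - x0 i\<bar> < \<delta>) \<longrightarrow>
    1 / \<rho> * grad_norm p n x0 \<le> grad_norm p n a \<and> grad_norm p n a \<le> \<rho> * grad_norm p n x0"
proof -
  let ?P = "\<lambda>i \<delta>. \<forall>t. \<bar>t - x0 i\<bar> < \<delta> \<longrightarrow> 1 / \<rho> * \<bar>x0 i\<bar> powr (p - 1) \<le> \<bar>t\<bar> powr (p - 1) \<and> \<bar>t\<bar> powr (p - 1) \<le> \<rho> * \<bar>x0 i\<bar> powr (p - 1)"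
  have "\<exists>\<delta>>0. \<forall>\<epsilon>. 0 < \<epsilon> \<longrightarrow> \<epsilon> \<le> \<delta> \<longrightarrow> (\<forall>i<n. ?P i \<epsilon>)"
  proof (rule uniform_radius)
    fix i assume i: "i < n"
    let ?c = "\<bar>x0 i\<bar> powr (p - 1)"
    have c: "0 < ?c" using nz[OF i] by simp
    have t: "((\<lambda>t. \<bar>t\<bar> powr (p - 1)) \<longlongrightarrow> ?c) (nhds (x0 i))"
      using nz[OF i] by (intro tendsto_intros filterlim_ident) auto
    have "\<forall>\<^sub>F t in nhds (x0 i). 1 / \<rho> * ?c < \<bar>t\<bar> powr (p - 1) \<and> \<bar>t\<bar> powr (p - 1) < \<rho> * ?c"
      using \<rho> c by (intro eventually_conj order_tendstoD[OF t]) (auto simp: field_simps)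
    then obtain \<delta> where "0 < \<delta>" "\<And>t. dist t (x0 i) < \<delta> \<Longrightarrow> 1 / \<rho> * ?c < \<bar>t\<bar> powr (p - 1) \<and> \<bar>t\<bar> powr (p - 1) < \<rho> * ?c"
      unfolding eventually_nhds_metric by blast
    then show "\<exists>\<delta>>0. \<forall>\<epsilon>. 0 < \<epsilon> \<longrightarrow> \<epsilon> \<le> \<delta> \<longrightarrow> ?P i \<epsilon>"
      unfolding dist_real_def by (meson less_imp_le less_le_trans)
  qed
  then obtain \<delta> where \<delta>: "0 < \<delta>" "\<forall>i<n. ?P i \<delta>" by blast
  show ?thesis
  proof (intro exI[of _ \<delta>] conjI allI impI \<delta>(1))
    fix a assume a: "\<forall>i<n. \<bar>a i - x0 i\<bar> < \<delta>"
    have b: "1 / \<rho> * \<bar>x0 i\<bar> powr (p - 1) \<le> \<bar>a i\<bar> powr (p - 1)" "\<bar>a i\<bar> powr (p - 1) \<le> \<rho> * \<bar>x0 i\<bar> powr (p - 1)"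
      if "i < n" for i using a \<delta>(2) that by auto
    have sc: "r * grad_norm p n x0 = sqrt (\<Sum>i<n. (r * \<bar>x0 i\<bar> powr (p - 1))\<^sup>2)" if "0 \<le> r" for r
      using that by (simp add: grad_norm_def power_mult_distrib sum_distrib_left[symmetric] real_sqrt_mult)
    show "1 / \<rho> * grad_norm p n x0 \<le> grad_norm p n a"
      using b \<rho> by (subst sc) (auto simp: grad_norm_def intro!: sum_mono power_mono)
    show "grad_norm p n a \<le> \<rho> * grad_norm p n x0"
      using b \<rho> by (subst sc) (auto simp: grad_norm_def intro!: sum_mono power_mono)
  qed
qed

lemma sphere_local_measure:
  fixes p C :: real and d :: nat and x0 :: "nat \<Rightarrow> real"
  defines "n \<equiv> Suc d"
  assumes p: "1 \<le> p" and x0: "x0 \<in> lp_sphere p n" and nz: "\<And>i. i < n \<Longrightarrow> x0 i \<noteq> 0" and C: "1 < C"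
  shows "\<exists>m. \<forall>A\<in>sets (leb n). A \<subseteq> lp_sphere p n \<longrightarrow> A \<subseteq> dcube n m x0 \<longrightarrow>
    hausdorff (euclid_dist n) d A \<le> ennreal C * (haus_const d * of_nat n * emeasure (weighted_cone p n) A) \<and>
    haus_const d * of_nat n * emeasure (weighted_cone p n) A \<le> ennreal C * hausdorff (euclid_dist n) d A"
proof -
  let ?k = "Suc (d + n)"
  \<comment> \<open>The chart costs \<open>\<rho> ^ (d + n)\<close> and the variation of the weight
    one more factor \<open>\<rho>\<close>; together they make \<open>C\<close>.\<close>
  define \<rho> where "\<rho> = root ?k C"
  have \<rho>: "1 < \<rho>" "\<rho> ^ ?k = C" using C real_root_pow_pos2[of ?k C] by (simp_all add: \<rho>_def del: power_Suc)
  let ?w = "grad_norm p n x0" and ?K = "haus_const d * of_nat n" and ?H = "hausdorff (euclid_dist n) d" and ?W = "weighted_cone p n"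
  let ?E = "\<lambda>\<delta>. \<forall>A\<in>sets (leb n). A \<subseteq> lp_sphere p n \<longrightarrow> (\<forall>a\<in>A. \<forall>i<n. \<bar>a i - x0 i\<bar> < \<delta>) \<longrightarrow>
    ?H A \<le> ennreal (\<rho> ^ (d + n)) * (?K * ennreal ?w * cone_vol p n A) \<and>
    ?K * ennreal ?w * cone_vol p n A \<le> ennreal (\<rho> ^ (d + n)) * ?H A"
  have "\<exists>\<delta>>0. ?E \<delta>"
    using sphere_local_estimate[OF p x0[unfolded n_def] nz[unfolded n_def] \<rho>(1)] unfolding n_def .
  then obtain \<delta>1 where *: "0 < \<delta>1 \<and> ?E \<delta>1" ..
  note \<delta>1 = *[THEN conjunct1] and H = *[THEN conjunct2]
  let ?G = "\<lambda>\<delta>. \<forall>a. (\<forall>i<n. \<bar>a i - x0 i\<bar> < \<delta>) \<longrightarrow> 1 / \<rho> * ?w \<le> grad_norm p n a \<and> grad_norm p n a \<le> \<rho> * ?w"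
  have "\<exists>\<delta>>0. ?G \<delta>" by (rule grad_norm_local[OF nz \<rho>(1)])
  then obtain \<delta>2 where *: "0 < \<delta>2 \<and> ?G \<delta>2" ..
  then have \<delta>2: "0 < \<delta>2" by (rule conjunct1)
  have G: "1 / \<rho> * ?w \<le> grad_norm p n a \<and> grad_norm p n a \<le> \<rho> * ?w" if "\<forall>i<n. \<bar>a i - x0 i\<bar> < \<delta>2" for a
    by (rule *[THEN conjunct2, THEN spec, THEN mp, OF that])
  obtain m where m: "(1 / 2 :: real) ^ m < min \<delta>1 \<delta>2" using real_arch_pow_inv[of "min \<delta>1 \<delta>2" "1 / 2"] \<delta>1 \<delta>2 by auto
  show ?thesis
  proof (intro exI[of _ m] ballI impI)
    fix A assume A: "A \<in> sets (leb n)" "A \<subseteq> lp_sphere p n" "A \<subseteq> dcube n m x0"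
    have near: "\<bar>a i - x0 i\<bar> < min \<delta>1 \<delta>2" if "a \<in> A" "i < n" for a i
      using dcube_dist[of a n m x0 i] A(3) that m by fastforce
    have HA: "?H A \<le> ennreal (\<rho> ^ (d + n)) * (?K * ennreal ?w * cone_vol p n A)"
      "?K * ennreal ?w * cone_vol p n A \<le> ennreal (\<rho> ^ (d + n)) * ?H A"
      using H[THEN bspec, OF A(1), THEN mp, OF A(2), THEN mp] near by auto
    have ga: "1 / \<rho> * ?w \<le> grad_norm p n a \<and> grad_norm p n a \<le> \<rho> * ?w" if "a \<in> A" for a
      using near that by (intro G) auto
    have w0: "0 \<le> 1 / \<rho> * ?w" "0 \<le> \<rho> * ?w" using \<rho> by simp_all
    have lo: "ennreal (1 / \<rho> * ?w) * cone_vol p n A \<le> emeasure ?W A" and up: "emeasure ?W A \<le> ennreal (\<rho> * ?w) * cone_vol p n A"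
      by (rule weighted_cone_bounds[OF A(1) w0 ga]; assumption)+
    have "ennreal ?w * cone_vol p n A = ennreal \<rho> * (ennreal (1 / \<rho> * ?w) * cone_vol p n A)"
      using \<rho> by (simp add: mult.assoc[symmetric] ennreal_mult[symmetric])
    also have "\<dots> \<le> ennreal \<rho> * emeasure ?W A" by (intro mult_left_mono lo) simp
    finally have lo': "ennreal ?w * cone_vol p n A \<le> ennreal \<rho> * emeasure ?W A" .
    have Ck: "ennreal (\<rho> ^ (d + n)) * ennreal \<rho> = ennreal C"
      using \<rho> by (simp add: ennreal_mult[symmetric] mult.commute)
    have "?H A \<le> ennreal (\<rho> ^ (d + n)) * (?K * (ennreal ?w * cone_vol p n A))" using HA(1) by (simp add: mult.assoc)
    also have "\<dots> \<le> ennreal (\<rho> ^ (d + n)) * (?K * (ennreal \<rho> * emeasure ?W A))"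
      by (intro mult_left_mono lo') auto
    also have "\<dots> = ennreal (\<rho> ^ (d + n)) * ennreal \<rho> * (?K * emeasure ?W A)" by (simp only: mult_ac)
    finally have 1: "?H A \<le> ennreal C * (?K * emeasure ?W A)" unfolding Ck .
    have "?K * emeasure ?W A \<le> ?K * (ennreal (\<rho> * ?w) * cone_vol p n A)" by (intro mult_left_mono up) auto
    also have "\<dots> = ennreal \<rho> * (?K * ennreal ?w * cone_vol p n A)" using \<rho> by (simp add: ennreal_mult mult_ac)
    also have "\<dots> \<le> ennreal \<rho> * (ennreal (\<rho> ^ (d + n)) * ?H A)" by (intro mult_left_mono HA) auto
    also have "\<dots> = ennreal (\<rho> ^ (d + n)) * ennreal \<rho> * ?H A" by (simp only: mult_ac)
    finally have 2: "?K * emeasure ?W A \<le> ennreal C * ?H A" unfolding Ck .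
    show "?H A \<le> ennreal C * (?K * emeasure ?W A) \<and> ?K * emeasure ?W A \<le> ennreal C * ?H A" using 1 2 by simp
  qed
qed

lemma ennreal_le_mult_gt1:
  assumes "\<And>C::real. 1 < C \<Longrightarrow> a \<le> ennreal C * b" shows "a \<le> b"
proof -
  have "((\<lambda>C. ennreal C * b) \<longlongrightarrow> ennreal 1 * b) (at_right 1)"
    by (intro tendsto_mult_ennreal tendsto_ennrealI tendsto_ident_at tendsto_const) auto
  moreover have "\<forall>\<^sub>F C in at_right 1. a \<le> ennreal C * b"
    using assms by (auto simp: eventually_at_filter)
  ultimately have "a \<le> ennreal 1 * b"
    by (rule tendsto_lowerbound) simp
  then show ?thesis by simp
qed

text \<open>The slices of the sphere at different heights are disjoint, so one of them is null;
  a rescaling maps it onto the slice at height zero.\<close>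

lemma hausdorff_sphere_coord_zero:
  fixes p :: real and d :: nat
  assumes p: "0 < p" and fin: "finite_measure \<nu>" and sets_\<nu>: "sets \<nu> = sets (leb n)"
    and \<nu>: "\<And>A. A \<in> sets (leb n) \<Longrightarrow> emeasure \<nu> A = hausdorff (euclid_dist n) d (A \<inter> lp_sphere p n)"
    and i: "i < n"
  shows "emeasure \<nu> {x \<in> space (leb n). x i = 0} = 0"
proof -
  interpret finite_measure \<nu> by (rule fin)
  have c[measurable]: "(\<lambda>x. x i) \<in> borel_measurable \<nu>"
    using i by (subst measurable_cong_sets[OF sets_\<nu> refl]) measurable
  have space_\<nu>: "space \<nu> = space (leb n)" using sets_\<nu> by (rule sets_eq_imp_space_eq)
  interpret D: finite_measure "distr \<nu> borel (\<lambda>x. x i)" by (rule finite_measure_distr[OF c])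
  have "\<not> {0<..<1::real} \<subseteq> {t. measure (distr \<nu> borel (\<lambda>x. x i)) {t} \<noteq> 0}"
    using D.countable_support uncountable_open_interval[of 0 "1::real"] countable_subset by (metis zero_less_one)
  then obtain t where t: "0 < t" "t < 1" "measure (distr \<nu> borel (\<lambda>x. x i)) {t} = 0" by auto
  let ?Z = "\<lambda>t. {x \<in> space (leb n). x i = t}"
  have Zs: "?Z t \<in> sets (leb n)" for t using i by (rule sets_leb_coord)
  have "measure \<nu> (?Z t) = 0"
    using t(3) by (subst (asm) measure_distr) (auto simp: space_\<nu> vimage_def Int_def conj_commute)
  then have Zt: "hausdorff (euclid_dist n) d (?Z t \<inter> lp_sphere p n) = 0"
    using \<nu>[OF Zs[of t]] by (simp add: emeasure_eq_measure)
  \<comment> \<open>The remaining coordinates of a point in the slice at height \<open>t\<close>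
    have p-norm \<open>s\<close>. Deleting coordinate \<open>i\<close> and dividing by
    \<open>s\<close> is therefore a Lipschitz map of this slice that covers the slice at height
    0.\<close>
  define s where "s = (1 - t powr p) powr (1 / p)"
  have tp: "t powr p < 1" using t p powr_less_mono2[of p t 1] by simp
  have s: "0 < s" "s powr p = 1 - t powr p" using tp p by (auto simp: s_def powr_powr)
  let ?f = "\<lambda>x. scale_vec n (1 / s) (x(i := 0))"
  have "?Z 0 \<inter> lp_sphere p n \<subseteq> ?f ` (?Z t \<inter> lp_sphere p n)"
  proof
    fix y assume y: "y \<in> ?Z 0 \<inter> lp_sphere p n"
    define x where "x = (scale_vec n s y)(i := t)"
    have sp: "x \<in> space (leb n)" using i by (auto simp: x_def scale_vec_def space_leb extensional_def)
    have "(\<Sum>k<n. \<bar>x k\<bar> powr p) = \<bar>x i\<bar> powr p + (\<Sum>k\<in>{..<n} - {i}. \<bar>x k\<bar> powr p)"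
      using i by (intro sum.remove) auto
    also have "(\<Sum>k\<in>{..<n} - {i}. \<bar>x k\<bar> powr p) = (\<Sum>k\<in>{..<n} - {i}. s powr p * \<bar>y k\<bar> powr p)"
      using s by (intro sum.cong) (auto simp: x_def scale_vec_apply abs_mult powr_mult)
    also have "\<dots> = s powr p * (\<Sum>k<n. \<bar>y k\<bar> powr p)"
      using i y p sum.remove[of "{..<n}" i "\<lambda>k. \<bar>y k\<bar> powr p"] by (simp add: sum_distrib_left)
    also have "(\<Sum>k<n. \<bar>y k\<bar> powr p) = 1" using y p by (auto intro: lp_sphere_sum)
    finally have "(\<Sum>k<n. \<bar>x k\<bar> powr p) = 1" using t s by (simp add: x_def)
    then have "x \<in> ?Z t \<inter> lp_sphere p n" using sp by (simp add: lp_sphere_def lp_norm_def) (simp add: x_def)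
    moreover have "?f x = y"
      using y s i by (auto simp: x_def scale_vec_def space_leb extensional_def fun_eq_iff)
    ultimately show "y \<in> ?f ` (?Z t \<inter> lp_sphere p n)" by (intro rev_image_eqI[of x]) simp_all
  qed
  then have "hausdorff (euclid_dist n) d (?Z 0 \<inter> lp_sphere p n) \<le> hausdorff (euclid_dist n) d (?f ` (?Z t \<inter> lp_sphere p n))"
    by (rule hausdorff_mono)
  also have "\<dots> \<le> ennreal ((1 / s) ^ d) * hausdorff (euclid_dist n) d (?Z t \<inter> lp_sphere p n)"
  proof (rule hausdorff_image_le)
    fix x y
    have "euclid_dist n (x(i := 0)) (y(i := 0)) \<le> euclid_dist n x y"
      unfolding euclid_dist_def by (intro real_sqrt_le_mono sum_mono) auto
    then show "euclid_dist n (?f x) (?f y) \<le> 1 / s * euclid_dist n x y"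
      using s by (simp add: euclid_dist_scale divide_right_mono)
  qed (use s in simp)
  also have "\<dots> = 0" by (simp add: Zt)
  finally show ?thesis by (simp add: \<nu>[OF Zs])
qed

text \<open>Off the coordinate hyperplanes, which are null for both measures, each point has a
  dyadic cube on which the measures agree up to a factor \<open>C > 1\<close>. Countably many cubes
  cover, so the comparison holds globally, and \<open>C\<close> tends to 1.\<close>

theorem hausdorff_sphere_eq_weighted_cone:
  fixes p :: real and d :: nat
  defines "n \<equiv> Suc d"
  assumes p: "1 \<le> p" and fin: "finite_measure \<nu>" and sets_\<nu>: "sets \<nu> = sets (leb n)"
    and \<nu>: "\<And>A. A \<in> sets (leb n) \<Longrightarrow> emeasure \<nu> A = hausdorff (euclid_dist n) d (A \<inter> lp_sphere p n)"
    and A: "A \<in> sets (leb n)"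
  shows "emeasure \<nu> A = haus_const d * of_nat n * emeasure (weighted_cone p n) A"
proof -
  let ?K = "haus_const d * of_nat n" and ?W = "weighted_cone p n"
  let ?S = "lp_sphere p n"
  let ?Z = "\<lambda>i. {x \<in> space (leb n). x i = 0}"
  define R where "R = ?S - (\<Union>i<n. ?Z i)"
  have Zs: "?Z i \<in> sets (leb n)" if "i < n" for i using that by (rule sets_leb_coord)
  have R[measurable]: "R \<in> sets (leb n)" unfolding R_def using Zs by (intro sets.Diff sets.finite_UN) auto
  define W where "W = scale_measure ?K ?W"
  have W: "sets W = sets (leb n)" "emeasure W B = ?K * emeasure ?W B" for B by (simp_all add: W_def)
  have null: "emeasure M A = emeasure M (A \<inter> R)"
    if M: "sets M = sets (leb n)" "emeasure M A = emeasure M (A \<inter> ?S)" "\<And>i. i < n \<Longrightarrow> emeasure M (?Z i) = 0" for M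
  proof (rule antisym)
    have "emeasure M A \<le> emeasure M ((A \<inter> R) \<union> (\<Union>i<n. ?Z i))"
      unfolding M(2) using A Zs M(1) by (intro emeasure_mono) (auto simp: R_def)
    also have "\<dots> \<le> emeasure M (A \<inter> R) + emeasure M (\<Union>i<n. ?Z i)"
      using A Zs M(1) by (intro emeasure_subadditive) auto
    also have "emeasure M (\<Union>i<n. ?Z i) \<le> (\<Sum>i<n. emeasure M (?Z i))"
      using Zs M(1) by (intro emeasure_subadditive_finite) (simp_all add: image_subset_iff)
    also have "(\<Sum>i<n. emeasure M (?Z i)) = 0" using M(3) by simp
    finally show "emeasure M A \<le> emeasure M (A \<inter> R)" by simp
  qed (use A M(1) in \<open>auto intro!: emeasure_mono\<close>)
  have \<nu>A: "emeasure \<nu> A = emeasure \<nu> (A \<inter> R)"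
    using A p by (intro null hausdorff_sphere_coord_zero[OF _ fin sets_\<nu> \<nu>] sets_\<nu>) (auto simp: \<nu> Int_assoc)
  have WA: "emeasure W A = emeasure W (A \<inter> R)"
    using A p by (intro null) (auto simp: W weighted_cone_sphere weighted_cone_coord_zero)
  \<comment> \<open>Collecting the cubes instead of their base points keeps the family
    countable.\<close>
  define good where "good C = {D. \<exists>m x. D = dcube n m x \<and> (\<forall>B\<in>sets (leb n). B \<subseteq> ?S \<longrightarrow> B \<subseteq> D \<longrightarrow>
      emeasure \<nu> B \<le> ennreal C * emeasure W B \<and> emeasure W B \<le> ennreal C * emeasure \<nu> B)}" for C
  have dc: "\<exists>m x. D = dcube n m x" if "D \<in> good C" for D C
    using that unfolding good_def mem_Collect_eq by (elim exE conjE) (intro exI)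
  have gd: "emeasure \<nu> B \<le> ennreal C * emeasure W B" "emeasure W B \<le> ennreal C * emeasure \<nu> B"
    if "D \<in> good C" "B \<in> sets (leb n)" "B \<subseteq> ?S" "B \<subseteq> D" for B C D
    using that unfolding good_def mem_Collect_eq by (elim exE conjE, simp)+
  have good: "countable (good C)" "good C \<subseteq> sets (leb n)" for C
  proof -
    have "good C \<subseteq> range (\<lambda>(m, x). dcube n m x)"
    proof
      fix D assume "D \<in> good C"
      from dc[OF this] obtain m x where "D = dcube n m x" by (elim exE)
      then show "D \<in> range (\<lambda>(m, x). dcube n m x)" by (intro image_eqI[of _ _ "(m, x)"]) simp_all
    qed
    then show "countable (good C)" using countable_dcubes by (rule countable_subset)
    show "good C \<subseteq> sets (leb n)"
    proof
      fix D assume "D \<in> good C"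
      from dc[OF this] obtain m x where "D = dcube n m x" by (elim exE)
      then show "D \<in> sets (leb n)" using sets_dcube by simp
    qed
  qed
  have cover: "A \<inter> R \<subseteq> \<Union>(good C)" if C: "1 < C" for C
  proof
    fix x assume x: "x \<in> A \<inter> R"
    then have xs: "x \<in> ?S" and nz: "\<And>i. i < n \<Longrightarrow> x i \<noteq> 0" by (auto simp: R_def lp_sphere_def)
    obtain m where m: "\<And>B. B \<in> sets (leb n) \<Longrightarrow> B \<subseteq> ?S \<Longrightarrow> B \<subseteq> dcube n m x \<Longrightarrow>
      hausdorff (euclid_dist n) d B \<le> ennreal C * (?K * emeasure ?W B) \<and> ?K * emeasure ?W B \<le> ennreal C * hausdorff (euclid_dist n) d B"
      using sphere_local_measure[OF p xs[unfolded n_def] nz[unfolded n_def] C] unfolding n_def by blast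
    have "dcube n m x \<in> good C"
      unfolding good_def using m by (auto simp: \<nu> W Int_absorb2)
    moreover have "x \<in> dcube n m x" using xs by (intro dcube_self) (auto simp: lp_sphere_def)
    ultimately show "x \<in> \<Union>(good C)" by blast
  qed
  have "emeasure \<nu> (A \<inter> R) = emeasure W (A \<inter> R)"
  proof (rule antisym; rule ennreal_le_mult_gt1)
    fix C :: real assume C: "1 < C"
    have sub: "B \<subseteq> ?S" if "B \<subseteq> A \<inter> R" for B using that by (auto simp: R_def)
    have sets': "sets \<nu> = sets W" "good C \<subseteq> sets \<nu>" "good C \<subseteq> sets W" "A \<inter> R \<in> sets \<nu>" "A \<inter> R \<in> sets W"
      using good(2)[of C] A by (auto simp only: sets_\<nu> W intro!: sets.Int R)
    show "emeasure \<nu> (A \<inter> R) \<le> ennreal C * emeasure W (A \<inter> R)"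
      by (rule emeasure_le_countable_cover[OF sets'(1) good(1) sets'(2,4) cover[OF C]])
         (rule gd(1); (assumption | rule sub | simp only: sets_\<nu>)+)
    show "emeasure W (A \<inter> R) \<le> ennreal C * emeasure \<nu> (A \<inter> R)"
      by (rule emeasure_le_countable_cover[OF sets'(1)[symmetric] good(1) sets'(3,5) cover[OF C]])
         (rule gd(2); (assumption | rule sub | simp only: W(1))+)
  qed
  then show ?thesis using \<nu>A WA by (simp add: W)
qed

section \<open>Laws of scale-invariant events\<close>

text \<open>The weight \<open>h\<close> is evaluated at the radial projection, so it depends on the
  direction alone. Up to normalization, \<open>h = 1\<close> belongs to the cone measure and the
  gradient norm to the surface measure.\<close>

definition cone_weight :: "real \<Rightarrow> nat \<Rightarrow> ((nat \<Rightarrow> real) \<Rightarrow> ennreal) \<Rightarrow> (nat \<Rightarrow> real) set \<Rightarrow> ennreal" where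
  "cone_weight p n h A = (\<integral>\<^sup>+x. h (sph p n x) *
     indicator {x \<in> space (leb n). 0 < lp_norm p n x \<and> lp_norm p n x \<le> 1 \<and> sph p n x \<in> A} x \<partial>leb n)"

lemma cone_weight_scale:
  assumes [measurable]: "h \<in> borel_measurable (leb n)" "A \<in> sets (leb n)" and t: "0 < t" and p: "0 < p"
  shows "(\<integral>\<^sup>+x. h (sph p n x) * indicator {x \<in> space (leb n). 0 < lp_norm p n x \<and> lp_norm p n x \<le> t \<and> sph p n x \<in> A} x \<partial>leb n)
    = ennreal (t ^ n) * cone_weight p n h A"
proof -
  let ?B = "\<lambda>r. {x \<in> space (leb n). 0 < lp_norm p n x \<and> lp_norm p n x \<le> r \<and> sph p n x \<in> A}"
  have [measurable]: "?B r \<in> sets (leb n)" for r by measurable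
  have "(\<integral>\<^sup>+x. h (sph p n x) * indicator (?B t) x \<partial>leb n)
      = ennreal (t ^ n) * (\<integral>\<^sup>+x. h (sph p n (scale_vec n t x)) * indicator (?B t) (scale_vec n t x) \<partial>leb n)"
    by (rule nn_integral_leb_scale[OF _ t]) measurable
  also have "(\<integral>\<^sup>+x. h (sph p n (scale_vec n t x)) * indicator (?B t) (scale_vec n t x) \<partial>leb n) = cone_weight p n h A"
    unfolding cone_weight_def using t p
    by (intro nn_integral_cong) (auto simp: indicator_def lp_norm_scale sph_scale zero_less_mult_iff mult_le_cancel_left1)
  finally show ?thesis .
qed

text \<open>Integration in polar coordinates: the push-forwards under the norm of the weighted Lebesgue measures on
  two cones are proportional, as they are on the intervals \<open>{..t}\<close>.\<close>

lemma polar_proportional: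
  assumes h[measurable]: "h \<in> borel_measurable (leb n)" and A[measurable]: "A \<in> sets (leb n)"
    and g[measurable]: "g \<in> borel_measurable borel" and p: "0 < p"
    and fin: "cone_weight p n h (space (leb n)) < \<infinity>"
  shows "cone_weight p n h (space (leb n)) *
      (\<integral>\<^sup>+x. h (sph p n x) * g (lp_norm p n x) * indicator {x \<in> space (leb n). 0 < lp_norm p n x \<and> sph p n x \<in> A} x \<partial>leb n)
    = cone_weight p n h A *
      (\<integral>\<^sup>+x. h (sph p n x) * g (lp_norm p n x) * indicator {x \<in> space (leb n). 0 < lp_norm p n x} x \<partial>leb n)"
proof -
  let ?S = "space (leb n)" and ?k = "cone_weight p n h"
  let ?V = "\<lambda>A. {x \<in> space (leb n). 0 < lp_norm p n x \<and> sph p n x \<in> A}"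
  define D where "D A = distr (density (leb n) (\<lambda>x. h (sph p n x) * indicator (?V A) x)) borel (lp_norm p n)" for A
  have D: "emeasure (D A) {..t} = (if 0 < t then ennreal (t ^ n) * ?k A else 0)"
    if [measurable]: "A \<in> sets (leb n)" for A t
  proof -
    have "emeasure (D A) {..t} = (\<integral>\<^sup>+x. h (sph p n x) * indicator {x \<in> space (leb n). 0 < lp_norm p n x \<and> lp_norm p n x \<le> t \<and> sph p n x \<in> A} x \<partial>leb n)"
      unfolding D_def
      by (subst emeasure_distr, measurable, subst emeasure_density, measurable)
         (auto intro!: nn_integral_cong simp: indicator_def)
    also have "\<dots> = (if 0 < t then ennreal (t ^ n) * ?k A else 0)"
    proof (cases "0 < t")
      case True then show ?thesis using p by (simp add: cone_weight_scale)
    next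
      case False
      then have e: "{x \<in> space (leb n). 0 < lp_norm p n x \<and> lp_norm p n x \<le> t \<and> sph p n x \<in> A} = {}" by auto
      show ?thesis unfolding e using False by simp
    qed
    finally show ?thesis .
  qed
  have kA: "?k A < \<infinity>"
  proof -
    have "?k A \<le> ?k ?S" unfolding cone_weight_def by (intro nn_integral_mono) (auto simp: indicator_def)
    then show ?thesis using fin by (rule le_less_trans)
  qed
  \<comment> \<open>Proportionality is put in cross-multiplied form, which avoids division by a
    total weight that may be 0.\<close>
  have eq: "scale_measure (?k ?S) (D A) = scale_measure (?k A) (D ?S)"
  proof (rule measure_eqI_generator_eq[where E = "range (\<lambda>t. {..t})" and \<Omega> = UNIV and A = "\<lambda>i::nat. {..real i}"])
    show "Int_stable (range (\<lambda>t::real. {..t}))" by (auto simp: Int_stable_def)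
    show "emeasure (scale_measure (?k ?S) (D A)) X = emeasure (scale_measure (?k A) (D ?S)) X" if "X \<in> range (\<lambda>t. {..t})" for X
      using that A by (auto simp: D mult_ac)
    have "sets (borel :: real measure) = sigma_sets UNIV (range (\<lambda>t. {..t}))"
      by (subst borel_eq_atMost) simp
    then show "sets (scale_measure (?k ?S) (D A)) = sigma_sets UNIV (range (\<lambda>t. {..t}))"
      "sets (scale_measure (?k A) (D ?S)) = sigma_sets UNIV (range (\<lambda>t. {..t}))" by (simp_all add: D_def)
    show "(\<Union>i. {..real i}) = UNIV" using real_arch_simple by auto
    show "emeasure (scale_measure (?k ?S) (D A)) {..real i} \<noteq> \<infinity>" for i
      using A fin kA by (auto simp: D ennreal_mult_eq_top_iff)
  qed auto
  have int: "(\<integral>\<^sup>+t. g t \<partial>D A) = (\<integral>\<^sup>+x. h (sph p n x) * g (lp_norm p n x) * indicator (?V A) x \<partial>leb n)"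
    if [measurable]: "A \<in> sets (leb n)" for A
  proof -
    have "(\<integral>\<^sup>+t. g t \<partial>D A) = (\<integral>\<^sup>+x. g (lp_norm p n x) \<partial>density (leb n) (\<lambda>x. h (sph p n x) * indicator (?V A) x))"
      unfolding D_def by (rule nn_integral_distr) (use g measurable_lp_norm in simp_all)
    also have "\<dots> = (\<integral>\<^sup>+x. h (sph p n x) * indicator (?V A) x * g (lp_norm p n x) \<partial>leb n)"
      by (rule nn_integral_density) measurable
    finally show ?thesis by (simp add: mult_ac)
  qed
  have "?k ?S * (\<integral>\<^sup>+t. g t \<partial>D A) = ?k A * (\<integral>\<^sup>+t. g t \<partial>D ?S)"
    using arg_cong[OF eq, of "\<lambda>M. \<integral>\<^sup>+t. g t \<partial>M"] by (simp add: nn_integral_scale_measure D_def)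
  then show ?thesis by (simp add: int)
qed

section \<open>Vectors of independent p-Gaussians in polar coordinates\<close>

definition gauss_vec :: "real \<Rightarrow> nat \<Rightarrow> (nat \<Rightarrow> real) measure" where
  "gauss_vec p n = (\<Pi>\<^sub>M i\<in>{..<n}. p_gaussian p)"

lemma sets_gauss_vec [measurable_cong, simp]: "sets (gauss_vec p n) = sets (leb n)"
  unfolding gauss_vec_def leb_def by (rule sets_PiM_cong) simp_all

lemma space_gauss_vec [simp]: "space (gauss_vec p n) = space (leb n)"
  by (rule sets_eq_imp_space_eq) simp

lemma prob_space_gauss_vec: "1 \<le> p \<Longrightarrow> prob_space (gauss_vec p n)"
  unfolding gauss_vec_def by (intro prob_space_PiM prob_space_p_gaussian)

lemma lp_norm_powr: "0 < p \<Longrightarrow> lp_norm p n x powr p = (\<Sum>i<n. \<bar>x i\<bar> powr p)"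
  by (simp add: lp_norm_def powr_powr sum_nonneg)

text \<open>The product density is a function of the p-norm alone, so direction and norm
  separate.\<close>

lemma gauss_vec_density:
  assumes p: "1 \<le> p"
  shows "gauss_vec p n = density (leb n) (\<lambda>x. ennreal (pg_const p ^ n * exp (- (lp_norm p n x powr p) / p)))"
proof -
  interpret P: product_prob_space "\<lambda>_. p_gaussian p"
    by (intro product_prob_spaceI prob_space_p_gaussian p)
  have eq: "(\<Prod>i<n. ennreal (pg_density p (x i))) = ennreal (pg_const p ^ n * exp (- (lp_norm p n x powr p) / p))" for x
    using pg_density_pos[OF p] p
    by (simp add: prod_ennreal less_imp_le lp_norm_powr)
       (simp add: pg_density_def prod.distrib exp_sum[symmetric] sum_negf sum_divide_distrib)
  have "density (leb n) (\<lambda>x. \<Prod>i<n. ennreal (pg_density p (x i))) = (\<Pi>\<^sub>M i\<in>{..<n}. p_gaussian p)"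
  proof (rule P.PiM_eqI)
    fix A :: "nat \<Rightarrow> real set" assume A: "\<And>i. i \<in> {..<n} \<Longrightarrow> A i \<in> sets (p_gaussian p)"
    have PA: "Pi\<^sub>E {..<n} A \<in> sets (leb n)" using A by (intro sets_leb_PiE) auto
    have "emeasure (density (leb n) (\<lambda>x. \<Prod>i<n. ennreal (pg_density p (x i)))) (Pi\<^sub>E {..<n} A)
      = (\<integral>\<^sup>+x. (\<Prod>i<n. ennreal (pg_density p (x i))) * indicator (Pi\<^sub>E {..<n} A) x \<partial>leb n)"
      using PA by (subst emeasure_density) auto
    also have "\<dots> = (\<integral>\<^sup>+x. (\<Prod>i<n. ennreal (pg_density p (x i)) * indicator (A i) (x i)) \<partial>leb n)"
    proof (intro nn_integral_cong)
      fix x assume x: "x \<in> space (leb n)"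
      have "indicator (Pi\<^sub>E {..<n} A) x = (\<Prod>i<n. indicator (A i) (x i) :: ennreal)"
      proof (cases "x \<in> Pi\<^sub>E {..<n} A")
        case True then show ?thesis by (auto simp: PiE_def Pi_def)
      next
        case False
        then obtain i where "i < n" "x i \<notin> A i" using x by (auto simp: space_leb PiE_def Pi_def)
        then have "(\<Prod>i<n. indicator (A i) (x i) :: ennreal) = 0" by (intro prod_zero bexI[of _ i]) auto
        then show ?thesis using False by simp
      qed
      then show "(\<Prod>i<n. ennreal (pg_density p (x i))) * indicator (Pi\<^sub>E {..<n} A) x = (\<Prod>i<n. ennreal (pg_density p (x i)) * indicator (A i) (x i))"
        by (simp add: prod.distrib)
    qed
    also have "\<dots> = (\<Prod>i<n. \<integral>\<^sup>+t. ennreal (pg_density p t) * indicator (A i) t \<partial>lborel)"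
      unfolding leb_def using A by (intro lborel_product.product_nn_integral_prod) auto
    also have "\<dots> = (\<Prod>i<n. emeasure (p_gaussian p) (A i))"
      using A by (intro prod.cong refl) (simp add: p_gaussian_density emeasure_density)
    finally show "emeasure (density (leb n) (\<lambda>x. \<Prod>i<n. ennreal (pg_density p (x i)))) (Pi\<^sub>E {..<n} A) = (\<Prod>i<n. emeasure (p_gaussian p) (A i))" .
  qed (auto simp: leb_def cong: sets_PiM_cong)
  then show ?thesis by (simp add: gauss_vec_def eq)
qed

lemma AE_lp_norm_pos:
  assumes "0 < n" shows "AE x in leb n. 0 < lp_norm p n x"
proof (rule AE_I)
  show "{x \<in> space (leb n). \<not> 0 < lp_norm p n x} \<subseteq> {x \<in> space (leb n). x 0 = 0}"
  proof safe
    fix x assume "\<not> 0 < lp_norm p n x"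
    then have "(\<Sum>i<n. \<bar>x i\<bar> powr p) = 0"
      by (metis lp_norm_def lp_norm_nonneg not_less order_antisym powr_eq_0_iff)
    then have "\<bar>x 0\<bar> powr p = 0" using assms by (simp add: sum_nonneg_eq_0_iff)
    then show "x 0 = 0" by simp
  qed
  show "emeasure (leb n) {x \<in> space (leb n). x 0 = 0} = 0" using assms by (rule emeasure_leb_coord_zero)
  show "{x \<in> space (leb n). x 0 = 0} \<in> sets (leb n)" using assms by (rule sets_leb_coord)
qed

definition scale_inv :: "nat \<Rightarrow> (nat \<Rightarrow> real) set \<Rightarrow> bool" where
  "scale_inv n B \<longleftrightarrow> (\<forall>r>0. \<forall>x\<in>space (leb n). scale_vec n r x \<in> B \<longleftrightarrow> x \<in> B)"

lemma scale_inv_sph: "scale_inv n B \<Longrightarrow> x \<in> space (leb n) \<Longrightarrow> 0 < lp_norm p n x \<Longrightarrow> sph p n x \<in> B \<longleftrightarrow> x \<in> B"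
  by (simp add: scale_inv_def sph_def)

text \<open>This is \<open>polar_proportional\<close> with the Gaussian density absorbed into the
  radial factor; scale invariance turns the condition on the direction into
  \<open>x \<in> B\<close>. The free factor \<open>g\<close> serves to restore the homogeneity of
  the gradient norm.\<close>

lemma cone_weight_gauss:
  assumes p: "1 \<le> p" and n: "0 < n" and h[measurable]: "h \<in> borel_measurable (leb n)"
    and fin: "cone_weight p n h (space (leb n)) < \<infinity>"
    and B[measurable]: "B \<in> sets (leb n)" and inv: "scale_inv n B" and g[measurable]: "g \<in> borel_measurable borel"
  shows "cone_weight p n h (space (leb n)) * (\<integral>\<^sup>+x. h (sph p n x) * g (lp_norm p n x) * indicator B x \<partial>gauss_vec p n)
    = cone_weight p n h B * (\<integral>\<^sup>+x. h (sph p n x) * g (lp_norm p n x) \<partial>gauss_vec p n)"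
proof -
  let ?f = "\<lambda>t. ennreal (pg_const p ^ n * exp (- (t powr p) / p))"
  let ?V = "\<lambda>A. {x \<in> space (leb n). 0 < lp_norm p n x \<and> sph p n x \<in> A}"
  have p0: "0 < p" using p by simp
  have *: "(\<integral>\<^sup>+x. h (sph p n x) * g (lp_norm p n x) * indicator A x \<partial>gauss_vec p n)
    = (\<integral>\<^sup>+x. h (sph p n x) * (g (lp_norm p n x) * ?f (lp_norm p n x)) * indicator (?V A) x \<partial>leb n)"
    if [measurable]: "A \<in> sets (leb n)" and inv: "scale_inv n A" for A
    unfolding gauss_vec_density[OF p]
  proof (subst nn_integral_density, measurable, intro nn_integral_cong_AE)
    show "AE x in leb n. ?f (lp_norm p n x) * (h (sph p n x) * g (lp_norm p n x) * indicator A x) =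
        h (sph p n x) * (g (lp_norm p n x) * ?f (lp_norm p n x)) * indicator (?V A) x"
      using AE_lp_norm_pos[OF n, of p] AE_space
    proof eventually_elim
      fix x assume "0 < lp_norm p n x" "x \<in> space (leb n)"
      then show "?f (lp_norm p n x) * (h (sph p n x) * g (lp_norm p n x) * indicator A x) =
        h (sph p n x) * (g (lp_norm p n x) * ?f (lp_norm p n x)) * indicator (?V A) x"
        using scale_inv_sph[OF inv] by (simp add: indicator_def mult_ac)
    qed
  qed
  have S: "scale_inv n (space (leb n))" by (simp add: scale_inv_def)
  have **: "(\<integral>\<^sup>+x. h (sph p n x) * g (lp_norm p n x) \<partial>gauss_vec p n) = (\<integral>\<^sup>+x. h (sph p n x) * g (lp_norm p n x) * indicator (space (leb n)) x \<partial>gauss_vec p n)"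
    by (intro nn_integral_cong) simp
  have g': "(\<lambda>t. g t * ?f t) \<in> borel_measurable borel" by measurable
  show ?thesis
    unfolding ** *[OF B inv] *[OF sets.top S]
    using polar_proportional[OF h B g' p0 fin] by simp
qed

section \<open>The cone measure and the radial laws\<close>

lemma lp_ball_finite: "0 < p \<Longrightarrow> emeasure (leb n) (lp_ball p n) < \<infinity>"
proof -
  assume p: "0 < p"
  have "lp_ball p n \<subseteq> Pi\<^sub>E {..<n} (\<lambda>_. {-1..1})"
  proof
    fix x assume x: "x \<in> lp_ball p n"
    have "x i \<in> {-1..1}" if "i < n" for i
    proof -
      have "\<bar>x i\<bar> powr p \<le> (\<Sum>i<n. \<bar>x i\<bar> powr p)" using that by (intro member_le_sum) auto
      also have "\<dots> = lp_norm p n x powr p" using p by (simp add: lp_norm_powr)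
      also have "\<dots> \<le> 1 powr p" using x p by (intro powr_mono2) (auto simp: lp_ball_def)
      finally have "\<bar>x i\<bar> \<le> 1" using p by (meson abs_ge_zero not_le powr_less_mono2 zero_le_one)
      then show ?thesis by (simp add: abs_le_iff)
    qed
    then show "x \<in> Pi\<^sub>E {..<n} (\<lambda>_. {-1..1})" using x by (auto simp: lp_ball_def space_leb PiE_def)
  qed
  then have "emeasure (leb n) (lp_ball p n) \<le> emeasure (leb n) (Pi\<^sub>E {..<n} (\<lambda>_. {-1..1}))"
    by (rule emeasure_mono) (auto intro: sets_leb_PiE)
  also have "\<dots> = (\<Prod>i<n. emeasure lborel {-1..1::real})" by (rule emeasure_leb_PiE) auto
  also have "\<dots> < \<infinity>" by (simp add: power_less_top_ennreal)
  finally show ?thesis .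
qed

lemma cone_weight_1_ball:
  assumes "0 < n" shows "cone_weight p n (\<lambda>_. 1) (space (leb n)) = emeasure (leb n) (lp_ball p n)"
proof -
  have [measurable]: "lp_ball p n \<in> sets (leb n)" unfolding lp_ball_def by measurable
  have "emeasure (leb n) (lp_ball p n) = (\<integral>\<^sup>+x. indicator (lp_ball p n) x \<partial>leb n)" by simp
  also have "\<dots> = cone_weight p n (\<lambda>_. 1) (space (leb n))"
    unfolding cone_weight_def
    by (intro nn_integral_cong_AE eventually_mono[OF eventually_conj[OF AE_lp_norm_pos[OF assms, of p] AE_space]])
       (auto simp: indicator_def lp_ball_def)
  finally show ?thesis ..
qed

text \<open>If the ball were null, so would be its dilates, which exhaust the space up to the null
  set where the norm vanishes.\<close>

lemma lp_ball_pos: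
  assumes n: "0 < n" and p: "0 < p" shows "emeasure (leb n) (lp_ball p n) \<noteq> 0"
proof
  assume "emeasure (leb n) (lp_ball p n) = 0"
  then have 0: "cone_weight p n (\<lambda>_. 1) (space (leb n)) = 0" using cone_weight_1_ball[OF n] by simp
  let ?B = "\<lambda>t. {x \<in> space (leb n). 0 < lp_norm p n x \<and> lp_norm p n x \<le> t}"
  have "emeasure (leb n) (?B t) = 0" if "0 < t" for t
    using cone_weight_scale[of "\<lambda>_. 1" n "space (leb n)" t p] that p 0 by simp
  then have "emeasure (leb n) (\<Union>k::nat. ?B (real k + 1)) = 0"
    by (intro emeasure_UN_eq_0) auto
  moreover have "(\<Union>k::nat. ?B (real k + 1)) = {x \<in> space (leb n). 0 < lp_norm p n x}"
  proof (intro subset_antisym subsetI)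
    fix x assume x: "x \<in> {x \<in> space (leb n). 0 < lp_norm p n x}"
    obtain k :: nat where "lp_norm p n x \<le> real k" using real_arch_simple by blast
    then have "x \<in> ?B (real k + 1)" using x by simp
    then show "x \<in> (\<Union>k::nat. ?B (real k + 1))" by blast
  qed auto
  ultimately have "AE x in leb n. \<not> 0 < lp_norm p n x"
    by (intro AE_I[where N = "{x \<in> space (leb n). 0 < lp_norm p n x}"]) auto
  with AE_lp_norm_pos[OF n, of p] have "AE x in leb n. False" by eventually_elim simp
  then have "(\<integral>\<^sup>+x. 1 \<partial>leb n) = (\<integral>\<^sup>+x. 0 \<partial>leb n)" by (intro nn_integral_cong_AE) (rule eventually_mono, auto)
  then have "emeasure (leb n) (space (leb n)) = 0" by simp
  moreover have "emeasure (leb n) (Pi\<^sub>E {..<n} (\<lambda>_. {0..1})) \<le> emeasure (leb n) (space (leb n))"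
    by (rule emeasure_space)
  moreover have "emeasure (leb n) (Pi\<^sub>E {..<n} (\<lambda>_. {0..1})) = 1"
    by (subst emeasure_leb_PiE) auto
  ultimately show False by simp
qed

definition normalized_cone :: "real \<Rightarrow> nat \<Rightarrow> (nat \<Rightarrow> real) measure" where
  "normalized_cone p n = scale_measure (1 / emeasure (leb n) (lp_ball p n))
     (distr (density (leb n) (indicator {x \<in> space (leb n). 0 < lp_norm p n x \<and> lp_norm p n x \<le> 1})) (leb n) (sph p n))"

lemma emeasure_normalized_cone:
  assumes [measurable]: "A \<in> sets (leb n)"
  shows "emeasure (normalized_cone p n) A = cone_weight p n (\<lambda>_. 1) A / emeasure (leb n) (lp_ball p n)"
proof -
  have "emeasure (distr (density (leb n) (indicator {x \<in> space (leb n). 0 < lp_norm p n x \<and> lp_norm p n x \<le> 1})) (leb n) (sph p n)) A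
    = cone_weight p n (\<lambda>_. 1) A"
    unfolding cone_weight_def
    by (subst emeasure_distr, measurable, subst emeasure_density, measurable)
       (auto intro!: nn_integral_cong simp: indicator_def)
  then show ?thesis
    by (simp add: normalized_cone_def divide_ennreal_def mult.commute)
qed

lemma emeasure_cone:
  assumes A[measurable]: "A \<in> sets (leb n)" and n: "0 < n" and p: "0 < p"
  shows "emeasure (leb n) (cone n (A \<inter> lp_sphere p n)) = cone_weight p n (\<lambda>_. 1) A"
proof -
  define V where "V = {x \<in> space (leb n). 0 < lp_norm p n x \<and> lp_norm p n x \<le> 1 \<and> sph p n x \<in> A}"
  have V[measurable]: "V \<in> sets (leb n)" unfolding V_def by measurable
  let ?C = "cone n (A \<inter> lp_sphere p n)" and ?z = "scale_vec n 0 (\<lambda>_. 0) :: nat \<Rightarrow> real"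
  have VC: "V \<subseteq> ?C"
  proof
    fix x assume x: "x \<in> V"
    then have "x = scale_vec n (lp_norm p n x) (sph p n x)" "sph p n x \<in> A \<inter> lp_sphere p n"
      using p by (auto simp: V_def scale_vec_sph sph_in_sphere)
    moreover have "lp_norm p n x \<in> {0..1}" using x by (auto simp: V_def)
    ultimately show "x \<in> ?C" unfolding cone_def by blast
  qed
  have CV: "?C \<subseteq> insert ?z V"
  proof
    fix x assume "x \<in> ?C"
    then obtain r a where r: "x = scale_vec n r a" "0 \<le> r" "r \<le> 1" "a \<in> A" "a \<in> lp_sphere p n" by (auto simp: cone_def)
    show "x \<in> insert ?z V"
    proof (cases "r = 0")
      case True then show ?thesis using r by (simp add: scale_vec_def)
    next
      case False
      then show ?thesis using r p by (simp add: V_def lp_norm_scale sph_scale sph_on_sphere) (simp add: lp_sphere_def)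
    qed
  qed
  have z: "{?z} \<subseteq> {x \<in> space (leb n). x 0 = 0}" using n by (auto simp: scale_vec_apply)
  have zs: "{?z} \<in> sets (leb n)"
  proof -
    have "{?z} = Pi\<^sub>E {..<n} (\<lambda>_. {0})" by (auto simp: scale_vec_def PiE_def extensional_def fun_eq_iff Pi_def)
    then show ?thesis by (metis sets_leb_PiE borel_singleton sets.empty_sets)
  qed
  have z0: "emeasure (leb n) {?z} = 0"
    using emeasure_mono[OF z sets_leb_coord[OF n]] emeasure_leb_coord_zero[OF n] by simp
  \<comment> \<open>The origin belongs to the cone unless the base is empty. In either case the cone
    is one of two measurable sets of equal volume.\<close>
  have "?C = V \<or> ?C = insert ?z V" using VC CV by auto
  moreover have "emeasure (leb n) (insert ?z V) = emeasure (leb n) V"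
    using emeasure_Un_null_set[of V "leb n" "{?z}"] zs z0 by (auto simp: null_sets_def)
  ultimately have "emeasure (leb n) ?C = emeasure (leb n) V" by auto
  also have "\<dots> = cone_weight p n (\<lambda>_. 1) A" unfolding cone_weight_def V_def[symmetric] by simp
  finally show ?thesis .
qed

text \<open>\<open>measure_of\<close> returns the prescribed values only if they form a measure;
  their agreement with a push-forward certifies this.\<close>

lemma cone_measure_eq: "0 < n \<Longrightarrow> 0 < p \<Longrightarrow> cone_measure p n = normalized_cone p n"
proof -
  assume n: "0 < n" and p: "0 < p"
  have "cone_measure p n = measure_of (space (leb n)) (sets (leb n)) (emeasure (normalized_cone p n))"
    unfolding cone_measure_def
    by (rule measure_of_eq) (auto simp: sets.space_closed emeasure_cone n p emeasure_normalized_cone sets.sigma_sets_eq)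
  also have "\<dots> = normalized_cone p n"
    using measure_of_of_measure[of "normalized_cone p n"] by (simp add: normalized_cone_def space_scale_measure)
  finally show ?thesis .
qed

lemma emeasure_cone_measure_inv:
  assumes p: "1 \<le> p" and n: "0 < n" and B: "B \<in> sets (leb n)" and inv: "scale_inv n B"
  shows "emeasure (cone_measure p n) B = emeasure (gauss_vec p n) B"
proof -
  interpret G: prob_space "gauss_vec p n" by (rule prob_space_gauss_vec[OF p])
  let ?b = "emeasure (leb n) (lp_ball p n)"
  have b: "?b \<noteq> 0" "?b < \<infinity>" using lp_ball_pos[OF n, of p] lp_ball_finite[of p n] p by auto
  have "?b * emeasure (gauss_vec p n) B = cone_weight p n (\<lambda>_. 1) B"
    using cone_weight_gauss[OF p n, of "\<lambda>_. 1" B "\<lambda>_. 1"] b B inv G.emeasure_space_1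
    by (simp add: cone_weight_1_ball[OF n])
  then have "cone_weight p n (\<lambda>_. 1) B / ?b = emeasure (gauss_vec p n) B"
    using b by (metis infinity_ennreal_def less_irrefl mult.commute mult_divide_eq_ennreal)
  then show ?thesis using B n p by (simp add: cone_measure_eq emeasure_normalized_cone)
qed

text \<open>By Fubini: for each fixed positive radius the scaling does not affect membership in
  \<open>B\<close>, so the inner integral is the cone measure of \<open>B\<close> whatever the law
  of the radius.\<close>

lemma radial_law_inv:
  assumes p: "1 \<le> p" and n: "0 < n" and B[measurable]: "B \<in> sets (leb n)" and inv: "scale_inv n B"
    and N: "prob_space N" and R[measurable]: "R \<in> borel_measurable N" and pos: "AE \<omega> in N. 0 < R \<omega>"
  shows "emeasure (radial_law p n N R) B = emeasure (gauss_vec p n) B"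
proof -
  interpret N: prob_space N by (rule N)
  interpret G: prob_space "gauss_vec p n" by (rule prob_space_gauss_vec[OF p])
  let ?C = "cone_measure p n"
  have sC[measurable_cong]: "sets ?C = sets (leb n)" by (simp add: cone_measure_def sets.sigma_sets_eq sets.space_closed)
  have spC: "space ?C = space (leb n)" using sC by (rule sets_eq_imp_space_eq)
  have "scale_inv n (space (leb n))" by (simp add: scale_inv_def)
  then have "emeasure ?C (space ?C) = 1"
    using emeasure_cone_measure_inv[OF p n sets.top] G.emeasure_space_1 by (simp add: spC)
  then interpret C: prob_space ?C by (rule prob_spaceI)
  let ?f = "\<lambda>(\<omega>, \<theta>). scale_vec n (R \<omega>) \<theta>"
  have f: "?f \<in> measurable (N \<Otimes>\<^sub>M ?C) (leb n)" by measurable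
  have "emeasure (radial_law p n N R) B = emeasure (N \<Otimes>\<^sub>M ?C) (?f -` B \<inter> space (N \<Otimes>\<^sub>M ?C))"
    unfolding radial_law_def by (rule emeasure_distr[OF f B])
  also have "\<dots> = (\<integral>\<^sup>+\<omega>. \<integral>\<^sup>+\<theta>. indicator (?f -` B \<inter> space (N \<Otimes>\<^sub>M ?C)) (\<omega>, \<theta>) \<partial>?C \<partial>N)"
    by (rule C.emeasure_pair_measure) (rule measurable_sets[OF f B])
  also have "\<dots> = (\<integral>\<^sup>+\<omega>. emeasure ?C B \<partial>N)"
  proof (rule nn_integral_cong_AE)
    show "AE \<omega> in N. (\<integral>\<^sup>+\<theta>. indicator (?f -` B \<inter> space (N \<Otimes>\<^sub>M ?C)) (\<omega>, \<theta>) \<partial>?C) = emeasure ?C B"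
      using pos AE_space
    proof eventually_elim
      fix \<omega> assume \<omega>: "0 < R \<omega>" "\<omega> \<in> space N"
      have "(\<integral>\<^sup>+\<theta>. indicator (?f -` B \<inter> space (N \<Otimes>\<^sub>M ?C)) (\<omega>, \<theta>) \<partial>?C) = (\<integral>\<^sup>+\<theta>. indicator B \<theta> \<partial>?C)"
        using \<omega> inv by (intro nn_integral_cong) (auto simp: indicator_def space_pair_measure spC scale_inv_def)
      then show "(\<integral>\<^sup>+\<theta>. indicator (?f -` B \<inter> space (N \<Otimes>\<^sub>M ?C)) (\<omega>, \<theta>) \<partial>?C) = emeasure ?C B" by simp
    qed
  qed
  also have "\<dots> = emeasure ?C B" by (simp add: N.emeasure_space_1)
  finally show ?thesis using emeasure_cone_measure_inv[OF p n B inv] by simp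
qed

text \<open>If the set function in the definition of the surface measure were not a measure, or if its normalizing
  constant were zero or infinite, the surface measure would have total mass zero.\<close>

lemma surface_measure_props:
  assumes total: "emeasure (surface_measure p n) (space (leb n)) = 1"
  defines "H \<equiv> \<lambda>A. hausdorff (euclid_dist n) (n - 1) (A \<inter> lp_sphere p n)"
  shows "\<And>A. A \<in> sets (leb n) \<Longrightarrow> emeasure (surface_measure p n) A = H A / H (lp_sphere p n)"
    and "H (lp_sphere p n) \<noteq> 0" and "H (lp_sphere p n) \<noteq> \<infinity>"
proof -
  let ?\<mu> = "\<lambda>A. H A / H (lp_sphere p n)"
  have S: "H (lp_sphere p n) = hausdorff (euclid_dist n) (n - 1) (lp_sphere p n)" by (simp add: H_def)
  have conv: "emeasure (surface_measure p n) A = (if A \<in> sets (leb n) \<and> measure_space (space (leb n)) (sets (leb n)) ?\<mu> then ?\<mu> A else 0)" for A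
    unfolding surface_measure_def S by (subst emeasure_measure_of_conv) (simp add: sets.space_closed sets.sigma_sets_eq H_def)
  have "measure_space (space (leb n)) (sets (leb n)) ?\<mu>"
    using total unfolding conv[of "space (leb n)"] by (rule contrapos_pp) simp
  then show 1: "emeasure (surface_measure p n) A = ?\<mu> A" if "A \<in> sets (leb n)" for A
    using that by (simp add: conv)
  have "space (leb n) \<inter> lp_sphere p n = lp_sphere p n" by (auto simp: lp_sphere_def)
  then have "H (space (leb n)) = H (lp_sphere p n)" by (simp add: H_def)
  then have "H (lp_sphere p n) / H (lp_sphere p n) = 1" using 1[OF sets.top] total by simp
  then show "H (lp_sphere p n) \<noteq> 0" "H (lp_sphere p n) \<noteq> \<infinity>" by auto
qed

text \<open>The surface probability is the Gaussian probability reweighted by the gradient norm. It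
  is stated as a product, so that the Gaussian mean of the gradient norm can be treated
  separately.\<close>

lemma surface_measure_inv:
  assumes p: "1 \<le> p" and n: "0 < n" and total: "emeasure (surface_measure p n) (space (leb n)) = 1"
    and B: "B \<in> sets (leb n)" and inv: "scale_inv n B"
  shows "emeasure (surface_measure p n) B * (\<integral>\<^sup>+x. ennreal (grad_norm p n x) \<partial>gauss_vec p n)
    = (\<integral>\<^sup>+x. ennreal (grad_norm p n x) * indicator B x \<partial>gauss_vec p n)"
proof -
  obtain d where d: "n = Suc d" using n by (cases n) auto
  define H where "H A = hausdorff (euclid_dist n) d (A \<inter> lp_sphere p n)" for A
  let ?\<sigma> = "surface_measure p n" and ?S = "lp_sphere p n"
  have \<sigma>: "\<And>A. A \<in> sets (leb n) \<Longrightarrow> emeasure ?\<sigma> A = H A / H ?S" and HS: "H ?S \<noteq> 0" "H ?S \<noteq> \<infinity>"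
    using surface_measure_props[OF total] by (simp_all add: H_def d)
  have s\<sigma>: "sets ?\<sigma> = sets (leb n)" by (simp add: surface_measure_def sets.sigma_sets_eq sets.space_closed)
  \<comment> \<open>Undoing the normalization gives the Hausdorff measure on the sphere as a finite
    measure, to which \<open>hausdorff_sphere_eq_weighted_cone\<close> applies.\<close>
  define \<nu> where "\<nu> = scale_measure (H ?S) ?\<sigma>"
  have \<nu>: "emeasure \<nu> A = H A" if "A \<in> sets (leb n)" for A
  proof -
    have "emeasure \<nu> A = H ?S * (H A / H ?S)" using that by (simp add: \<nu>_def \<sigma>)
    also have "\<dots> = H A" using HS by (simp add: ennreal_times_divide mult.commute[of "H ?S"] mult_divide_eq_ennreal)
    finally show ?thesis .
  qed
  have s\<nu>: "sets \<nu> = sets (leb n)" by (simp add: \<nu>_def s\<sigma>)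
  have sp\<nu>: "space \<nu> = space (leb n)" using s\<nu> by (rule sets_eq_imp_space_eq)
  have HS': "H (space (leb n)) = H ?S" unfolding H_def by (rule arg_cong[where f = "hausdorff _ _"]) (auto simp: lp_sphere_def)
  have fin: "finite_measure \<nu>" by standard (use HS \<nu>[OF sets.top] HS' in \<open>simp add: sp\<nu>\<close>)
  let ?K = "haus_const d * of_nat n" and ?h = "\<lambda>x. ennreal (grad_norm p n x)"
  have HW: "H A = ?K * cone_weight p n ?h A" if A: "A \<in> sets (leb n)" for A
  proof -
    have "emeasure \<nu> A = ?K * emeasure (weighted_cone p n) A"
      unfolding d
      by (rule hausdorff_sphere_eq_weighted_cone[OF p fin]) (use s\<nu> \<nu> A in \<open>auto simp: d H_def\<close>)
    then show ?thesis by (simp add: \<nu>[OF A] emeasure_weighted_cone[OF A] cone_weight_def)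
  qed
  let ?kS = "cone_weight p n ?h (space (leb n))"
  have K: "?K * ?kS = H ?S" using HW[OF sets.top] HS' by simp
  \<comment> \<open>Finiteness of the weighted cone volume, as required by
    \<open>cone_weight_gauss\<close>, is read off from the finite nonzero value of the
    product.\<close>
  then have kS: "?kS \<noteq> 0" "?kS < \<infinity>" "?K \<noteq> 0"
  proof -
    have *: "b \<noteq> 0 \<and> b < \<infinity> \<and> a \<noteq> 0" if "a * b = c" "c \<noteq> 0" "c \<noteq> \<infinity>" for a b c :: ennreal
      using that by (auto simp: less_top[symmetric] ennreal_mult_eq_top_iff)
    show "?kS \<noteq> 0" "?kS < \<infinity>" "?K \<noteq> 0" using *[OF K HS] by simp_all
  qed
  have Kf: "?K \<noteq> \<infinity>" using haus_const_finite[of d] by (auto simp: ennreal_mult_eq_top_iff)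
  have p0: "0 < p" using p by simp
  \<comment> \<open>The gradient norm is homogeneous of degree \<open>p - 1\<close>; this radial
    factor turns its value at the projected point into the value at \<open>x\<close>.\<close>
  let ?g = "\<lambda>t::real. ennreal (t powr (p - 1))"
  have hg: "?h (sph p n x) * ?g (lp_norm p n x) = ?h x" if "x \<in> space (leb n)" "0 < lp_norm p n x" for x
  proof -
    let ?N = "lp_norm p n x"
    have "(\<Sum>i<n. (\<bar>x i\<bar> powr (p - 1))\<^sup>2) = (\<Sum>i<n. (?N powr (p - 1))\<^sup>2 * (\<bar>sph p n x i\<bar> powr (p - 1))\<^sup>2)"
      using that by (intro sum.cong refl)
        (simp add: sph_def scale_vec_apply abs_mult powr_mult powr_divide power_mult_distrib power_divide)
    then have "grad_norm p n x = grad_norm p n (sph p n x) * ?N powr (p - 1)"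
      by (simp add: grad_norm_def sum_distrib_left[symmetric] real_sqrt_mult)
    then show ?thesis by (simp add: ennreal_mult)
  qed
  have AEpos: "AE x in gauss_vec p n. 0 < lp_norm p n x"
    unfolding gauss_vec_density[OF p] using AE_lp_norm_pos[OF n, of p] by (subst AE_density) auto
  have i1: "(\<integral>\<^sup>+x. ?h (sph p n x) * ?g (lp_norm p n x) * f x \<partial>gauss_vec p n) = (\<integral>\<^sup>+x. ?h x * f x \<partial>gauss_vec p n)" for f
    by (intro nn_integral_cong_AE eventually_mono[OF eventually_conj[OF AEpos AE_space]]) (simp add: hg)
  have "?kS * (\<integral>\<^sup>+x. ?h x * indicator B x \<partial>gauss_vec p n) = cone_weight p n ?h B * (\<integral>\<^sup>+x. ?h x \<partial>gauss_vec p n)"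
    using cone_weight_gauss[OF p n, of ?h B ?g] kS B inv i1[of "indicator B"] i1[of "\<lambda>_. 1"] by simp
  then have "(?K * ?kS) * (\<integral>\<^sup>+x. ?h x * indicator B x \<partial>gauss_vec p n) = (?K * cone_weight p n ?h B) * (\<integral>\<^sup>+x. ?h x \<partial>gauss_vec p n)"
    by (simp only: mult.assoc)
  then have "H ?S * (\<integral>\<^sup>+x. ?h x * indicator B x \<partial>gauss_vec p n) = H B * (\<integral>\<^sup>+x. ?h x \<partial>gauss_vec p n)"
    unfolding K HW[OF B, symmetric] .
  then have "(H ?S * (\<integral>\<^sup>+x. ?h x * indicator B x \<partial>gauss_vec p n)) / H ?S = (H B * (\<integral>\<^sup>+x. ?h x \<partial>gauss_vec p n)) / H ?S" by simp
  then have "(\<integral>\<^sup>+x. ?h x * indicator B x \<partial>gauss_vec p n) = (H B / H ?S) * (\<integral>\<^sup>+x. ?h x \<partial>gauss_vec p n)"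
    using HS by (simp add: mult.commute[of "H ?S"] mult_divide_eq_ennreal) (simp add: divide_ennreal_def mult_ac)
  then show ?thesis by (simp add: \<sigma>[OF B])
qed

section \<open>The Gaussian limit\<close>

text \<open>One infinite product carries the Gaussian vectors of all dimensions, so that the central
  limit theorem applies to a single sequence.\<close>

definition gauss_seq :: "real \<Rightarrow> (nat \<Rightarrow> real) measure" where
  "gauss_seq p = (\<Pi>\<^sub>M i\<in>UNIV. p_gaussian p)"

lemma sym_mean_elem_sym:
  "sym_mean n k p x = (elem_sym n k (\<lambda>i. \<bar>x i\<bar> powr p) / real (n choose k)) powr (1 / (real k * p))"
  by (simp add: sym_mean_def elem_sym_def)

lemma elem_sym_full: "elem_sym n n y = (\<Prod>i<n. y i)"
proof -
  have "I = {..<n}" if "I \<subseteq> {..<n}" "card I = n" for I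
    using that card_subset_eq[of "{..<n}" I] by simp
  then have "{I. I \<subseteq> {..<n} \<and> card I = n} = {{..<n}}" by auto
  then show ?thesis by (simp add: elem_sym_def)
qed

text \<open>A pointwise statement. The premise \<open>Y\<close> bounds \<open>sqrt n\<close> times
  the whole remainder: \<open>2 * A\<^sup>2\<close> is the error in replacing
  \<open>ln (1 + A)\<close> by \<open>A\<close>, and the other summand comes from
  \<open>ln_elem_sym_mean\<close>, where the factor 4 reflects that the sum is at least
  \<open>n / 2\<close>. The event says that \<open>T\<close> is at least a quantity of absolute
  value at most \<open>\<delta>\<close>.\<close>

lemma sym_mean_event_bounds:
  fixes x :: "nat \<Rightarrow> real"
  assumes p: "1 \<le> p" and k: "1 \<le> k" "k \<le> n" and nz: "\<And>i. i < n \<Longrightarrow> x i \<noteq> 0"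
    and c: "c = real (k choose 2)" and A: "A = (\<Sum>i<n. \<bar>x i\<bar> powr p - 1) / n"
    and Y: "sqrt n * (2 * A\<^sup>2 + 2 * c * (4 * (\<Sum>i<n. (\<bar>x i\<bar> powr p)\<^sup>2) / n\<^sup>2 + 1 / n)) \<le> \<delta>" and \<delta>: "\<delta> \<le> 1 / 2"
    and T: "T = (\<Sum>i<n. xi p (x i)) / sqrt n"
  shows "exp (log_moment p) * sym_mean n k p x \<le> sym_mean n n p x \<Longrightarrow> - \<delta> \<le> T"
    and "\<delta> \<le> T \<Longrightarrow> exp (log_moment p) * sym_mean n k p x \<le> sym_mean n n p x"
proof -
  have n: "1 \<le> real n" using k by simp
  define q2 where "q2 = (\<Sum>i<n. (\<bar>x i\<bar> powr p)\<^sup>2)"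
  define s where "s = (\<Sum>i<n. \<bar>x i\<bar> powr p)"
  have c0: "0 \<le> c" using c by simp
  have q20: "0 \<le> q2" by (simp add: q2_def sum_nonneg)
  have sA: "s / n = 1 + A" using n by (simp add: A s_def sum_subtractf field_simps)
  define Z where "Z = 2 * A\<^sup>2 + 2 * c * (4 * q2 / n\<^sup>2 + 1 / n)"
  have Z0: "0 \<le> Z" "0 \<le> c * (4 * q2 / n\<^sup>2)" "0 \<le> c / n" using c0 q20 by (auto simp: Z_def)
  have sq: "1 \<le> sqrt n" using n by simp
  have "1 * Z \<le> sqrt n * Z" using Z0 sq by (intro mult_right_mono) auto
  then have Zd: "Z \<le> \<delta>" using Y by (simp add: Z_def q2_def)
  have Zsplit: "Z = 2 * A\<^sup>2 + 2 * (c * (4 * q2 / n\<^sup>2)) + 2 * (c / n)" by (simp add: Z_def algebra_simps)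
  \<comment> \<open>Each summand of \<open>Z\<close> is nonnegative and
    \<open>Z \<le> 1 / 2\<close>. This alone gives \<open>\<bar>A\<bar> \<le> 1 / 2\<close> and the
    smallness conditions of \<open>ln_elem_sym_mean\<close>.\<close>
  have A2: "A\<^sup>2 \<le> 1 / 4" and c1: "c * (4 * q2 / n\<^sup>2) \<le> 1 / 4" and c2: "c / n \<le> 1 / 4"
    using Zd \<delta> Z0 zero_le_power2[of A] unfolding Zsplit by linarith+
  have Ah: "\<bar>A\<bar> \<le> 1 / 2"
    using A2 by (intro power2_le_imp_le[of "\<bar>A\<bar>" "1 / 2"]) (auto simp: power2_eq_square)
  have s_lb: "n / 2 \<le> s"
  proof -
    have "real n * (1 / 2) \<le> real n * (1 + A)" using Ah by (intro mult_left_mono) (auto simp: abs_le_iff)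
    also have "real n * (1 + A) = s" using n by (simp add: sA[symmetric])
    finally show ?thesis by simp
  qed
  have s0: "0 < s" using s_lb n by simp
  define q where "q = q2 / s\<^sup>2"
  have q: "q \<le> 4 * q2 / n\<^sup>2"
  proof -
    have "(n / 2)\<^sup>2 \<le> s\<^sup>2" using s_lb n by (intro power_mono) auto
    then have "q2 / s\<^sup>2 \<le> q2 / (n / 2)\<^sup>2" using q20 n s0 by (intro divide_left_mono mult_pos_pos) auto
    then show ?thesis by (simp add: q_def power_divide mult.commute)
  qed
  have cq: "c * q \<le> c * (4 * q2 / n\<^sup>2)" using q c0 by (intro mult_left_mono)
  define E where "E = elem_sym n k (\<lambda>i. \<bar>x i\<bar> powr p) / real (n choose k)"
  have E: "0 < E" "\<bar>ln E - k * ln (s / n)\<bar> \<le> 2 * c * (q + 1 / n)"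
  proof -
    have cq': "c * q \<le> 1 / 2" "c / n \<le> 1 / 2" using cq c1 c2 by linarith+
    note l = ln_elem_sym_mean[of n "\<lambda>i. \<bar>x i\<bar> powr p", OF _ k c s_def s0 q_def[unfolded q2_def] cq']
    show "0 < E" unfolding E_def by (rule l(1)) simp
    show "\<bar>ln E - k * ln (s / n)\<bar> \<le> 2 * c * (q + 1 / n)" unfolding E_def by (rule l(2)) simp
  qed
  define L where "L = (\<Sum>i<n. ln \<bar>x i\<bar>) / n"
  have full: "sym_mean n n p x = exp L"
  proof -
    have "sym_mean n n p x = (\<Prod>i<n. \<bar>x i\<bar> powr p) powr (1 / (real n * p))"
      by (simp add: sym_mean_elem_sym elem_sym_full)
    also have "(\<Prod>i<n. \<bar>x i\<bar> powr p) = exp (\<Sum>i<n. p * ln \<bar>x i\<bar>)"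
      using nz by (simp add: exp_sum powr_def)
    also have "\<dots> powr (1 / (real n * p)) = exp L"
      using p n by (simp add: powr_def L_def sum_distrib_left[symmetric])
    finally show ?thesis .
  qed
  have part: "sym_mean n k p x = exp (ln E / (k * p))"
  proof -
    have "sym_mean n k p x = E powr (1 / (k * p))" by (simp only: sym_mean_elem_sym E_def)
    then show ?thesis using E(1) by (simp add: powr_def)
  qed
  have event: "exp (log_moment p) * sym_mean n k p x \<le> sym_mean n n p x \<longleftrightarrow> log_moment p + ln E / (k * p) \<le> L"
    unfolding full part exp_add[symmetric] by simp
  have "(\<Sum>i<n. xi p (x i)) = n * L - n * log_moment p - n * A / p"
    using n by (simp add: xi_def sum_subtractf L_def A sum_divide_distrib[symmetric])
  then have "T = (n * (L - log_moment p - A / p)) / sqrt n" by (simp add: T algebra_simps)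
  also have "\<dots> = sqrt n * (L - log_moment p - A / p)"
    using n by (simp add: real_div_sqrt field_simps)
  finally have T': "T = sqrt n * (L - log_moment p - A / p)" .
  \<comment> \<open>The error made when the logarithm of \<open>sym_mean n k p x\<close> is replaced
    by its linearization \<open>A / p\<close>.\<close>
  define \<epsilon> where "\<epsilon> = ln E / (k * p) - A / p"
  have "\<bar>\<epsilon>\<bar> \<le> Z"
  proof -
    have k0: "1 \<le> real k" using k by simp
    have lnA: "\<bar>ln (1 + A) - A\<bar> \<le> 2 * A\<^sup>2"
      using abs_ln_one_plus_x_minus_x_bound_nonneg[of A] abs_ln_one_plus_x_minus_x_bound_nonpos[of A] Ah zero_le_power2[of A]
      by (cases "0 \<le> A") (auto simp: abs_le_iff)
    have "\<epsilon> = ((ln E - k * ln (1 + A)) / k + (ln (1 + A) - A)) / p"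
      using k0 p by (simp add: \<epsilon>_def field_simps)
    then have "\<bar>\<epsilon>\<bar> = \<bar>(ln E - k * ln (1 + A)) / k + (ln (1 + A) - A)\<bar> / p" using p by simp
    also have "\<dots> \<le> \<bar>(ln E - k * ln (1 + A)) / k + (ln (1 + A) - A)\<bar> / 1"
      using p by (intro divide_left_mono) auto
    also have "\<dots> \<le> \<bar>ln E - k * ln (1 + A)\<bar> / k + \<bar>ln (1 + A) - A\<bar>"
      using abs_triangle_ineq[of "(ln E - k * ln (1 + A)) / k" "ln (1 + A) - A"] by simp
    also have "\<bar>ln E - k * ln (1 + A)\<bar> / k \<le> \<bar>ln E - k * ln (1 + A)\<bar> / 1"
      using k0 by (intro divide_left_mono) auto
    also have "\<bar>ln E - k * ln (1 + A)\<bar> / 1 \<le> 2 * c * (q + 1 / n)" using E(2) by (simp add: sA)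
    also have "\<dots> = 2 * (c * q) + 2 * (c / n)" by (simp add: algebra_simps)
    also have "\<dots> \<le> 2 * (c * (4 * q2 / n\<^sup>2)) + 2 * (c / n)" using cq by linarith
    finally show ?thesis using lnA unfolding Zsplit by linarith
  qed
  then have "sqrt n * \<bar>\<epsilon>\<bar> \<le> sqrt n * Z" using sq by (intro mult_left_mono) auto
  also have "\<dots> \<le> \<delta>" using Y by (simp add: Z_def q2_def)
  finally have \<epsilon>: "\<bar>sqrt n * \<epsilon>\<bar> \<le> \<delta>" using sq by (simp add: abs_mult)
  have key: "T - sqrt n * \<epsilon> = sqrt n * (L - (log_moment p + ln E / (k * p)))"
    unfolding T' \<epsilon>_def by (simp add: algebra_simps)
  have sq0: "0 < sqrt n" using n by simp
  { assume "exp (log_moment p) * sym_mean n k p x \<le> sym_mean n n p x"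
    then have "0 \<le> T - sqrt n * \<epsilon>" unfolding key using event sq by (intro mult_nonneg_nonneg) auto
    then show "- \<delta> \<le> T" using \<epsilon> by (simp add: abs_le_iff) }
  { assume "\<delta> \<le> T"
    then have "0 \<le> sqrt n * (L - (log_moment p + ln E / (k * p)))" unfolding key[symmetric] using \<epsilon> by (simp add: abs_le_iff)
    then have "0 \<le> L - (log_moment p + ln E / (k * p))" using sq0 by (simp only: zero_le_mult_iff) auto
    then show "exp (log_moment p) * sym_mean n k p x \<le> sym_mean n n p x" using event by simp }
qed

section \<open>The central limit theorem for the centred variables\<close>

lemma
  shows cdf_std_normal_0: "cdf std_normal_distribution 0 = 1 / 2"
    and isCont_cdf_std_normal: "isCont (cdf std_normal_distribution) x"
proof -
  let ?N = std_normal_distribution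
  interpret N: real_distribution ?N by (rule real_dist_normal_dist)
  have atom: "measure ?N {x} = 0" for x
  proof -
    have "AE y in lborel. y \<noteq> x" by (rule AE_lborel_singleton)
    then have "AE y in ?N. y \<noteq> x" by (subst AE_density) auto
    then have "emeasure ?N {x} = 0" by (subst (asm) AE_iff_measurable[where N = "{x}"]) auto
    then show ?thesis by (simp add: measure_def)
  qed
  show "isCont (cdf ?N) x" using atom by (simp add: N.isCont_cdf)
  have "emeasure ?N {..0} = (\<integral>\<^sup>+x. ennreal (std_normal_density x) * indicator {..0} x \<partial>lborel)"
    by (rule emeasure_density) auto
  also have "\<dots> = (\<integral>\<^sup>+x. ennreal (std_normal_density x) * indicator {0..} x \<partial>lborel)"
    by (subst nn_integral_real_affine[where c = "-1" and t = 0]) (auto intro!: nn_integral_cong simp: indicator_def std_normal_density_def)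
  also have "\<dots> = emeasure ?N {0..}" by (rule emeasure_density[symmetric]) auto
  finally have eq: "measure ?N {..0} = measure ?N {0..}" by (simp add: measure_def)
  have "measure ?N {..0} + measure ?N {0<..} = measure ?N ({..0} \<union> {0<..})"
    by (rule N.finite_measure_Union[symmetric]) auto
  also have "{..0} \<union> {0<..} = (UNIV :: real set)" by auto
  also have "measure ?N UNIV = 1" using N.prob_space by simp
  finally have "measure ?N {..0} + measure ?N {0<..} = 1" .
  moreover have "measure ?N {0..} = measure ?N {0<..} + measure ?N {0}"
  proof -
    have "{0..} = {0<..} \<union> {0::real}" by auto
    then show ?thesis by (simp only:) (rule N.finite_measure_Union, auto)
  qed
  ultimately show "cdf ?N 0 = 1 / 2" using eq atom[of 0] by (simp add: cdf_def2)
qed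

definition sigma_xi :: "real \<Rightarrow> real" where
  "sigma_xi p = sqrt (LINT x|p_gaussian p. (xi p x)\<^sup>2)"

context
  fixes p :: real assumes p: "1 \<le> p"
begin

interpretation PP: product_prob_space "\<lambda>_. p_gaussian p" "UNIV :: nat set"
  by (intro product_prob_spaceI prob_space_p_gaussian p)

interpretation G: prob_space "gauss_seq p"
  unfolding gauss_seq_def by (rule PP.P.prob_space_axioms)

lemma space_gauss_seq: "space (gauss_seq p) = UNIV"
  by (simp add: gauss_seq_def space_PiM)

lemma measurable_gauss_seq_comp [measurable (raw)]: "(\<lambda>\<omega>. \<omega> i) \<in> borel_measurable (gauss_seq p)"
proof -
  have "(\<lambda>\<omega>. \<omega> i) \<in> measurable (gauss_seq p) (p_gaussian p)" unfolding gauss_seq_def by measurable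
  then show ?thesis by (simp cong: measurable_cong_sets)
qed

lemma distr_gauss_seq_comp: "distr (gauss_seq p) (p_gaussian p) (\<lambda>\<omega>. \<omega> i) = p_gaussian p"
  unfolding gauss_seq_def by (rule PP.PiM_component) simp

lemma integral_gauss_seq_comp:
  fixes f :: "real \<Rightarrow> real"
  assumes [measurable]: "f \<in> borel_measurable borel"
  shows "(LINT \<omega>|gauss_seq p. f (\<omega> i)) = (LINT x|p_gaussian p. f x)"
    and "integrable (gauss_seq p) (\<lambda>\<omega>. f (\<omega> i)) \<longleftrightarrow> integrable (p_gaussian p) f"
proof -
  have m: "(\<lambda>\<omega>. \<omega> i) \<in> measurable (gauss_seq p) (p_gaussian p)" unfolding gauss_seq_def by measurable
  have f: "f \<in> borel_measurable (p_gaussian p)" using assms by (simp cong: measurable_cong_sets)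
  show "(LINT \<omega>|gauss_seq p. f (\<omega> i)) = (LINT x|p_gaussian p. f x)"
    using integral_distr[OF m f] by (simp add: distr_gauss_seq_comp)
  show "integrable (gauss_seq p) (\<lambda>\<omega>. f (\<omega> i)) \<longleftrightarrow> integrable (p_gaussian p) f"
    using integrable_distr_eq[OF m f] by (simp add: distr_gauss_seq_comp)
qed

lemma AE_gauss_seq_nonzero: "AE \<omega> in gauss_seq p. \<forall>i. \<omega> i \<noteq> 0"
  unfolding gauss_seq_def
  by (subst AE_all_countable) (intro allI PP.AE_component AE_p_gaussian_nonzero p, simp)

lemma indep_gauss_seq:
  fixes f :: "real \<Rightarrow> real"
  assumes [measurable]: "f \<in> borel_measurable borel"
  shows "G.indep_vars (\<lambda>_. borel) (\<lambda>i \<omega>. f (\<omega> i)) UNIV"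
proof -
  have m: "(\<lambda>\<omega>. \<omega> i) \<in> measurable (gauss_seq p) (p_gaussian p)" for i unfolding gauss_seq_def by measurable
  have "distr (gauss_seq p) (\<Pi>\<^sub>M i\<in>UNIV. p_gaussian p) (\<lambda>\<omega>. \<lambda>i\<in>UNIV. \<omega> i) = distr (gauss_seq p) (gauss_seq p) (\<lambda>\<omega>. \<omega>)"
    by (rule distr_cong) (auto simp: gauss_seq_def)
  also have "\<dots> = (\<Pi>\<^sub>M i\<in>UNIV. distr (gauss_seq p) (p_gaussian p) (\<lambda>\<omega>. \<omega> i))"
    by (simp add: distr_gauss_seq_comp) (simp add: gauss_seq_def)
  finally have "G.indep_vars (\<lambda>_. p_gaussian p) (\<lambda>i \<omega>. \<omega> i) UNIV"
    by (subst G.indep_vars_iff_distr_eq_PiM) (auto simp: m)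
  then show ?thesis by (rule G.indep_vars_compose2) (use assms in \<open>simp cong: measurable_cong_sets\<close>)
qed

lemma second_moment_sum:
  fixes f :: "real \<Rightarrow> real"
  assumes [measurable]: "f \<in> borel_measurable borel" and zero: "(LINT x|p_gaussian p. f x) = 0"
    and sq: "integrable (p_gaussian p) (\<lambda>x. (f x)\<^sup>2)"
  shows "integrable (gauss_seq p) (\<lambda>\<omega>. (\<Sum>i<n. f (\<omega> i))\<^sup>2)"
    and "(LINT \<omega>|gauss_seq p. (\<Sum>i<n. f (\<omega> i))\<^sup>2) = n * (LINT x|p_gaussian p. (f x)\<^sup>2)"
proof -
  let ?v = "LINT x|p_gaussian p. (f x)\<^sup>2"
  have int: "integrable (p_gaussian p) f" by (rule PP.M.square_integrable_imp_integrable[OF _ sq]) (use assms(1) in \<open>simp cong: measurable_cong_sets\<close>)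
  have pair: "integrable (gauss_seq p) (\<lambda>\<omega>. f (\<omega> i) * f (\<omega> j)) \<and>
    (LINT \<omega>|gauss_seq p. f (\<omega> i) * f (\<omega> j)) = (if i = j then ?v else 0)" for i j
  proof (cases "i = j")
    case True
    then show ?thesis
      using integral_gauss_seq_comp[of "\<lambda>x. (f x)\<^sup>2" i] sq by (simp add: power2_eq_square)
  next
    case False
    have ind: "G.indep_vars (\<lambda>_. borel) (\<lambda>i \<omega>. f (\<omega> i)) {i, j}"
      by (rule G.indep_vars_subset[OF indep_gauss_seq]) auto
    have i: "integrable (gauss_seq p) (\<lambda>\<omega>. f (\<omega> k))" for k using int by (simp add: integral_gauss_seq_comp)
    show ?thesis
      using G.indep_vars_lebesgue_integral[OF _ ind] G.indep_vars_integrable[OF _ ind] i False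
      by (simp add: integral_gauss_seq_comp zero)
  qed
  have expand: "(\<Sum>i<n. f (\<omega> i))\<^sup>2 = (\<Sum>i<n. \<Sum>j<n. f (\<omega> i) * f (\<omega> j))" for \<omega>
    by (simp add: power2_eq_square sum_product)
  show "integrable (gauss_seq p) (\<lambda>\<omega>. (\<Sum>i<n. f (\<omega> i))\<^sup>2)"
    unfolding expand using pair by (intro Bochner_Integration.integrable_sum) auto
  have "(LINT \<omega>|gauss_seq p. (\<Sum>i<n. f (\<omega> i))\<^sup>2) = (\<Sum>i<n. \<Sum>j<n. if i = j then ?v else 0)"
    unfolding expand using pair by (simp add: Bochner_Integration.integral_sum)
  then show "(LINT \<omega>|gauss_seq p. (\<Sum>i<n. f (\<omega> i))\<^sup>2) = n * ?v" by simp
qed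

lemma sigma_xi_pos: "0 < sigma_xi p"
  using variance_xi_pos[OF p] by (simp add: sigma_xi_def)

lemma clt_xi:
  "(\<lambda>n. measure (gauss_seq p) {\<omega>. (\<Sum>i<n. xi p (\<omega> i)) / sqrt (n * (sigma_xi p)\<^sup>2) \<le> t}) \<longlonglongrightarrow> cdf std_normal_distribution t"
proof -
  have s2: "(sigma_xi p)\<^sup>2 = (LINT x|p_gaussian p. (xi p x)\<^sup>2)"
    using variance_xi_pos[OF p] by (simp add: sigma_xi_def)
  have e0: "G.expectation (\<lambda>\<omega>. xi p (\<omega> n)) = 0" for n
    by (simp add: integral_gauss_seq_comp expectation_xi[OF p])
  have sqm: "(\<lambda>x. (xi p x)\<^sup>2) \<in> borel_measurable borel" by measurable
  have "weak_conv_m (\<lambda>n. distr (gauss_seq p) borel (\<lambda>\<omega>. (\<Sum>i<n. xi p (\<omega> i)) / sqrt (n * (sigma_xi p)\<^sup>2))) std_normal_distribution"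
  proof (rule G.central_limit_theorem_zero_mean[where X = "\<lambda>i \<omega>. xi p (\<omega> i)" and \<mu> = "distr (gauss_seq p) borel (\<lambda>\<omega>. xi p (\<omega> 0))"])
    show "G.indep_vars (\<lambda>i. borel) (\<lambda>i \<omega>. xi p (\<omega> i)) UNIV" by (rule indep_gauss_seq) measurable
    show "integrable (gauss_seq p) (\<lambda>\<omega>. (xi p (\<omega> n))\<^sup>2)" for n
      using integral_gauss_seq_comp(2)[OF sqm, of n] integrable_xi_square[OF p] by simp
    show "G.variance (\<lambda>\<omega>. xi p (\<omega> n)) = (sigma_xi p)\<^sup>2" for n
      using integral_gauss_seq_comp(1)[OF sqm, of n] by (simp add: e0 s2)
    have m: "(\<lambda>\<omega>. \<omega> i) \<in> measurable (gauss_seq p) (p_gaussian p)" for i unfolding gauss_seq_def by measurable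
    have "distr (gauss_seq p) borel (\<lambda>\<omega>. xi p (\<omega> n)) = distr (distr (gauss_seq p) (p_gaussian p) (\<lambda>\<omega>. \<omega> n)) borel (xi p)" for n
      using measurable_xi by (subst distr_distr[OF _ m]) (simp_all add: comp_def cong: measurable_cong_sets)
    then show "distr (gauss_seq p) borel (\<lambda>\<omega>. xi p (\<omega> n)) = distr (gauss_seq p) borel (\<lambda>\<omega>. xi p (\<omega> 0))" for n
      by (simp add: distr_gauss_seq_comp)
  qed (use e0 sigma_xi_pos in auto)
  then have "(\<lambda>n. cdf (distr (gauss_seq p) borel (\<lambda>\<omega>. (\<Sum>i<n. xi p (\<omega> i)) / sqrt (n * (sigma_xi p)\<^sup>2))) t) \<longlonglongrightarrow> cdf std_normal_distribution t"
    using isCont_cdf_std_normal unfolding weak_conv_m_def weak_conv_def by blast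
  moreover have "cdf (distr (gauss_seq p) borel (\<lambda>\<omega>. (\<Sum>i<n. xi p (\<omega> i)) / sqrt (n * (sigma_xi p)\<^sup>2))) t
    = measure (gauss_seq p) {\<omega>. (\<Sum>i<n. xi p (\<omega> i)) / sqrt (n * (sigma_xi p)\<^sup>2) \<le> t}" for n
    unfolding cdf_def2 by (subst measure_distr) (auto simp: space_gauss_seq vimage_def)
  ultimately show ?thesis by simp
qed

lemma measurable_sym_mean_seq [measurable]: "(\<lambda>\<omega>. sym_mean n k p \<omega>) \<in> borel_measurable (gauss_seq p)"
  unfolding sym_mean_def by measurable

text \<open>By Markov's inequality the remainder \<open>Y n\<close> is below any fixed \<delta> with
  probability tending to 1. Up to that exceptional set, the event lies between two events on the
  normalized sum with thresholds near 0, and the normal distribution function is continuous at 0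
  with value 1/2.\<close>

lemma gaussian_event_limit:
  assumes k: "1 \<le> k"
  shows "(\<lambda>n. measure (gauss_seq p) {\<omega>. exp (log_moment p) * sym_mean n k p \<omega> \<le> sym_mean n n p \<omega>}) \<longlonglongrightarrow> 1 / 2"
proof -
  define E where "E n = {\<omega>. exp (log_moment p) * sym_mean n k p \<omega> \<le> sym_mean n n p \<omega>}" for n
  define S where "S n \<omega> = (\<Sum>i<n. xi p (\<omega> i))" for n and \<omega> :: "nat \<Rightarrow> real"
  define c where "c = real (k choose 2)"
  define A where "A n \<omega> = (\<Sum>i<n. \<bar>\<omega> i\<bar> powr p - 1) / n" for n :: nat and \<omega> :: "nat \<Rightarrow> real"
  define Y where "Y n \<omega> = sqrt n * (2 * (A n \<omega>)\<^sup>2 + 2 * c * (4 * (\<Sum>i<n. (\<bar>\<omega> i\<bar> powr p)\<^sup>2) / n\<^sup>2 + 1 / n))" for n :: nat and \<omega> :: "nat \<Rightarrow> real"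
  let ?P = "measure (gauss_seq p)"
  have [measurable]: "A n \<in> borel_measurable (gauss_seq p)" "Y n \<in> borel_measurable (gauss_seq p)" "S n \<in> borel_measurable (gauss_seq p)" for n
    unfolding A_def Y_def S_def by measurable
  have c0: "0 \<le> c" by (simp add: c_def)
  have Esets: "E n \<in> sets (gauss_seq p)" for n
  proof -
    have "{\<omega> \<in> space (gauss_seq p). exp (log_moment p) * sym_mean n k p \<omega> \<le> sym_mean n n p \<omega>} \<in> sets (gauss_seq p)" by measurable
    then show ?thesis by (simp add: E_def space_gauss_seq)
  qed
  have sets': "{\<omega>. P \<omega>} \<in> sets (gauss_seq p)" if "{\<omega> \<in> space (gauss_seq p). P \<omega>} \<in> sets (gauss_seq p)" for P
    using that by (simp add: space_gauss_seq)
  define v where "v = (LINT x|p_gaussian p. (\<bar>x\<bar> powr p - 1)\<^sup>2)"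
  define b where "b = (LINT x|p_gaussian p. (\<bar>x\<bar> powr p)\<^sup>2)"
  have ip: "integrable (p_gaussian p) (\<lambda>x. \<bar>x\<bar> powr p)" using p by (intro integrable_p_gaussian_powr) auto
  have ip2: "integrable (p_gaussian p) (\<lambda>x. (\<bar>x\<bar> powr p)\<^sup>2)" using p by (intro integrable_powr_square) auto
  have iv: "integrable (p_gaussian p) (\<lambda>x. (\<bar>x\<bar> powr p - 1)\<^sup>2)"
    using ip ip2 by (simp add: power2_diff)
  have z: "(LINT x|p_gaussian p. \<bar>x\<bar> powr p - 1) = 0"
    using ip expectation_p_gaussian_powr_p[OF p] PP.M.prob_space by simp
  have m1: "(\<lambda>x::real. \<bar>x\<bar> powr p - 1) \<in> borel_measurable borel" "(\<lambda>x::real. (\<bar>x\<bar> powr p)\<^sup>2) \<in> borel_measurable borel" by measurable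
  \<comment> \<open>\<open>A n\<close> is a centred average with second moment \<open>v / n\<close>,
    and the sum of squares divided by \<open>n\<^sup>2\<close> has mean \<open>b / n\<close>; after
    the factor \<open>sqrt n\<close> the order \<open>1 / sqrt n\<close> remains.\<close>
  have EY: "integrable (gauss_seq p) (Y n) \<and> (LINT \<omega>|gauss_seq p. Y n \<omega>) = (2 * v + 8 * c * b + 2 * c) / sqrt n" if n: "1 \<le> n" for n
  proof -
    have iA: "integrable (gauss_seq p) (\<lambda>\<omega>. (A n \<omega>)\<^sup>2)" "(LINT \<omega>|gauss_seq p. (A n \<omega>)\<^sup>2) = v / n"
      using second_moment_sum[OF m1(1) z iv, of n] n
      by (simp_all add: A_def power_divide v_def power2_eq_square)
    have iq: "integrable (gauss_seq p) (\<lambda>\<omega>. (\<bar>\<omega> i\<bar> powr p)\<^sup>2)" "(LINT \<omega>|gauss_seq p. (\<bar>\<omega> i\<bar> powr p)\<^sup>2) = b" for i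
      using integral_gauss_seq_comp[OF m1(2), of i] ip2 by (simp_all add: b_def)
    have iQ: "integrable (gauss_seq p) (\<lambda>\<omega>. \<Sum>i<n. (\<bar>\<omega> i\<bar> powr p)\<^sup>2)" "(LINT \<omega>|gauss_seq p. (\<Sum>i<n. (\<bar>\<omega> i\<bar> powr p)\<^sup>2)) = n * b"
      using iq by (simp_all add: Bochner_Integration.integral_sum)
    have i1: "integrable (gauss_seq p) (Y n)"
      unfolding Y_def using iA iQ by (intro integrable_mult_right Bochner_Integration.integrable_add integrable_divide) auto
    have "(LINT \<omega>|gauss_seq p. Y n \<omega>) = sqrt n * (2 * (v / n) + 2 * c * (4 * (n * b) / n\<^sup>2 + 1 / n))"
      unfolding Y_def using iA iQ G.prob_space by simp
    also have "\<dots> = (sqrt n / n) * (2 * v + 8 * c * b + 2 * c)"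
      using n by (simp add: power2_eq_square field_simps)
    also have "sqrt n / n = 1 / sqrt n" using n real_div_sqrt[of n] by (simp add: field_simps)
    finally show ?thesis using i1 by simp
  qed
  have Ybad: "(\<lambda>n. ?P {\<omega>. \<delta> \<le> Y n \<omega>}) \<longlonglongrightarrow> 0" if \<delta>: "0 < \<delta>" for \<delta>
  proof (rule tendsto_sandwich[where f = "\<lambda>_. 0" and h = "\<lambda>n::nat. (2 * v + 8 * c * b + 2 * c) / sqrt n / \<delta>"])
    show "\<forall>\<^sub>F n in sequentially. ?P {\<omega>. \<delta> \<le> Y n \<omega>} \<le> (2 * v + 8 * c * b + 2 * c) / sqrt n / \<delta>"
      using eventually_ge_at_top[of 1]
    proof eventually_elim
      fix n :: nat assume n: "1 \<le> n"
      have "0 \<le> Y n \<omega>" for \<omega> unfolding Y_def using c0 by (intro mult_nonneg_nonneg add_nonneg_nonneg divide_nonneg_nonneg sum_nonneg) auto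
      then have "?P {\<omega> \<in> space (gauss_seq p). \<delta> \<le> Y n \<omega>} \<le> (LINT \<omega>|gauss_seq p. Y n \<omega>) / \<delta>"
        using EY[OF n] \<delta> by (intro integral_Markov_inequality_measure[where A = "{}"]) auto
      then show "?P {\<omega>. \<delta> \<le> Y n \<omega>} \<le> (2 * v + 8 * c * b + 2 * c) / sqrt n / \<delta>"
        using EY[OF n] by (simp add: space_gauss_seq)
    qed
    have "(\<lambda>n. (2 * v + 8 * c * b + 2 * c) / \<delta> * inverse (sqrt (real n))) \<longlonglongrightarrow> (2 * v + 8 * c * b + 2 * c) / \<delta> * 0"
      by (intro tendsto_mult tendsto_const tendsto_inverse_0_at_top filterlim_compose[OF sqrt_at_top filterlim_real_sequentially])
    then show "(\<lambda>n. (2 * v + 8 * c * b + 2 * c) / sqrt n / \<delta>) \<longlonglongrightarrow> 0" by (simp add: field_simps)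
  qed auto
  let ?F = "\<lambda>n t. ?P {\<omega>. S n \<omega> / sqrt (n * (sigma_xi p)\<^sup>2) \<le> t}"
  have Fsets: "{\<omega>. S n \<omega> / sqrt (n * (sigma_xi p)\<^sup>2) \<le> t} \<in> sets (gauss_seq p)" "{\<omega>. \<delta> \<le> Y n \<omega>} \<in> sets (gauss_seq p)"
    "{\<omega>. t < S n \<omega> / sqrt (n * (sigma_xi p)\<^sup>2)} \<in> sets (gauss_seq p)" for n t \<delta>
    by (rule sets', measurable)+
  have compl: "?P {\<omega>. t < S n \<omega> / sqrt (n * (sigma_xi p)\<^sup>2)} = 1 - ?F n t" for n t
  proof -
    have "{\<omega>. t < S n \<omega> / sqrt (n * (sigma_xi p)\<^sup>2)} = space (gauss_seq p) - {\<omega>. S n \<omega> / sqrt (n * (sigma_xi p)\<^sup>2) \<le> t}"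
      by (auto simp: space_gauss_seq)
    then show ?thesis using G.prob_compl[OF Fsets(1)] by simp
  qed
  have norm: "S n \<omega> / sqrt n = sigma_xi p * (S n \<omega> / sqrt (n * (sigma_xi p)\<^sup>2))" for n \<omega>
    using sigma_xi_pos by (simp add: real_sqrt_mult)
  \<comment> \<open>The lower threshold is doubled because the event only yields a weak inequality
    with \<open>- \<delta>\<close>, while the complement of a distribution function calls for a
    strict one.\<close>
  have bounds: "?P (E n) \<le> 1 - ?F n (- 2 * \<delta> / sigma_xi p) + ?P {\<omega>. \<delta> \<le> Y n \<omega>} \<and> 1 - ?F n (\<delta> / sigma_xi p) - ?P {\<omega>. \<delta> \<le> Y n \<omega>} \<le> ?P (E n)"
    if n: "k \<le> n" and \<delta>: "0 < \<delta>" "\<delta> \<le> 1 / 2" for n \<delta>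
  proof
    have eb: "exp (log_moment p) * sym_mean n k p \<omega> \<le> sym_mean n n p \<omega> \<Longrightarrow> - \<delta> \<le> S n \<omega> / sqrt n"
      "\<delta> \<le> S n \<omega> / sqrt n \<Longrightarrow> exp (log_moment p) * sym_mean n k p \<omega> \<le> sym_mean n n p \<omega>"
      if "\<forall>i. \<omega> i \<noteq> 0" "\<not> \<delta> \<le> Y n \<omega>" for \<omega>
      using sym_mean_event_bounds[OF p k n, of \<omega> c "A n \<omega>" \<delta> "S n \<omega> / sqrt n"] that \<delta>
      by (auto simp: c_def A_def Y_def S_def)
    have "?P (E n) \<le> ?P ({\<omega>. - 2 * \<delta> / sigma_xi p < S n \<omega> / sqrt (n * (sigma_xi p)\<^sup>2)} \<union> {\<omega>. \<delta> \<le> Y n \<omega>})"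
    proof (rule G.finite_measure_mono_AE)
      show "AE \<omega> in gauss_seq p. \<omega> \<in> E n \<longrightarrow> \<omega> \<in> {\<omega>. - 2 * \<delta> / sigma_xi p < S n \<omega> / sqrt (n * (sigma_xi p)\<^sup>2)} \<union> {\<omega>. \<delta> \<le> Y n \<omega>}"
        using AE_gauss_seq_nonzero
      proof (eventually_elim, intro impI)
        fix \<omega> assume \<omega>: "\<forall>i. \<omega> i \<noteq> 0" "\<omega> \<in> E n"
        show "\<omega> \<in> {\<omega>. - 2 * \<delta> / sigma_xi p < S n \<omega> / sqrt (n * (sigma_xi p)\<^sup>2)} \<union> {\<omega>. \<delta> \<le> Y n \<omega>}"
        proof (cases "\<delta> \<le> Y n \<omega>")
          case False
          have "exp (log_moment p) * sym_mean n k p \<omega> \<le> sym_mean n n p \<omega>"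
            using \<omega>(2) by (simp only: E_def mem_Collect_eq)
          then have "- \<delta> \<le> sigma_xi p * (S n \<omega> / sqrt (n * (sigma_xi p)\<^sup>2))"
            using eb(1)[OF \<omega>(1) False] by (simp only: norm)
          then have "- 2 * \<delta> < sigma_xi p * (S n \<omega> / sqrt (n * (sigma_xi p)\<^sup>2))" using \<delta> by linarith
          then have "- 2 * \<delta> / sigma_xi p < S n \<omega> / sqrt (n * (sigma_xi p)\<^sup>2)"
            using sigma_xi_pos by (subst pos_divide_less_eq) (simp_all only: mult.commute)
          then show ?thesis by blast
        qed blast
      qed
      show "{\<omega>. - 2 * \<delta> / sigma_xi p < S n \<omega> / sqrt (n * (sigma_xi p)\<^sup>2)} \<union> {\<omega>. \<delta> \<le> Y n \<omega>} \<in> sets (gauss_seq p)"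
        by (intro sets.Un Fsets)
    qed
    also have "\<dots> \<le> ?P {\<omega>. - 2 * \<delta> / sigma_xi p < S n \<omega> / sqrt (n * (sigma_xi p)\<^sup>2)} + ?P {\<omega>. \<delta> \<le> Y n \<omega>}"
      by (intro measure_Un_le Fsets)
    finally show "?P (E n) \<le> 1 - ?F n (- 2 * \<delta> / sigma_xi p) + ?P {\<omega>. \<delta> \<le> Y n \<omega>}" by (simp only: compl)
    have "?P {\<omega>. \<delta> / sigma_xi p < S n \<omega> / sqrt (n * (sigma_xi p)\<^sup>2)} \<le> ?P (E n \<union> {\<omega>. \<delta> \<le> Y n \<omega>})"
    proof (rule G.finite_measure_mono_AE)
      show "AE \<omega> in gauss_seq p. \<omega> \<in> {\<omega>. \<delta> / sigma_xi p < S n \<omega> / sqrt (n * (sigma_xi p)\<^sup>2)} \<longrightarrow> \<omega> \<in> E n \<union> {\<omega>. \<delta> \<le> Y n \<omega>}"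
        using AE_gauss_seq_nonzero
      proof (eventually_elim, intro impI)
        fix \<omega> assume \<omega>: "\<forall>i. \<omega> i \<noteq> 0" "\<omega> \<in> {\<omega>. \<delta> / sigma_xi p < S n \<omega> / sqrt (n * (sigma_xi p)\<^sup>2)}"
        show "\<omega> \<in> E n \<union> {\<omega>. \<delta> \<le> Y n \<omega>}"
        proof (cases "\<delta> \<le> Y n \<omega>")
          case False
          have "\<delta> / sigma_xi p < S n \<omega> / sqrt (n * (sigma_xi p)\<^sup>2)" using \<omega>(2) by blast
          then have "\<delta> < sigma_xi p * (S n \<omega> / sqrt (n * (sigma_xi p)\<^sup>2))"
            using sigma_xi_pos by (subst (asm) pos_divide_less_eq) (simp_all only: mult.commute)
          then have "\<delta> \<le> S n \<omega> / sqrt n" by (simp only: norm less_imp_le)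
          then have "\<omega> \<in> E n" using eb(2)[OF \<omega>(1) False] by (simp only: E_def mem_Collect_eq)
          then show ?thesis by blast
        qed blast
      qed
      show "E n \<union> {\<omega>. \<delta> \<le> Y n \<omega>} \<in> sets (gauss_seq p)" by (intro sets.Un Fsets Esets)
    qed
    also have "\<dots> \<le> ?P (E n) + ?P {\<omega>. \<delta> \<le> Y n \<omega>}"
      by (intro measure_Un_le Fsets Esets)
    finally show "1 - ?F n (\<delta> / sigma_xi p) - ?P {\<omega>. \<delta> \<le> Y n \<omega>} \<le> ?P (E n)" by (simp only: compl)
  qed
  have "(\<lambda>n. ?P (E n)) \<longlonglongrightarrow> 1 / 2"
  proof (rule tendstoI)
    fix e :: real assume e: "0 < e"
    let ?\<Phi> = "cdf std_normal_distribution"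
    obtain r where r: "0 < r" "\<And>t. \<bar>t\<bar> < r \<Longrightarrow> \<bar>?\<Phi> t - 1 / 2\<bar> < e / 3"
      using isCont_cdf_std_normal[of 0] e unfolding continuous_at_eps_delta cdf_std_normal_0 dist_real_def
      by (metis diff_zero zero_less_divide_iff zero_less_numeral)
    \<comment> \<open>The first bound is required by \<open>sym_mean_event_bounds\<close>; the
      second keeps both thresholds, of size at most \<open>2 * \<delta> / sigma_xi p\<close>, inside
      the radius of continuity \<open>r\<close>.\<close>
    define \<delta> where "\<delta> = min (1 / 2) (r * sigma_xi p / 4)"
    have \<delta>: "0 < \<delta>" "\<delta> \<le> 1 / 2" using r sigma_xi_pos by (auto simp: \<delta>_def)
    have "2 * \<delta> < r * sigma_xi p" using mult_pos_pos[OF r(1) sigma_xi_pos] unfolding \<delta>_def min_def by (simp split: if_splits)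
    then have d1: "2 * \<delta> / sigma_xi p < r" using sigma_xi_pos by (simp add: pos_divide_less_eq)
    have d2: "0 < \<delta> / sigma_xi p" "\<delta> / sigma_xi p < 2 * \<delta> / sigma_xi p" using \<delta> sigma_xi_pos by (auto simp: divide_strict_right_mono)
    have P1: "\<bar>?\<Phi> (- 2 * \<delta> / sigma_xi p) - 1 / 2\<bar> < e / 3" using r(2)[of "- 2 * \<delta> / sigma_xi p"] d1 d2 by (simp add: abs_less_iff)
    have P2: "\<bar>?\<Phi> (\<delta> / sigma_xi p) - 1 / 2\<bar> < e / 3" using r(2)[of "\<delta> / sigma_xi p"] d1 d2 by (simp add: abs_less_iff)
    have F: "(\<lambda>n. ?F n t) \<longlonglongrightarrow> ?\<Phi> t" for t using clt_xi by (simp add: S_def)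
    have e3: "0 < e / 3" using e by simp
    show "\<forall>\<^sub>F n in sequentially. dist (?P (E n)) (1 / 2) < e"
      using tendstoD[OF F[of "- 2 * \<delta> / sigma_xi p"] e3] tendstoD[OF F[of "\<delta> / sigma_xi p"] e3] tendstoD[OF Ybad[OF \<delta>(1)] e3] eventually_ge_at_top[of k]
    proof eventually_elim
      fix n assume "dist (?F n (- 2 * \<delta> / sigma_xi p)) (?\<Phi> (- 2 * \<delta> / sigma_xi p)) < e / 3"
        "dist (?F n (\<delta> / sigma_xi p)) (?\<Phi> (\<delta> / sigma_xi p)) < e / 3" "dist (?P {\<omega>. \<delta> \<le> Y n \<omega>}) 0 < e / 3" "k \<le> n"
      then show "dist (?P (E n)) (1 / 2) < e"
        using bounds[OF \<open>k \<le> n\<close> \<delta>] P1 P2 unfolding dist_real_def abs_less_iff by linarith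
    qed
  qed
  then show ?thesis by (simp add: E_def)
qed

end

section \<open>Measurability and scale invariance of the event\<close>

definition mean_event :: "real \<Rightarrow> nat \<Rightarrow> nat \<Rightarrow> (nat \<Rightarrow> real) set" where
  "mean_event p k n = {x \<in> space (leb n). exp (log_moment p) * sym_mean n k p x \<le> sym_mean n n p x}"

lemma sets_mean_event: "mean_event p k n \<in> sets (leb n)"
proof -
  have "(\<lambda>x. sym_mean n j p x) \<in> borel_measurable (leb n)" for j
    unfolding sym_mean_def
  proof (intro powr_real_measurable borel_measurable_divide borel_measurable_sum borel_measurable_prod borel_measurable_const)
    fix I i assume "I \<in> {I. I \<subseteq> {..<n} \<and> card I = j}" "i \<in> I"
    then have "(\<lambda>x. x i) \<in> borel_measurable (leb n)" using measurable_leb_component[OF measurable_ident, of i n] by auto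
    then show "(\<lambda>x. \<bar>x i\<bar>) \<in> borel_measurable (leb n)" by measurable
  qed
  then show ?thesis unfolding mean_event_def by measurable
qed

lemma sym_mean_scale:
  assumes r: "0 < r" and p: "0 < p" and k: "1 \<le> k"
  shows "sym_mean n k p (scale_vec n r x) = r * sym_mean n k p x"
proof -
  have "(\<Prod>i\<in>I. \<bar>scale_vec n r x i\<bar> powr p) = (r powr p) ^ k * (\<Prod>i\<in>I. \<bar>x i\<bar> powr p)"
    if "I \<subseteq> {..<n}" "card I = k" for I
  proof -
    have "(\<Prod>i\<in>I. \<bar>scale_vec n r x i\<bar> powr p) = (\<Prod>i\<in>I. r powr p * \<bar>x i\<bar> powr p)"
      using that r by (intro prod.cong) (auto simp: scale_vec_apply abs_mult powr_mult)
    then show ?thesis using that by (simp add: prod.distrib)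
  qed
  then have "(\<Sum>I | I \<subseteq> {..<n} \<and> card I = k. \<Prod>i\<in>I. \<bar>scale_vec n r x i\<bar> powr p)
      = (r powr p) ^ k * (\<Sum>I | I \<subseteq> {..<n} \<and> card I = k. \<Prod>i\<in>I. \<bar>x i\<bar> powr p)"
    by (simp add: sum_distrib_left)
  moreover have "((r powr p) ^ k) powr (1 / (real k * p)) = r"
    using r p k by (simp add: powr_realpow[symmetric] powr_powr)
  ultimately show ?thesis
    using r by (simp add: sym_mean_def powr_mult sum_nonneg prod_nonneg flip: times_divide_eq_right)
qed

lemma scale_inv_mean_event: "0 < p \<Longrightarrow> 1 \<le> k \<Longrightarrow> 0 < n \<Longrightarrow> scale_inv n (mean_event p k n)"
  by (simp add: scale_inv_def mean_event_def sym_mean_scale mult.left_commute[of _ _ "sym_mean _ _ _ _"])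

lemma sym_mean_restrict: "sym_mean n k p (restrict x {..<n}) = sym_mean n k p x"
  unfolding sym_mean_def by (intro arg_cong2[where f = "(powr)"] arg_cong2[where f = "(/)"] sum.cong prod.cong refl) auto

section \<open>Reweighting by the gradient norm\<close>

definition seq_event :: "real \<Rightarrow> nat \<Rightarrow> nat \<Rightarrow> (nat \<Rightarrow> real) set" where
  "seq_event p k n = {\<omega>. exp (log_moment p) * sym_mean n k p \<omega> \<le> sym_mean n n p \<omega>}"

definition grad_rms :: "real \<Rightarrow> nat \<Rightarrow> (nat \<Rightarrow> real) \<Rightarrow> real" where
  "grad_rms p n \<omega> = sqrt ((\<Sum>i<n. (\<bar>\<omega> i\<bar> powr (p - 1))\<^sup>2) / n)"

definition grad_mean :: "real \<Rightarrow> real" where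
  "grad_mean p = (LINT x|p_gaussian p. (\<bar>x\<bar> powr (p - 1))\<^sup>2)"

text \<open>The probability of the event under the surface measure, expressed through Gaussians.
  Dividing the gradient norm by \<open>sqrt n\<close> in numerator and denominator leaves the
  quotient unchanged and makes the weight converge.\<close>

definition tilted_prob :: "real \<Rightarrow> nat \<Rightarrow> nat \<Rightarrow> real" where
  "tilted_prob p k n = (LINT \<omega>|gauss_seq p. grad_rms p n \<omega> * indicator (seq_event p k n) \<omega>) / (LINT \<omega>|gauss_seq p. grad_rms p n \<omega>)"

context
  fixes p :: real assumes p: "1 \<le> p"
begin

interpretation PP: product_prob_space "\<lambda>_. p_gaussian p" "UNIV :: nat set"
  by (intro product_prob_spaceI prob_space_p_gaussian p)

interpretation G: prob_space "gauss_seq p"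
  unfolding gauss_seq_def by (rule PP.P.prob_space_axioms)

lemma restrict_gauss_seq: "(\<lambda>\<omega>. restrict \<omega> {..<n}) \<in> measurable (gauss_seq p) (leb n)"
  using measurable_gauss_seq_comp[OF p] by (intro measurable_leb_restrict) simp

lemma gauss_vec_distr: "gauss_vec p n = distr (gauss_seq p) (leb n) (\<lambda>\<omega>. restrict \<omega> {..<n})"
proof -
  have "gauss_vec p n = distr (gauss_seq p) (gauss_vec p n) (\<lambda>\<omega>. restrict \<omega> {..<n})"
    using PP.distr_PiM_restrict_finite[of "{..<n}"] by (simp add: gauss_vec_def gauss_seq_def)
  also have "\<dots> = distr (gauss_seq p) (leb n) (\<lambda>\<omega>. restrict \<omega> {..<n})" by (rule distr_cong) auto
  finally show ?thesis .
qed

lemma vimage_mean_event: "(\<lambda>\<omega>. restrict \<omega> {..<n}) -` mean_event p k n \<inter> space (gauss_seq p) = seq_event p k n"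
  by (auto simp: mean_event_def seq_event_def sym_mean_restrict space_gauss_seq[OF p] space_leb)

lemma sets_seq_event: "seq_event p k n \<in> sets (gauss_seq p)"
  unfolding vimage_mean_event[symmetric] by (rule measurable_sets[OF restrict_gauss_seq sets_mean_event])

lemma emeasure_gauss_vec_event: "emeasure (gauss_vec p n) (mean_event p k n) = emeasure (gauss_seq p) (seq_event p k n)"
  unfolding gauss_vec_distr by (subst emeasure_distr[OF restrict_gauss_seq sets_mean_event]) (simp add: vimage_mean_event)

lemma grad_rms_nonneg: "0 \<le> grad_rms p n \<omega>"
  unfolding grad_rms_def by (intro real_sqrt_ge_zero divide_nonneg_nonneg sum_nonneg) auto

lemma measurable_grad_rms [measurable]: "grad_rms p n \<in> borel_measurable (gauss_seq p)"
  unfolding grad_rms_def using measurable_gauss_seq_comp[OF p] by measurable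

lemma grad_norm_restrict: "0 < n \<Longrightarrow> grad_norm p n (restrict \<omega> {..<n}) = sqrt n * grad_rms p n \<omega>"
  by (simp add: grad_norm_def grad_rms_def real_sqrt_mult[symmetric])

lemma grad_mean_pos: "0 < (grad_mean p)"
proof (rule ccontr)
  assume "\<not> 0 < (grad_mean p)"
  moreover have "0 \<le> (grad_mean p)" unfolding grad_mean_def by (intro integral_nonneg_AE AE_I2) simp
  ultimately have "(grad_mean p) = 0" by linarith
  moreover have i: "integrable (p_gaussian p) (\<lambda>x. (\<bar>x\<bar> powr (p - 1))\<^sup>2)" using p by (intro integrable_powr_square) auto
  ultimately have "AE x in p_gaussian p. (\<bar>x\<bar> powr (p - 1))\<^sup>2 = 0"
    unfolding grad_mean_def by (subst (asm) integral_nonneg_eq_0_iff_AE[OF i]) auto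
  with AE_p_gaussian_nonzero[OF p] have "AE x in p_gaussian p. False" by eventually_elim simp
  then show False using PP.M.AE_False by simp
qed

text \<open>With r for \<open>grad_rms p n \<omega>\<close> and s for its limit, |r - s| s is at
  most |r^2 - s^2|, and the latter is the modulus of a centred average with variance of order
  1/n.\<close>

lemma grad_rms_L1:
  "\<exists>C. \<forall>n\<ge>1. integrable (gauss_seq p) (grad_rms p n) \<and> (LINT \<omega>|gauss_seq p. \<bar>grad_rms p n \<omega> - sqrt (grad_mean p)\<bar>) \<le> C / sqrt n"
proof -
  let ?b = "(grad_mean p)" and ?f = "\<lambda>x. (\<bar>x\<bar> powr (p - 1))\<^sup>2 - (grad_mean p)"
  define V where "V = (LINT x|p_gaussian p. (?f x)\<^sup>2)"
  have b: "0 < sqrt ?b" using grad_mean_pos by simp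
  have i2: "integrable (p_gaussian p) (\<lambda>x. (\<bar>x\<bar> powr (p - 1))\<^sup>2)" using p by (intro integrable_powr_square) auto
  have sq: "(\<bar>x\<bar> powr (p - 1))\<^sup>2 = \<bar>x\<bar> powr (2 * (p - 1))" for x :: real
    by (simp add: power2_eq_square powr_add[symmetric])
  have i4: "integrable (p_gaussian p) (\<lambda>x. ((\<bar>x\<bar> powr (p - 1))\<^sup>2)\<^sup>2)" unfolding sq using p by (intro integrable_powr_square) auto
  have iV: "integrable (p_gaussian p) (\<lambda>x. (?f x)\<^sup>2)" using i2 i4 by (simp add: power2_diff)
  have z: "(LINT x|p_gaussian p. ?f x) = 0"
    using i2 PP.M.prob_space by (simp add: grad_mean_def)
  have "integrable (gauss_seq p) (grad_rms p n) \<and> (LINT \<omega>|gauss_seq p. \<bar>grad_rms p n \<omega> - sqrt ?b\<bar>) \<le> (V + 1) / (2 * sqrt ?b) / sqrt n"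
    if n: "1 \<le> n" for n :: nat
  proof -
    let ?D = "\<lambda>\<omega>. (\<Sum>i<n. ?f (\<omega> i)) / n"
    have D2: "integrable (gauss_seq p) (\<lambda>\<omega>. (?D \<omega>)\<^sup>2)" "(LINT \<omega>|gauss_seq p. (?D \<omega>)\<^sup>2) = V / n"
      using second_moment_sum[OF p _ z iV, of n] n by (simp_all add: V_def power_divide power2_eq_square)
    have rms: "(grad_rms p n \<omega>)\<^sup>2 - ?b = ?D \<omega>" for \<omega>
    proof -
      have "(grad_rms p n \<omega>)\<^sup>2 = (\<Sum>i<n. (\<bar>\<omega> i\<bar> powr (p - 1))\<^sup>2) / n"
        unfolding grad_rms_def by (intro real_sqrt_pow2 divide_nonneg_nonneg sum_nonneg) auto
      then show ?thesis using n by (simp add: sum_subtractf diff_divide_distrib)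
    qed
    \<comment> \<open>The inequality of arithmetic and geometric means bounds
      \<open>2 * \<bar>?D \<omega>\<bar>\<close> by two terms whose means are both of order
      \<open>1 / sqrt n\<close>; \<open>?m\<close> is the fourth root of \<open>n\<close>, chosen to
      complete the square.\<close>
    have pt: "\<bar>grad_rms p n \<omega> - sqrt ?b\<bar> \<le> (sqrt n * (?D \<omega>)\<^sup>2 + 1 / sqrt n) / (2 * sqrt ?b)" for \<omega>
    proof -
      let ?r = "grad_rms p n \<omega>" and ?s = "sqrt ?b" and ?m = "sqrt (sqrt n)"
      have "?D \<omega> = (?r - ?s) * (?r + ?s)"
        unfolding rms[symmetric] using b by (simp add: algebra_simps power2_eq_square)
      then have "\<bar>?r - ?s\<bar> * (?r + ?s) = \<bar>?D \<omega>\<bar>" using grad_rms_nonneg[of n \<omega>] b by (simp add: abs_mult)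
      moreover have "\<bar>?r - ?s\<bar> * ?s \<le> \<bar>?r - ?s\<bar> * (?r + ?s)" using grad_rms_nonneg by (intro mult_left_mono) auto
      ultimately have 1: "\<bar>?r - ?s\<bar> * ?s \<le> \<bar>?D \<omega>\<bar>" by simp
      have m: "0 < ?m" using n by simp
      have "0 \<le> (?m * \<bar>?D \<omega>\<bar> - 1 / ?m)\<^sup>2" by simp
      also have "\<dots> = sqrt n * (?D \<omega>)\<^sup>2 + 1 / sqrt n - 2 * \<bar>?D \<omega>\<bar>"
        using m n by (simp add: power2_diff power_mult_distrib power_divide)
      finally have "2 * \<bar>?D \<omega>\<bar> \<le> sqrt n * (?D \<omega>)\<^sup>2 + 1 / sqrt n" by simp
      then have "\<bar>?r - ?s\<bar> * (2 * ?s) \<le> sqrt n * (?D \<omega>)\<^sup>2 + 1 / sqrt n" using 1 by linarith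
      then show ?thesis using b by (simp add: pos_le_divide_eq)
    qed
    have iB: "integrable (gauss_seq p) (\<lambda>\<omega>. (sqrt n * (?D \<omega>)\<^sup>2 + 1 / sqrt n) / (2 * sqrt ?b))"
      using D2 by (intro integrable_divide Bochner_Integration.integrable_add integrable_mult_right) auto
    have iD: "integrable (gauss_seq p) (\<lambda>\<omega>. grad_rms p n \<omega> - sqrt ?b)"
      by (rule Bochner_Integration.integrable_bound[OF iB]) (measurable, use order_trans[OF pt abs_ge_self] in auto)
    have "integrable (gauss_seq p) (\<lambda>\<omega>. (grad_rms p n \<omega> - sqrt ?b) + sqrt ?b)"
      using iD by (intro Bochner_Integration.integrable_add) auto
    then have i: "integrable (gauss_seq p) (grad_rms p n)" by simp
    have "(LINT \<omega>|gauss_seq p. \<bar>grad_rms p n \<omega> - sqrt ?b\<bar>) \<le> (LINT \<omega>|gauss_seq p. (sqrt n * (?D \<omega>)\<^sup>2 + 1 / sqrt n) / (2 * sqrt ?b))"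
      using iD iB pt by (intro integral_mono) auto
    also have "\<dots> = (sqrt n * (V / n) + 1 / sqrt n) / (2 * sqrt ?b)"
      using D2 G.prob_space by simp
    also have "sqrt n * (V / n) = V / sqrt n" using n real_div_sqrt[of n] by (simp add: field_simps)
    also have "(V / sqrt n + 1 / sqrt n) / (2 * sqrt ?b) = (V + 1) / (2 * sqrt ?b) / sqrt n" by (simp add: add_divide_distrib mult.commute)
    finally show ?thesis using i by simp
  qed
  then show ?thesis by blast
qed

text \<open>The L1 bound is uniform over events: the weighted expectation of an indicator differs
  from \<open>sqrt (grad_mean p)\<close> times its probability by \<open>C / sqrt n\<close> at most,
  and this constant cancels in the quotient.\<close>

lemma tilted_prob_limit:
  assumes k: "1 \<le> k" shows "tilted_prob p k \<longlonglongrightarrow> 1 / 2"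
proof -
  let ?b = "sqrt (grad_mean p)" and ?P = "measure (gauss_seq p)"
  obtain C where C: "\<And>n. 1 \<le> n \<Longrightarrow> integrable (gauss_seq p) (grad_rms p n)"
    "\<And>n. 1 \<le> n \<Longrightarrow> (LINT \<omega>|gauss_seq p. \<bar>grad_rms p n \<omega> - ?b\<bar>) \<le> C / sqrt n"
    using grad_rms_L1 by blast
  have approx: "\<bar>(LINT \<omega>|gauss_seq p. grad_rms p n \<omega> * indicator B \<omega>) - ?b * ?P B\<bar> \<le> C / sqrt n"
    if n: "1 \<le> n" and B: "B \<in> sets (gauss_seq p)" for n and B
  proof -
    have i1: "integrable (gauss_seq p) (\<lambda>\<omega>. grad_rms p n \<omega> * indicator B \<omega>)" using C(1)[OF n] B by (rule integrable_real_mult_indicator[rotated])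
    have i2: "integrable (gauss_seq p) (\<lambda>\<omega>. ?b * indicator B \<omega> :: real)" using B by (intro integrable_mult_right integrable_real_indicator) (auto simp: G.emeasure_eq_measure)
    have "(LINT \<omega>|gauss_seq p. grad_rms p n \<omega> * indicator B \<omega>) - ?b * ?P B =
      (LINT \<omega>|gauss_seq p. grad_rms p n \<omega> * indicator B \<omega> - ?b * indicator B \<omega>)"
      using i1 i2 B by (simp add: Bochner_Integration.integral_diff)
    also have "\<bar>\<dots>\<bar> \<le> (LINT \<omega>|gauss_seq p. \<bar>grad_rms p n \<omega> * indicator B \<omega> - ?b * indicator B \<omega>\<bar>)"
      by (rule integral_abs_bound)
    also have "\<dots> \<le> (LINT \<omega>|gauss_seq p. \<bar>grad_rms p n \<omega> - ?b\<bar>)"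
      using i1 i2 C(1)[OF n] by (intro integral_mono) (auto simp: indicator_def)
    also have "\<dots> \<le> C / sqrt n" by (rule C(2)[OF n])
    finally show ?thesis .
  qed
  have C0: "(\<lambda>n. C / sqrt (real n)) \<longlonglongrightarrow> 0"
  proof -
    have "(\<lambda>n. C * inverse (sqrt (real n))) \<longlonglongrightarrow> C * 0"
      by (intro tendsto_mult tendsto_const tendsto_inverse_0_at_top filterlim_compose[OF sqrt_at_top filterlim_real_sequentially])
    then show ?thesis by (simp add: field_simps)
  qed
  have lim: "(\<lambda>n. (LINT \<omega>|gauss_seq p. grad_rms p n \<omega> * indicator (B n) \<omega>)) \<longlonglongrightarrow> ?b * l"
    if B: "\<And>n. B n \<in> sets (gauss_seq p)" and l: "(\<lambda>n. ?P (B n)) \<longlonglongrightarrow> l" for B l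
  proof -
    have "(\<lambda>n. (LINT \<omega>|gauss_seq p. grad_rms p n \<omega> * indicator (B n) \<omega>) - ?b * ?P (B n)) \<longlonglongrightarrow> 0"
      by (rule Lim_null_comparison[OF _ C0]) (use approx B in \<open>auto intro!: eventually_sequentiallyI[of 1]\<close>)
    from tendsto_add[OF this tendsto_mult[OF tendsto_const[of ?b] l]] show ?thesis by simp
  qed
  have num: "(\<lambda>n. (LINT \<omega>|gauss_seq p. grad_rms p n \<omega> * indicator (seq_event p k n) \<omega>)) \<longlonglongrightarrow> ?b * (1 / 2)"
    by (rule lim[OF sets_seq_event]) (use gaussian_event_limit[OF p k] in \<open>simp add: seq_event_def\<close>)
  have "(\<lambda>n. (LINT \<omega>|gauss_seq p. grad_rms p n \<omega> * indicator (space (gauss_seq p)) \<omega>)) \<longlonglongrightarrow> ?b * 1"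
    by (rule lim) (simp_all add: G.prob_space)
  then have den: "(\<lambda>n. (LINT \<omega>|gauss_seq p. grad_rms p n \<omega>)) \<longlonglongrightarrow> ?b" by (simp add: space_gauss_seq[OF p])
  have "(\<lambda>n. tilted_prob p k n) \<longlonglongrightarrow> (?b * (1 / 2)) / ?b"
    unfolding tilted_prob_def using grad_mean_pos by (intro tendsto_divide num den) auto
  then show ?thesis using grad_mean_pos by simp
qed

lemma surface_measure_event:
  assumes k: "1 \<le> k" and n: "0 < n" and total: "emeasure (surface_measure p n) (space (leb n)) = 1"
  shows "measure (surface_measure p n) (mean_event p k n) = tilted_prob p k n"
proof -
  have i: "integrable (gauss_seq p) (grad_rms p n)" using grad_rms_L1 n by auto
  let ?B = "mean_event p k n" and ?\<sigma> = "surface_measure p n"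
  have iB: "integrable (gauss_seq p) (\<lambda>\<omega>. grad_rms p n \<omega> * indicator (seq_event p k n) \<omega>)"
    using i sets_seq_event by (rule integrable_real_mult_indicator[rotated])
  have I: "(\<integral>\<^sup>+x. ennreal (grad_norm p n x) * f x \<partial>gauss_vec p n) = ennreal (sqrt n) * (\<integral>\<^sup>+\<omega>. ennreal (grad_rms p n \<omega>) * f (restrict \<omega> {..<n}) \<partial>gauss_seq p)"
    if [measurable]: "f \<in> borel_measurable (leb n)" for f
  proof -
    have "(\<integral>\<^sup>+x. ennreal (grad_norm p n x) * f x \<partial>gauss_vec p n) = (\<integral>\<^sup>+\<omega>. ennreal (grad_norm p n (restrict \<omega> {..<n})) * f (restrict \<omega> {..<n}) \<partial>gauss_seq p)"
      unfolding gauss_vec_distr by (subst nn_integral_distr[OF restrict_gauss_seq]) auto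
    also have "\<dots> = (\<integral>\<^sup>+\<omega>. ennreal (sqrt n) * (ennreal (grad_rms p n \<omega>) * f (restrict \<omega> {..<n})) \<partial>gauss_seq p)"
      using n grad_rms_nonneg by (intro nn_integral_cong) (simp add: grad_norm_restrict ennreal_mult mult.assoc)
    also have "\<dots> = ennreal (sqrt n) * (\<integral>\<^sup>+\<omega>. ennreal (grad_rms p n \<omega>) * f (restrict \<omega> {..<n}) \<partial>gauss_seq p)"
      by (intro nn_integral_cmult borel_measurable_times_ennreal measurable_compose[OF restrict_gauss_seq that]
          measurable_compose[OF measurable_grad_rms measurable_ennreal])
    finally show ?thesis .
  qed
  have full: "(\<integral>\<^sup>+x. ennreal (grad_norm p n x) \<partial>gauss_vec p n) = ennreal (sqrt n) * ennreal (LINT \<omega>|gauss_seq p. grad_rms p n \<omega>)"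
    using I[of "\<lambda>_. 1"] i grad_rms_nonneg by (simp add: nn_integral_eq_integral)
  have part: "(\<integral>\<^sup>+x. ennreal (grad_norm p n x) * indicator ?B x \<partial>gauss_vec p n)
      = ennreal (sqrt n) * ennreal (LINT \<omega>|gauss_seq p. grad_rms p n \<omega> * indicator (seq_event p k n) \<omega>)"
  proof -
    have "restrict \<omega> {..<n} \<in> ?B \<longleftrightarrow> \<omega> \<in> seq_event p k n" for \<omega>
      using vimage_mean_event[of n k] by (auto simp: space_gauss_seq[OF p])
    then have "(\<integral>\<^sup>+\<omega>. ennreal (grad_rms p n \<omega>) * indicator ?B (restrict \<omega> {..<n}) \<partial>gauss_seq p)
       = (\<integral>\<^sup>+\<omega>. ennreal (grad_rms p n \<omega> * indicator (seq_event p k n) \<omega>) \<partial>gauss_seq p)"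
      by (intro nn_integral_cong) (simp add: indicator_def)
    also have "\<dots> = ennreal (LINT \<omega>|gauss_seq p. grad_rms p n \<omega> * indicator (seq_event p k n) \<omega>)"
      using iB grad_rms_nonneg by (intro nn_integral_eq_integral) auto
    finally show ?thesis using I[of "indicator ?B"] sets_mean_event by simp
  qed
  define a b where "a = (LINT \<omega>|gauss_seq p. grad_rms p n \<omega> * indicator (seq_event p k n) \<omega>)" and "b = (LINT \<omega>|gauss_seq p. grad_rms p n \<omega>)"
  have ab: "0 \<le> a" "0 \<le> b" unfolding a_def b_def using grad_rms_nonneg by (auto intro!: integral_nonneg_AE)
  have sq: "0 < sqrt (real n)" using n by simp
  have pb: "0 < b"
  proof (rule ccontr)
    assume "\<not> 0 < b" then have "b = 0" using ab by simp
    then have "AE \<omega> in gauss_seq p. grad_rms p n \<omega> = 0"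
      unfolding b_def using grad_rms_nonneg by (subst (asm) integral_nonneg_eq_0_iff_AE[OF i]) auto
    with AE_gauss_seq_nonzero[OF p] have "AE \<omega> in gauss_seq p. False"
    proof eventually_elim
      fix \<omega> :: "nat \<Rightarrow> real" assume \<omega>: "\<forall>i. \<omega> i \<noteq> 0" "grad_rms p n \<omega> = 0"
      have "0 < (\<Sum>i<n. (\<bar>\<omega> i\<bar> powr (p - 1))\<^sup>2)" using \<omega>(1) n by (intro sum_pos) auto
      then show False using \<omega>(2) n by (simp add: grad_rms_def)
    qed
    then show False by (simp add: G.AE_False)
  qed
  have fin: "emeasure ?\<sigma> ?B < \<infinity>"
  proof -
    have "emeasure ?\<sigma> ?B \<le> emeasure ?\<sigma> (space ?\<sigma>)" by (rule emeasure_space)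
    also have "space ?\<sigma> = space (leb n)" by (simp add: surface_measure_def sets.space_closed)
    finally show ?thesis using total by (simp add: le_less_trans)
  qed
  have "emeasure ?\<sigma> ?B * (ennreal (sqrt n) * ennreal b) = ennreal (sqrt n) * ennreal a"
    using surface_measure_inv[OF p n total sets_mean_event scale_inv_mean_event[of p k n]] p k n full part
    by (simp add: a_def b_def)
  moreover have "emeasure ?\<sigma> ?B = ennreal (measure ?\<sigma> ?B)" using fin by (simp add: emeasure_eq_ennreal_measure)
  ultimately have "ennreal (measure ?\<sigma> ?B * (sqrt n * b)) = ennreal (sqrt n * a)"
    using ab by (simp add: ennreal_mult)
  then have "measure ?\<sigma> ?B * (sqrt n * b) = sqrt n * a"
    using ab by (subst (asm) ennreal_inj) auto
  then have "measure ?\<sigma> ?B = a / b" using pb sq by (simp add: field_simps)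
  then show ?thesis by (simp add: tilted_prob_def a_def b_def)
qed

end

theorem corollary1p2:
  fixes k :: nat and p :: real
    and M :: "nat \<Rightarrow> 'a measure" and X :: "nat \<Rightarrow> 'a \<Rightarrow> nat \<Rightarrow> real"
    and N :: "nat \<Rightarrow> 'b measure" and R :: "nat \<Rightarrow> 'b \<Rightarrow> real"
  assumes "1 \<le> k" and "1 \<le> p"
    and "\<And>n. k \<le> n \<Longrightarrow> prob_space (M n)"
    and "\<And>n. k \<le> n \<Longrightarrow> X n \<in> measurable (M n) (leb n)"
    and "\<And>n. k \<le> n \<Longrightarrow>
      (prob_space (N n) \<and> R n \<in> borel_measurable (N n) \<and> (AE \<omega> in N n. 0 < R n \<omega>) \<and>
         distr (M n) (leb n) (X n) = radial_law p n (N n) (R n)) \<or>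
      distr (M n) (leb n) (X n) = surface_measure p n"
  shows "(\<lambda>n. \<P>(\<omega> in M n.
           sym_mean n n p (X n \<omega>) \<ge> exp (log_moment p) * sym_mean n k p (X n \<omega>)))
         \<longlonglongrightarrow> 1 / 2"
proof -
  note k = assms(1) and p = assms(2)
  let ?Q = "\<lambda>n. \<P>(\<omega> in M n. sym_mean n n p (X n \<omega>) \<ge> exp (log_moment p) * sym_mean n k p (X n \<omega>))"
  define g where "g n = measure (gauss_seq p) (seq_event p k n)" for n
  have g: "g \<longlonglongrightarrow> 1 / 2" using gaussian_event_limit[OF p k] unfolding g_def[abs_def] seq_event_def .
  have t: "tilted_prob p k \<longlonglongrightarrow> 1 / 2" by (rule tilted_prob_limit[OF p k])
  \<comment> \<open>The two alternatives of the hypothesis may change with \<open>n\<close>. Each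
    term thus belongs to one of two fixed sequences, and both converge to 1/2.\<close>
  have Q: "?Q n = g n \<or> ?Q n = tilted_prob p k n" if n: "k \<le> n" for n
  proof -
    interpret M: prob_space "M n" by (rule assms(3)[OF n])
    note X = assms(4)[OF n]
    let ?D = "distr (M n) (leb n) (X n)" and ?B = "mean_event p k n"
    have n0: "0 < n" using k n by simp
    have inv: "scale_inv n ?B" using p k n0 by (intro scale_inv_mean_event) auto
    have "X n -` ?B \<inter> space (M n) = {\<omega> \<in> space (M n). exp (log_moment p) * sym_mean n k p (X n \<omega>) \<le> sym_mean n n p (X n \<omega>)}"
      using measurable_space[OF X] by (auto simp: mean_event_def)
    then have QD: "?Q n = measure ?D ?B" by (simp add: measure_distr[OF X sets_mean_event])
    from assms(5)[OF n] show ?thesis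
    proof (elim disjE conjE)
      assume "prob_space (N n)" "R n \<in> borel_measurable (N n)" "AE \<omega> in N n. 0 < R n \<omega>"
        "?D = radial_law p n (N n) (R n)"
      then have "emeasure ?D ?B = emeasure (gauss_seq p) (seq_event p k n)"
        using radial_law_inv[OF p n0 sets_mean_event inv] emeasure_gauss_vec_event[OF p] by simp
      then show ?thesis using QD by (simp add: measure_def g_def)
    next
      assume D: "?D = surface_measure p n"
      interpret D: prob_space ?D by (rule M.prob_space_distr[OF X])
      \<comment> \<open>Being the law of a random vector, the surface measure has mass 1, which
        excludes its degenerate cases.\<close>
      have "emeasure (surface_measure p n) (space (leb n)) = 1"
        using D.emeasure_space_1 unfolding D[symmetric] by simp
      then show ?thesis using QD surface_measure_event[OF p k n0] by (simp add: D)
    qed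
  qed
  show ?thesis
  proof (rule tendstoI)
    fix e :: real assume "0 < e"
    show "\<forall>\<^sub>F n in sequentially. dist (?Q n) (1 / 2) < e"
      using tendstoD[OF g \<open>0 < e\<close>] tendstoD[OF t \<open>0 < e\<close>] eventually_ge_at_top[of k]
    proof eventually_elim
      fix n assume "dist (g n) (1 / 2) < e" "dist (tilted_prob p k n) (1 / 2) < e" "k \<le> n"
      then show "dist (?Q n) (1 / 2) < e" using Q[OF \<open>k \<le> n\<close>] by (elim disjE) simp_all
    qed
  qed
qed

end
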